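(* For each $\mathbf{k}\in\mathbb{C}^4$, it is decidable whether or not $\mathbf{x},\mathbf{y}\in V_{\mathbf{k}}(\mathbb{Z})$ are in the same $\Gamma_{\mathbf{k}}$-orbit. That is, there exists an algorithm which terminates in finitely many steps and outputs "yes" or "no" according to whether $\mathbf{x},\mathbf{y}\in V_{\mathbf{k}}(\mathbb{Z})$ are in the same $\Gamma_{\mathbf{k}}$-orbit.
   Context: For $\mathbf{k}=(k_1,k_2,k_3,k_4)\in\mathbb{C}^4$ put $\alpha_1=k_1k_2+k_3k_4$, $\alpha_2=k_1k_4+k_2k_3$, $\alpha_3=k_1k_3+k_2k_4$, $\beta=4-\sum_{i=1}^4k_i^2-\prod_{i=1}^4k_i$. $V_{\mathbf{k}}$ is the affine cubic surface $x_1^2+x_2^2+x_3^2+x_1x_2x_3-\alpha_1x_1-\alpha_2x_2-\alpha_3x_3-\beta=0$, and $V_{\mathbf{k}}(\mathbb{Z})$ is its set of solutions $\mathbf{x}=(x_1,x_2,x_3)\in\mathbb{Z}^3$. $\Gamma_{\mathbf{k}}$ is the group generated by the three Vieta involutions $\mathcal{V}_1(x_1,x_2,x_3)=(\alpha_1-x_2x_3-x_1,x_2,x_3)$, $\mathcal{V}_2(x_1,x_2,x_3)=(x_1,\alpha_2-x_3x_1-x_2,x_3)$, $\mathcal{V}_3(x_1,x_2,x_3)=(x_1,x_2,\alpha_3-x_1x_2-x_3)$. It acts on $V_{\mathbf{k}}(\mathbb{Z})$ by $\gamma\cdot\mathbf{x}=\gamma(\mathbf{x})$. *)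

theory Defs
  imports "HOL-Algebra.Elementary_Groups" "HOL-Algebra.Group_Action"
    Complex_Main "HOL-Library.Nat_Bijection"
begin

section \<open>The surfaces and the group generated by the Vieta involutions\<close>

type_synonym 'a triple = "'a \<times> 'a \<times> 'a"
type_synonym params = "complex \<times> complex \<times> complex \<times> complex"

fun alpha1 :: "params \<Rightarrow> complex" where
  "alpha1 (k1, k2, k3, k4) = k1 * k2 + k3 * k4"

fun alpha2 :: "params \<Rightarrow> complex" where
  "alpha2 (k1, k2, k3, k4) = k1 * k4 + k2 * k3"

fun alpha3 :: "params \<Rightarrow> complex" where
  "alpha3 (k1, k2, k3, k4) = k1 * k3 + k2 * k4"

fun beta :: "params \<Rightarrow> complex" where
  "beta (k1, k2, k3, k4) = 4 - (k1\<^sup>2 + k2\<^sup>2 + k3\<^sup>2 + k4\<^sup>2) - k1 * k2 * k3 * k4"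

definition surface :: "params \<Rightarrow> complex triple set" where
  "surface k = {(x1, x2, x3).
     x1\<^sup>2 + x2\<^sup>2 + x3\<^sup>2 + x1 * x2 * x3
       - alpha1 k * x1 - alpha2 k * x2 - alpha3 k * x3 - beta k = 0}"

fun of_int_triple :: "int triple \<Rightarrow> complex triple" where
  "of_int_triple (x1, x2, x3) = (of_int x1, of_int x2, of_int x3)"

definition integer_points :: "params \<Rightarrow> int triple set" where
  "integer_points k = {x. of_int_triple x \<in> surface k}"

fun vieta1 :: "params \<Rightarrow> complex triple \<Rightarrow> complex triple" where
  "vieta1 k (x1, x2, x3) = (alpha1 k - x2 * x3 - x1, x2, x3)"

fun vieta2 :: "params \<Rightarrow> complex triple \<Rightarrow> complex triple" where
  "vieta2 k (x1, x2, x3) = (x1, alpha2 k - x3 * x1 - x2, x3)"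

fun vieta3 :: "params \<Rightarrow> complex triple \<Rightarrow> complex triple" where
  "vieta3 k (x1, x2, x3) = (x1, x2, alpha3 k - x1 * x2 - x3)"

text \<open>The involutions are taken as permutations of complex affine 3-space: the parameters
  are arbitrary complex numbers, and an involution maps integer points to integer points only
  if the corresponding \<open>alpha\<close> is an integer (see \<open>Gamma_integer_points\<close> below).\<close>

definition Gamma :: "params \<Rightarrow> (complex triple \<Rightarrow> complex triple) monoid" where
  "Gamma k = subgroup_generated (BijGroup UNIV) {vieta1 k, vieta2 k, vieta3 k}"

definition same_orbit :: "params \<Rightarrow> int triple \<Rightarrow> int triple \<Rightarrow> bool" where
  "same_orbit k x y \<longleftrightarrow> of_int_triple y \<in> orbit (Gamma k) (\<lambda>\<gamma>. \<gamma>) (of_int_triple x)"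

lemma vieta_involution:
  "vieta1 k (vieta1 k x) = x" "vieta2 k (vieta2 k x) = x" "vieta3 k (vieta3 k x) = x"
  by (cases x; simp)+

lemma vieta_in_BijGroup:
  "{vieta1 k, vieta2 k, vieta3 k} \<subseteq> carrier (BijGroup UNIV)"
  by (auto simp: BijGroup_def Bij_def intro!: involuntory_imp_bij vieta_involution)

lemma carrier_Gamma:
  "carrier (Gamma k) = generate (BijGroup UNIV) {vieta1 k, vieta2 k, vieta3 k}"
  using vieta_in_BijGroup[of k] by (simp add: Gamma_def carrier_subgroup_generated Int_absorb1)

lemma group_Gamma: "group (Gamma k)"
  by (simp add: Gamma_def group.group_subgroup_generated group_BijGroup)

lemma Gamma_induct [consumes 1, case_names one vieta1 vieta2 vieta3 mult]:
  assumes "g \<in> carrier (Gamma k)"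
    and "P id" "P (vieta1 k)" "P (vieta2 k)" "P (vieta3 k)"
    and mult: "\<And>g h. P g \<Longrightarrow> P h \<Longrightarrow> P (g \<circ> h)"
  shows "P g"
proof -
  let ?B = "BijGroup (UNIV :: complex triple set)"
  have B: "carrier ?B = {f. bij f}"
    by (auto simp: BijGroup_def Bij_def)
  have mul: "f \<otimes>\<^bsub>?B\<^esub> h = f \<circ> h" if "bij f" "bij h" for f h
    using that by (auto simp: BijGroup_def Bij_def compose_def fun_eq_iff)
  have one_id: "\<one>\<^bsub>?B\<^esub> = id"
    by (auto simp: BijGroup_def)
  interpret G: group ?B by (rule group_BijGroup)
  have inv_id: "inv\<^bsub>?B\<^esub> v = v" if "v \<in> {vieta1 k, vieta2 k, vieta3 k}" for v
  proof (rule G.inv_equality)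
    have "bij v" using that vieta_in_BijGroup[of k] B by auto
    then show "v \<otimes>\<^bsub>?B\<^esub> v = \<one>\<^bsub>?B\<^esub>"
      using that by (auto simp: mul one_id fun_eq_iff vieta_involution simp del: split_paired_All)
  qed (use that vieta_in_BijGroup[of k] in auto)
  have gen: "h \<in> carrier ?B" if "h \<in> generate ?B {vieta1 k, vieta2 k, vieta3 k}" for h
    using that G.generate_in_carrier vieta_in_BijGroup by blast
  have "g \<in> generate ?B {vieta1 k, vieta2 k, vieta3 k}"
    using assms(1) carrier_Gamma by simp
  then show ?thesis
  proof (induction rule: generate.induct)
    case one show ?case unfolding one_id by (rule assms(2))
  next
    case (incl h) then show ?case using assms(3-5) by auto
  next
    case (inv h) then show ?case using assms(3-5) inv_id by auto
  next
    case (eng h1 h2)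
    then have "h1 \<otimes>\<^bsub>?B\<^esub> h2 = h1 \<circ> h2"
      using mul[of h1 h2] gen[of h1] gen[of h2] B by blast
    then show ?case using mult[OF eng.IH] by (simp only:)
  qed
qed

lemma Gamma_surface:
  assumes "g \<in> carrier (Gamma k)" "x \<in> surface k"
  shows "g x \<in> surface k"
proof -
  have "\<forall>x\<in>surface k. g x \<in> surface k"
    using assms(1)
  proof (induction rule: Gamma_induct)
    case (mult g h) then show ?case by (simp del: split_paired_All)
  qed (auto simp: surface_def algebra_simps power2_eq_square)
  with assms(2) show ?thesis by blast
qed

lemma Gamma_integer_points:
  assumes "alpha1 k \<in> \<int>" "alpha2 k \<in> \<int>" "alpha3 k \<in> \<int>"
    and "g \<in> carrier (Gamma k)" "x \<in> of_int_triple ` integer_points k"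
  shows "g x \<in> of_int_triple ` integer_points k"
proof -
  have eq: "of_int_triple ` integer_points k = surface k \<inter> (\<int> \<times> \<int> \<times> \<int>)"
    by (force simp: integer_points_def image_iff elim!: Ints_cases)
  have "\<forall>x\<in>\<int> \<times> \<int> \<times> \<int>. g x \<in> \<int> \<times> \<int> \<times> \<int>"
    using assms(4)
  proof (induction rule: Gamma_induct)
    case (mult g h) then show ?case by (metis comp_apply)
  qed (use assms(1-3) in auto)
  then show ?thesis
    using assms(5) Gamma_surface[OF assms(4)] unfolding eq by blast
qed


section \<open>Decidability\<close>

text \<open>Algorithms are programs for partial recursive functions (Kleene) on finite sequences of
  natural numbers; \<open>computes f xs y\<close> says that \<open>f\<close> terminates on input \<open>xs\<close> with output \<open>y\<close>.
  In \<open>Pr\<close> and \<open>Mn\<close> the first argument is the recursion and the search variable, respectively.\<close>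

datatype recf =
    Zero
  | Succ
  | Proj nat
  | Comp recf "recf list"
  | Pr recf recf
  | Mn recf

inductive computes :: "recf \<Rightarrow> nat list \<Rightarrow> nat \<Rightarrow> bool" where
  zero: "computes Zero xs 0"
| succ: "computes Succ [x] (Suc x)"
| proj: "i < length xs \<Longrightarrow> computes (Proj i) xs (xs ! i)"
| comp: "list_all2 (\<lambda>g y. computes g xs y) gs ys \<Longrightarrow> computes f ys z
    \<Longrightarrow> computes (Comp f gs) xs z"
| pr_0: "computes f xs z \<Longrightarrow> computes (Pr f g) (0 # xs) z"
| pr_Suc: "computes (Pr f g) (n # xs) y \<Longrightarrow> computes g (n # y # xs) z
    \<Longrightarrow> computes (Pr f g) (Suc n # xs) z"
| mn: "computes f (n # xs) 0 \<Longrightarrow> (\<And>m. m < n \<Longrightarrow> \<exists>y>0. computes f (m # xs) y)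
    \<Longrightarrow> computes (Mn f) xs n"

lemma computes_unique:
  "computes f xs y \<Longrightarrow> computes f xs z \<Longrightarrow> y = z"
proof (induction arbitrary: z rule: computes.induct)
  case (zero xs)
  then show ?case by (auto elim: computes.cases)
next
  case (succ x)
  then show ?case by (auto elim: computes.cases)
next
  case (proj i xs)
  from proj(2) show ?case by (auto elim: computes.cases)
next
  case (comp xs gs ys f w)
  from comp.prems obtain ys' where
    ys': "list_all2 (\<lambda>g y. computes g xs y) gs ys'" "computes f ys' z"
    by (auto elim: computes.cases)
  have "ys = ys'"
    using comp(1) ys'(1) by (auto simp: list_all2_conv_all_nth intro!: nth_equalityI)
  with ys'(2) show ?case using comp.IH(2)[of z] by simp
next
  case (pr_0 f xs w g)
  from pr_0(3) show ?case by cases (use pr_0 in auto)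
next
  case (pr_Suc f g n xs y w)
  from pr_Suc(5) show ?case by cases (use pr_Suc in auto)
next
  case (mn f n xs)
  from mn(4) obtain
    z: "computes f (z # xs) 0" "\<And>m. m < z \<Longrightarrow> \<exists>y>0. computes f (m # xs) y"
    by cases auto
  show ?case
    using mn(2) mn(3) z by (metis linorder_neqE_nat less_irrefl)
qed

text \<open>\<open>int_encode\<close> is the standard effective bijection between integers and naturals.\<close>

fun encode_triple :: "int triple \<Rightarrow> nat list" where
  "encode_triple (x1, x2, x3) = [int_encode x1, int_encode x2, int_encode x3]"

text \<open>The inputs of the decision problem are pairs of points of \<open>D\<close>.
  Output 1 means yes, output 0 means no.\<close>

definition decidable_on :: "int triple set \<Rightarrow> (int triple \<Rightarrow> int triple \<Rightarrow> bool) \<Rightarrow> bool" where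
  "decidable_on D R \<longleftrightarrow>
     (\<exists>f. \<forall>x\<in>D. \<forall>y\<in>D. computes f (encode_triple x @ encode_triple y) (if R x y then 1 else 0))"

end

theory Submission
  imports Defs "HOL-Computational_Algebra.Fundamental_Theorem_Algebra"
begin

text \<open>
  Two integer points lie in one orbit iff a word in the three involutions takes one to the
  other, and the parameter enters only through \<open>\<alpha> = (\<alpha>\<^sub>1,
  \<alpha>\<^sub>2, \<alpha>\<^sub>3)\<close> and \<open>\<beta>\<close>. Words may leave the
  integer points, and shortest words have no evident bound. An algorithm may be chosen for each
  parameter separately, so it may contain constants and a finite table that depend on the
  parameter. The proof shows (\<open>orbits_by_lattice_paths\<close>) that one kind of test
  always suffices: two integer points are in one orbit iff they are joined by a walk in a
  lattice \<open>(1/N)\<int>\<^sup>3\<close> whose length is bounded in terms of their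
  coordinates, or if each of them is joined by such a walk to a point of a finite set, and the
  resulting pair occurs in a finite table of equivalent pairs. The walks use only involutions
  whose coefficient lies in \<open>(1/N)\<int>\<close>. There are finitely many walks of a given
  length, so the test is recursive (\<open>decidable_on_template\<close>). Three cases remain.

  \<^emph>\<open>All coefficients are rational.\<close> Fix a valuation ring of
  \<open>\<complex>\<close>. If a reduced word that starts at an integer point makes a
  coordinate larger than 1, \<open>\<beta>\<close> and all coefficients, then every later step
  makes the moved coordinate still larger (\<open>rising_step\<close>), so that the word cannot
  end at an integer point. As this holds for all valuation rings, a reduced word between integer
  points stays in a lattice \<open>(1/N)\<int>\<^sup>3\<close>. In the ordinary absolute value
  coordinates may shrink again, but along a shortest word the sum of their absolute values has
  no local maximum above a constant (\<open>lattice_local_max\<close>). A shortest word thus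
  stays in a box that is determined by its end points, and its length is at most the number of
  lattice points in the box, because it meets no point twice.

  \<^emph>\<open>Exactly one coefficient \<open>\<alpha>\<^sub>k\<close> is irrational.\<close>
  The equation then prescribes the coordinate \<open>x\<^sub>k\<close> of the integer points.
  The other two involutions preserve a lattice in this fibre, and the previous argument applies
  to them. If \<open>V\<^sub>k\<close> is used at a point whose other two coordinates are large,
  then all coordinates become large, with the last moved one the largest, and this remains so
  along reduced words (\<open>escaped_forever\<close>), so the fibre is never reached again.
  Hence the first use of \<open>V\<^sub>k\<close> in a word between integer points is at one of
  finitely many lattice points, and so is the last one. These points give the table.

  \<^emph>\<open>At least two coefficients are irrational.\<close> A
  \<open>\<rat>\<close>-linear functional on \<open>\<complex>\<close> that vanishes at 1 but
  not at these two coefficients turns the equation of the surface into a linear equation for the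
  integer points. Comparing sizes on this plane, one finds an index \<open>k\<close> such that
  \<open>x\<^sub>k\<close>, or the coordinate \<open>x\<^sub>k\<close> of \<open>V\<^sub>k
  x\<close>, is bounded; it then takes finitely many values. So after at most one step, an
  integer point lies on one of finitely many lines. If one of these lines contains infinitely
  many of the points, then it lies in the surface: it consists of points \<open>(u + m r, v + n
  r, \<tau>)\<close>, and the alternating words in \<open>V\<^sub>i\<close> and
  \<open>V\<^sub>j\<close> act on it by \<open>W \<mapsto> q W + constant\<close> with \<open>q
  = n / m\<close>. The numbers \<open>W\<close> are irrational, so no integer point is met
  within the fibre, and one has to show that after leaving the fibre by \<open>V\<^sub>k\<close>
  no integer point is reached either, provided that \<open>r\<close> is large. By the escape
  argument it suffices that two consecutive values of \<open>W\<close> are large. If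
  \<open>\<bar>q\<bar> > 1\<close>, then all of them are (\<open>no_return_expanding\<close>).
  If \<open>\<bar>q\<bar> = 1\<close>, then \<open>\<alpha>\<^sub>i\<close> is replaced by
  another number that satisfies the same equations over \<open>\<rat>\<close>, which preserves
  every identity that says that a word leads to an integer point; the two sequences
  \<open>W\<close> move apart linearly, so that one of them is large
  (\<open>no_return_parabolic\<close>). If \<open>\<bar>q\<bar> < 1\<close>, then a prime
  \<open>p\<close> divides the denominator of \<open>q\<close>, and two algebraic values of
  \<open>\<alpha>\<^sub>i\<close> give sequences that move apart exponentially in the
  \<open>p\<close>-adic sense, so that the non-archimedean argument bounds the length of the
  alternating part (\<open>no_return_contracting\<close>). Outside a finite set, the only
  integer points equivalent to an integer point are therefore itself and at most one neighbour.
\<close>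

section \<open>Recursive functions\<close>

definition recursive :: "nat \<Rightarrow> (nat list \<Rightarrow> nat) \<Rightarrow> bool" where
  "recursive k F \<longleftrightarrow> (\<exists>f. \<forall>xs. length xs = k \<longrightarrow> computes f xs (F xs))"

named_theorems recursive_intros

lemma recursive_cong:
  assumes "recursive k F" "\<And>xs. length xs = k \<Longrightarrow> F xs = G xs"
  shows "recursive k G"
  using assms unfolding recursive_def by metis

lemma recursive_nth [recursive_intros]: "i < k \<Longrightarrow> recursive k (\<lambda>xs. xs ! i)"
  unfolding recursive_def using computes.proj by blast

lemma recursive_comp:
  assumes F: "recursive (length Gs) F" and Gs: "\<And>G. G \<in> set Gs \<Longrightarrow> recursive k G"
  shows "recursive k (\<lambda>xs. F (map (\<lambda>G. G xs) Gs))"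
proof -
  obtain f where f: "\<And>xs. length xs = length Gs \<Longrightarrow> computes f xs (F xs)"
    using F unfolding recursive_def by blast
  obtain g where g: "\<And>G xs. G \<in> set Gs \<Longrightarrow> length xs = k \<Longrightarrow> computes (g G) xs (G xs)"
    using Gs unfolding recursive_def by metis
  have "computes (Comp f (map g Gs)) xs (F (map (\<lambda>G. G xs) Gs))" if "length xs = k" for xs
    by (rule computes.comp[where ys = "map (\<lambda>G. G xs) Gs"])
       (use that f g in \<open>auto simp: list_all2_conv_all_nth\<close>)
  then show ?thesis unfolding recursive_def by blast
qed

lemma recursive_Suc [recursive_intros]:
  assumes "recursive k F" shows "recursive k (\<lambda>xs. Suc (F xs))"
proof -
  have "recursive (length [F]) (\<lambda>ys. Suc (ys ! 0))"
    unfolding recursive_def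
    by (rule exI[of _ Succ]) (auto simp: length_Suc_conv intro: computes.succ)
  from recursive_comp[OF this, of k] assms show ?thesis by simp
qed

lemma recursive_const [recursive_intros]: "recursive k (\<lambda>xs. c)"
proof (induction c)
  case 0
  show ?case unfolding recursive_def using computes.zero by blast
qed (rule recursive_Suc)

lemma recursive_drop:
  assumes "recursive k F" shows "recursive (k + d) (\<lambda>xs. F (drop d xs))"
proof -
  let ?Gs = "map (\<lambda>i xs. xs ! i) [d..<d + k]"
  have "recursive (k + d) (\<lambda>xs. F (map (\<lambda>G. G xs) ?Gs))"
    using assms by (intro recursive_comp) (auto intro!: recursive_nth)
  then show ?thesis
    by (rule recursive_cong) (auto intro!: arg_cong[of _ _ F] nth_equalityI)
qed

lemmas recursive_drop1 = recursive_drop[where d = 1, simplified]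
lemmas recursive_drop2 = recursive_drop[where d = 2]

text \<open>The step function receives the counter and the previous value in front of the parameters,
as in \<open>Pr\<close>. In the premise these are components of one argument list, so that the
introduction rules can treat them like any other argument.\<close>

lemma recursive_rec_nat [recursive_intros]:
  assumes A: "recursive k A" and G: "recursive k G"
    and B: "recursive (k + 2) (\<lambda>zs. B (zs ! 0) (zs ! 1) (drop 2 zs))"
  shows "recursive k (\<lambda>xs. rec_nat (A xs) (\<lambda>n y. B n y xs) (G xs))"
proof -
  obtain a where a: "\<And>xs. length xs = k \<Longrightarrow> computes a xs (A xs)"
    using A unfolding recursive_def by blast
  obtain b where "\<And>zs. length zs = k + 2 \<Longrightarrow> computes b zs (B (zs ! 0) (zs ! 1) (drop 2 zs))"
    using B unfolding recursive_def by blast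
  from this[of "n # y # xs" for n y xs]
  have b: "\<And>n y xs. length xs = k \<Longrightarrow> computes b (n # y # xs) (B n y xs)"
    by simp
  have pr: "computes (Pr a b) (n # xs) (rec_nat (A xs) (\<lambda>n y. B n y xs) n)" if "length xs = k" for n xs
    by (induction n) (auto intro!: computes.pr_0 computes.pr_Suc a b that)
  have "recursive (Suc k) (\<lambda>zs. rec_nat (A (tl zs)) (\<lambda>n y. B n y (tl zs)) (hd zs))"
    unfolding recursive_def
    by (rule exI[of _ "Pr a b"]) (auto simp: length_Suc_conv intro: pr)
  then have R: "recursive (length (G # map (\<lambda>i xs. xs ! i) [0..<k]))
      (\<lambda>zs. rec_nat (A (tl zs)) (\<lambda>n y. B n y (tl zs)) (hd zs))"
    by simp
  have "recursive k g" if "g \<in> set (G # map (\<lambda>i xs. xs ! i) [0..<k])" for g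
    using that G by (auto intro: recursive_nth)
  from recursive_comp[OF R this]
  have *: "recursive k (\<lambda>xs. rec_nat (A (map (\<lambda>i. xs ! i) [0..<k]))
      (\<lambda>n y. B n y (map (\<lambda>i. xs ! i) [0..<k])) (G xs))"
    by (simp add: comp_def)
  show ?thesis
  proof (rule recursive_cong[OF *])
    fix xs :: "nat list" assume "length xs = k"
    then have "map (\<lambda>i. xs ! i) [0..<k] = xs" using map_nth[of xs] by simp
    then show "rec_nat (A (map (\<lambda>i. xs ! i) [0..<k])) (\<lambda>n y. B n y (map (\<lambda>i. xs ! i) [0..<k])) (G xs)
      = rec_nat (A xs) (\<lambda>n y. B n y xs) (G xs)" by simp
  qed
qed

text \<open>Unbounded search serves for quotients and square roots, where the existence of a solution
is obvious and an explicit bound for it would have to be computed as well.\<close>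

lemma recursive_Least:
  assumes P: "recursive (Suc k) (\<lambda>zs. of_bool (\<not> P (zs ! 0) (drop (Suc 0) zs)))"
    and ex: "\<And>xs. length xs = k \<Longrightarrow> \<exists>n. P n xs"
  shows "recursive k (\<lambda>xs. LEAST n. P n xs)"
proof -
  obtain f where f: "\<And>n xs. length xs = k \<Longrightarrow> computes f (n # xs) (of_bool (\<not> P n xs))"
  proof -
    obtain f where "\<And>zs. length zs = Suc k \<Longrightarrow> computes f zs (of_bool (\<not> P (zs ! 0) (drop (Suc 0) zs)))"
      using P unfolding recursive_def by blast
    from that[of f] this[of "n # xs" for n xs] show thesis by simp
  qed
  have "computes (Mn f) xs (LEAST n. P n xs)" if xs: "length xs = k" for xs
  proof (rule computes.mn)
    have "P (LEAST n. P n xs) xs" using ex[OF xs] by (rule LeastI_ex)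
    then show "computes f ((LEAST n. P n xs) # xs) 0" using f[OF xs] by (metis of_bool_eq(1))
    show "\<exists>y>0. computes f (m # xs) y" if "m < (LEAST n. P n xs)" for m
      using f[OF xs, of m] not_less_Least[OF that] by (intro exI[of _ 1]) auto
  qed
  then show ?thesis unfolding recursive_def by blast
qed

lemma recursive_add [recursive_intros]:
  assumes "recursive k F" "recursive k G" shows "recursive k (\<lambda>xs. F xs + G xs)"
proof -
  have "recursive k (\<lambda>xs. rec_nat (G xs) (\<lambda>n y. Suc y) (F xs))"
    by (intro recursive_intros assms assms[THEN recursive_drop2]) auto
  moreover have "rec_nat b (\<lambda>n y. Suc y) a = a + b" for a b by (induction a) auto
  ultimately show ?thesis by simp
qed

lemma recursive_mult [recursive_intros]:
  assumes "recursive k F" "recursive k G" shows "recursive k (\<lambda>xs. F xs * G xs)"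
proof -
  have "recursive k (\<lambda>xs. rec_nat 0 (\<lambda>n y. y + G xs) (F xs))"
    by (intro recursive_intros assms assms[THEN recursive_drop2]) auto
  moreover have "rec_nat 0 (\<lambda>n y. y + b) a = a * b" for a b by (induction a) auto
  ultimately show ?thesis by simp
qed

lemma recursive_diff [recursive_intros]:
  assumes "recursive k F" "recursive k G" shows "recursive k (\<lambda>xs. F xs - G xs)"
proof -
  have pred: "rec_nat 0 (\<lambda>n y. n) a = a - Suc 0" for a by (cases a) auto
  have "recursive k (\<lambda>xs. rec_nat (F xs) (\<lambda>n y. rec_nat 0 (\<lambda>n y. n) y) (G xs))"
    by (intro recursive_intros assms assms[THEN recursive_drop2]) auto
  moreover have "rec_nat a (\<lambda>n y. rec_nat 0 (\<lambda>n y. n) y) b = a - b" for a b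
    by (induction b) (auto simp: pred)
  ultimately show ?thesis by simp
qed

lemma recursive_power [recursive_intros]:
  assumes "recursive k F" "recursive k G" shows "recursive k (\<lambda>xs. F xs ^ G xs)"
proof -
  have "recursive k (\<lambda>xs. rec_nat 1 (\<lambda>n y. F xs * y) (G xs))"
    by (intro recursive_intros assms assms[THEN recursive_drop2]) auto
  moreover have "rec_nat 1 (\<lambda>n y. b * y) a = b ^ a" for a b :: nat by (induction a) auto
  ultimately show ?thesis by simp
qed

definition decidable :: "nat \<Rightarrow> (nat list \<Rightarrow> bool) \<Rightarrow> bool" where
  "decidable k P \<longleftrightarrow> recursive k (\<lambda>xs. of_bool (P xs))"

lemma decidable_cong:
  assumes "decidable k P" "\<And>xs. length xs = k \<Longrightarrow> P xs = Q xs"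
  shows "decidable k Q"
  using assms(1) unfolding decidable_def by (rule recursive_cong) (simp add: assms(2))

lemma decidable_not [recursive_intros]:
  assumes "decidable k P" shows "decidable k (\<lambda>xs. \<not> P xs)"
proof -
  have "recursive k (\<lambda>xs. 1 - of_bool (P xs))"
    using assms unfolding decidable_def by (intro recursive_intros)
  then show ?thesis unfolding decidable_def by (rule recursive_cong) auto
qed

lemma decidable_conj [recursive_intros]:
  assumes "decidable k P" "decidable k Q" shows "decidable k (\<lambda>xs. P xs \<and> Q xs)"
proof -
  have "recursive k (\<lambda>xs. of_bool (P xs) * of_bool (Q xs))"
    using assms unfolding decidable_def by (intro recursive_intros)
  then show ?thesis unfolding decidable_def by (rule recursive_cong) auto
qed

lemma decidable_disj [recursive_intros]:
  assumes "decidable k P" "decidable k Q" shows "decidable k (\<lambda>xs. P xs \<or> Q xs)"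
  using decidable_not[OF decidable_conj[OF decidable_not decidable_not], OF assms] by simp

lemma decidable_le [recursive_intros]:
  assumes "recursive k F" "recursive k G" shows "decidable k (\<lambda>xs. F xs \<le> G xs)"
proof -
  have "recursive k (\<lambda>xs. 1 - (F xs - G xs))" by (intro recursive_intros assms)
  then show ?thesis unfolding decidable_def by (rule recursive_cong) auto
qed

lemma decidable_less [recursive_intros]:
  assumes "recursive k F" "recursive k G" shows "decidable k (\<lambda>xs. F xs < G xs)"
  using decidable_not[OF decidable_le[OF assms(2,1)]] by (simp add: not_le)

lemma decidable_eq [recursive_intros]:
  assumes "recursive k F" "recursive k G" shows "decidable k (\<lambda>xs. F xs = G xs)"
  using decidable_conj[OF decidable_le[OF assms] decidable_le[OF assms(2,1)]]
  by (rule decidable_cong) auto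

lemma decidable_const [recursive_intros]: "decidable k (\<lambda>xs. c)"
  unfolding decidable_def by (rule recursive_const)

lemma recursive_if [recursive_intros]:
  assumes "decidable k P" "recursive k F" "recursive k G"
  shows "recursive k (\<lambda>xs. if P xs then F xs else G xs)"
proof -
  have "recursive k (\<lambda>xs. of_bool (P xs) * F xs + (1 - of_bool (P xs)) * G xs)"
    using assms unfolding decidable_def by (intro recursive_intros)
  then show ?thesis by (rule recursive_cong) auto
qed

text \<open>A bounded quantifier is a primitive recursion that runs through the bound.\<close>

lemma decidable_Ex_less [recursive_intros]:
  assumes "decidable (k + 2) (\<lambda>zs. P (zs ! 0) (drop 2 zs))" "recursive k G"
  shows "decidable k (\<lambda>xs. \<exists>n<G xs. P n xs)"
proof -
  have "recursive k (\<lambda>xs. rec_nat 0 (\<lambda>n y. if P n xs then 1 else y) (G xs))"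
    by (intro recursive_intros assms) auto
  moreover have "rec_nat 0 (\<lambda>n y. if P n xs then 1 else y) m = of_bool (\<exists>n<m. P n xs)" for m xs
    by (induction m) (auto simp: less_Suc_eq)
  ultimately show ?thesis unfolding decidable_def by (rule recursive_cong)
qed

lemma recursive_LEAST [recursive_intros]:
  assumes "decidable (Suc k) (\<lambda>zs. P (zs ! 0) (drop (Suc 0) zs))"
    and "\<And>xs. length xs = k \<Longrightarrow> \<exists>n. P n xs"
  shows "recursive k (\<lambda>xs. LEAST n. P n xs)"
  by (rule recursive_Least) (use assms(2) decidable_not[OF assms(1)] in \<open>simp_all add: decidable_def\<close>)

lemma recursive_div [recursive_intros]:
  assumes "recursive k F" "recursive k G" shows "recursive k (\<lambda>xs. F xs div G xs)"
proof -
  (* The first disjunct stops the search when the divisor is 0, with the value 0 that div has in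
     this case. *)
  have "recursive k (\<lambda>xs. LEAST q. G xs = 0 \<or> F xs < Suc q * G xs)"
  proof (intro recursive_intros assms assms[THEN recursive_drop1])
    show "\<exists>q. G xs = 0 \<or> F xs < Suc q * G xs" for xs
      using dividend_less_div_times[of "G xs" "F xs"]
      by (intro exI[of _ "F xs div G xs"]) (auto simp: add.commute)
  qed auto
  moreover have "(LEAST q. b = 0 \<or> a < Suc q * b) = a div b" for a b :: nat
  proof (cases "b = 0")
    case False
    show ?thesis
    proof (rule Least_equality)
      show "b = 0 \<or> a < Suc (a div b) * b"
        using False dividend_less_div_times[of b a] by (simp add: add.commute)
      show "a div b \<le> q" if "b = 0 \<or> a < Suc q * b" for q
        using that False less_mult_imp_div_less[of a "Suc q" b] by simp
    qed
  qed simp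
  ultimately show ?thesis by simp
qed

lemma recursive_mod [recursive_intros]:
  assumes "recursive k F" "recursive k G" shows "recursive k (\<lambda>xs. F xs mod G xs)"
proof -
  have "recursive k (\<lambda>xs. F xs - G xs * (F xs div G xs))" by (intro recursive_intros assms)
  then show ?thesis by (simp add: minus_mult_div_eq_mod)
qed

text \<open>The pairing function \<open>(a + b)\<^sup>2 + a\<close> is decoded by one integer square
root: \<open>(a + b)\<^sup>2\<close> is the largest square not above it. It allows a recursion
to carry a lattice point along in a single number.\<close>

definition sq_pair :: "nat \<Rightarrow> nat \<Rightarrow> nat" where "sq_pair a b = (a + b) * (a + b) + a"
definition sq_root :: "nat \<Rightarrow> nat" where "sq_root n = (LEAST s. n < Suc s * Suc s)"
definition sq_fst :: "nat \<Rightarrow> nat" where "sq_fst n = n - sq_root n * sq_root n"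
definition sq_snd :: "nat \<Rightarrow> nat" where "sq_snd n = sq_root n - sq_fst n"

lemma root_pair: "sq_root (sq_pair a b) = a + b"
  unfolding sq_root_def
proof (rule Least_equality)
  show "sq_pair a b < Suc (a + b) * Suc (a + b)" by (simp add: sq_pair_def)
  show "a + b \<le> s" if "sq_pair a b < Suc s * Suc s" for s
  proof (rule ccontr)
    assume "\<not> a + b \<le> s"
    then have "Suc s * Suc s \<le> (a + b) * (a + b)" by (intro mult_le_mono) auto
    with that show False by (simp add: sq_pair_def)
  qed
qed

lemma first_pair [simp]: "sq_fst (sq_pair a b) = a" and second_pair [simp]: "sq_snd (sq_pair a b) = b"
  by (simp_all add: sq_fst_def sq_snd_def root_pair) (simp_all add: sq_pair_def)

lemma recursive_pair [recursive_intros]: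
  "recursive k F \<Longrightarrow> recursive k G \<Longrightarrow> recursive k (\<lambda>xs. sq_pair (F xs) (G xs))"
  unfolding sq_pair_def by (intro recursive_intros)

lemma recursive_root [recursive_intros]:
  assumes "recursive k F" shows "recursive k (\<lambda>xs. sq_root (F xs))"
  unfolding sq_root_def
proof (intro recursive_intros assms assms[THEN recursive_drop1])
  show "\<exists>s. F xs < Suc s * Suc s" for xs by (intro exI[of _ "F xs"]) simp
qed auto

lemma recursive_first [recursive_intros]: "recursive k F \<Longrightarrow> recursive k (\<lambda>xs. sq_fst (F xs))"
  unfolding sq_fst_def by (intro recursive_intros)

lemma recursive_second [recursive_intros]: "recursive k F \<Longrightarrow> recursive k (\<lambda>xs. sq_snd (F xs))"
  unfolding sq_snd_def by (intro recursive_intros)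

text \<open>Integer-valued functions are represented by differences of recursive functions. Such
differences are closed under ring operations, and the sign is only examined where a comparison
or a quotient needs it.\<close>

definition recursive_int :: "nat \<Rightarrow> (nat list \<Rightarrow> int) \<Rightarrow> bool" where
  "recursive_int k F \<longleftrightarrow>
     (\<exists>p m. recursive k p \<and> recursive k m \<and> (\<forall>xs. F xs = int (p xs) - int (m xs)))"

lemma recursive_intI:
  "recursive k p \<Longrightarrow> recursive k m \<Longrightarrow> (\<And>xs. F xs = int (p xs) - int (m xs)) \<Longrightarrow> recursive_int k F"
  unfolding recursive_int_def by blast

lemma recursive_int_of_nat [recursive_intros]: "recursive k F \<Longrightarrow> recursive_int k (\<lambda>xs. int (F xs))"
  by (rule recursive_intI[of _ F "\<lambda>_. 0"]) (auto intro: recursive_intros)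

lemma recursive_int_const [recursive_intros]: "recursive_int k (\<lambda>xs. c)"
  by (rule recursive_intI[of _ "\<lambda>_. nat c" "\<lambda>_. nat (- c)"]) (auto intro: recursive_intros)

lemma recursive_int_diff [recursive_intros]:
  assumes "recursive_int k F" "recursive_int k G" shows "recursive_int k (\<lambda>xs. F xs - G xs)"
proof -
  obtain p m p' m' where "recursive k p" "recursive k m" "\<And>xs. F xs = int (p xs) - int (m xs)"
    "recursive k p'" "recursive k m'" "\<And>xs. G xs = int (p' xs) - int (m' xs)"
    using assms unfolding recursive_int_def by blast
  then show ?thesis
    by (intro recursive_intI[of _ "\<lambda>xs. p xs + m' xs" "\<lambda>xs. m xs + p' xs"] recursive_intros) auto
qed

lemma recursive_int_mult [recursive_intros]:
  assumes "recursive_int k F" "recursive_int k G" shows "recursive_int k (\<lambda>xs. F xs * G xs)"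
proof -
  obtain p m p' m' where "recursive k p" "recursive k m" and F: "\<And>xs. F xs = int (p xs) - int (m xs)"
    and "recursive k p'" "recursive k m'" and G: "\<And>xs. G xs = int (p' xs) - int (m' xs)"
    using assms unfolding recursive_int_def by blast
  then show ?thesis
    by (intro recursive_intI[of _ "\<lambda>xs. p xs * p' xs + m xs * m' xs" "\<lambda>xs. p xs * m' xs + m xs * p' xs"]
          recursive_intros) (auto simp: F G algebra_simps)
qed

lemma decidable_int_eq [recursive_intros]:
  assumes "recursive_int k F" "recursive_int k G" shows "decidable k (\<lambda>xs. F xs = G xs)"
proof -
  obtain p m p' m' where "recursive k p" "recursive k m" and F: "\<And>xs. F xs = int (p xs) - int (m xs)"
    and "recursive k p'" "recursive k m'" and G: "\<And>xs. G xs = int (p' xs) - int (m' xs)"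
    using assms unfolding recursive_int_def by blast
  then have "decidable k (\<lambda>xs. p xs + m' xs = p' xs + m xs)" by (intro recursive_intros)
  then show ?thesis by (rule decidable_cong) (auto simp: F G)
qed

lemma recursive_nat_abs [recursive_intros]:
  assumes "recursive_int k F" shows "recursive k (\<lambda>xs. nat \<bar>F xs\<bar>)"
proof -
  obtain p m where "recursive k p" "recursive k m" and F: "\<And>xs. F xs = int (p xs) - int (m xs)"
    using assms unfolding recursive_int_def by blast
  then have "recursive k (\<lambda>xs. (p xs - m xs) + (m xs - p xs))" by (intro recursive_intros)
  then show ?thesis by (rule recursive_cong) (auto simp: F)
qed

lemma decidable_int_nonneg [recursive_intros]:
  assumes "recursive_int k F" shows "decidable k (\<lambda>xs. 0 \<le> F xs)"
proof -
  obtain p m where "recursive k p" "recursive k m" and F: "\<And>xs. F xs = int (p xs) - int (m xs)"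
    using assms unfolding recursive_int_def by blast
  then have "decidable k (\<lambda>xs. m xs \<le> p xs)" by (intro recursive_intros)
  then show ?thesis by (rule decidable_cong) (auto simp: F)
qed

lemma recursive_int_if [recursive_intros]:
  assumes "decidable k P" "recursive_int k F" "recursive_int k G"
  shows "recursive_int k (\<lambda>xs. if P xs then F xs else G xs)"
proof -
  obtain p m p' m' where "recursive k p" "recursive k m" and F: "\<And>xs. F xs = int (p xs) - int (m xs)"
    and "recursive k p'" "recursive k m'" and G: "\<And>xs. G xs = int (p' xs) - int (m' xs)"
    using assms unfolding recursive_int_def by blast
  then show ?thesis
    by (intro recursive_intI[of _ "\<lambda>xs. if P xs then p xs else p' xs" "\<lambda>xs. if P xs then m xs else m' xs"]
          recursive_intros assms) auto
qed

lemma recursive_int_div [recursive_intros]: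
  assumes "recursive_int k F" shows "recursive_int k (\<lambda>xs. F xs div int N)"
proof (cases "N = 0")
  case False
  (* Rounding towards minus infinity becomes rounding up of the absolute value. *)
  have *: "x div int N = (if 0 \<le> x then int (nat \<bar>x\<bar> div N) else 0 - int ((nat \<bar>x\<bar> + (N - 1)) div N))" for x
  proof (cases "0 \<le> x")
    case False
    define y where "y = nat \<bar>x\<bar>"
    have x: "x = - int y" using False by (simp add: y_def)
    have "- int y div int N = - int ((y + (N - 1)) div N)"
    proof (rule int_div_pos_eq)
      let ?q = "(y + (N - 1)) div N"
      have q: "N * ?q \<le> y + (N - 1)" "y + (N - 1) < N * ?q + N"
        using \<open>N \<noteq> 0\<close> dividend_less_div_times[of N "y + (N - 1)"]
        by (auto simp: mult.commute)
      have "int (N * ?q) \<le> int y + int N - 1" "int y < int (N * ?q) + 1"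
        using q \<open>N \<noteq> 0\<close> by linarith+
      then show "0 \<le> int N * int ?q - int y" "int N * int ?q - int y < int N"
        unfolding of_nat_mult by linarith+
      show "- int y = int N * - int ?q + (int N * int ?q - int y)" by simp
    qed
    then have "x div int N = - int ((y + (N - 1)) div N)" using x by (simp only:)
    with False show ?thesis by (simp only: y_def if_False diff_0)
  qed (simp add: zdiv_int)
  show ?thesis
    unfolding * by (intro recursive_intros assms)
qed (auto intro: recursive_intros)

lemma decidable_int_dvd [recursive_intros]:
  assumes "recursive_int k F" shows "decidable k (\<lambda>xs. int N dvd F xs)"
proof -
  have "decidable k (\<lambda>xs. F xs - int N * (F xs div int N) = 0)" by (intro recursive_intros assms)
  then show ?thesis by (simp only: minus_mult_div_eq_mod mod_eq_0_iff_dvd)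
qed

lemma recursive_int_decode [recursive_intros]:
  assumes "recursive k F" shows "recursive_int k (\<lambda>xs. int_decode (F xs))"
proof -
  have "int_decode n = (if n mod 2 = 0 then int (n div 2) else 0 - int (Suc (n div 2)))" for n
    by (auto simp: int_decode_def sum_decode_def even_iff_mod_2_eq_zero)
  then show ?thesis by (simp only:) (intro recursive_intros assms)
qed

lemma recursive_int_encode [recursive_intros]:
  assumes "recursive_int k F" shows "recursive k (\<lambda>xs. int_encode (F xs))"
proof -
  have "int_encode i = (if 0 \<le> i then 2 * nat \<bar>i\<bar> else 2 * nat \<bar>i\<bar> - 1)" for i
    by (auto simp: int_encode_def sum_encode_def)
  then show ?thesis by (simp only:) (intro recursive_intros assms)
qed

section \<open>Walks in a lattice\<close>

datatype idx = I1 | I2 | I3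

text \<open>\<open>X\<close> stands for the point \<open>X / N\<close> of the lattice
\<open>(1/N)\<int>\<^sup>3\<close>, and \<open>a / N\<close> for the coefficients. The digits 0,
1, 2 are the three involutions. A step is made only if its index belongs to \<open>J\<close> and
if it leads to a lattice point, which is the divisibility condition. In all other cases, in
particular for the digit 3, the walk stays where it is.\<close>

definition move :: "nat \<Rightarrow> idx set \<Rightarrow> (idx \<Rightarrow> int) \<Rightarrow> nat \<Rightarrow> (idx \<Rightarrow> int) \<Rightarrow> idx \<Rightarrow> int" where
  "move N J a d X = (
     if d = 0 \<and> I1 \<in> J \<and> int N dvd X I2 * X I3
       then X(I1 := a I1 - X I2 * X I3 div int N - X I1)
     else if d = 1 \<and> I2 \<in> J \<and> int N dvd X I3 * X I1
       then X(I2 := a I2 - X I3 * X I1 div int N - X I2)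
     else if d = 2 \<and> I3 \<in> J \<and> int N dvd X I1 * X I2
       then X(I3 := a I3 - X I1 * X I2 div int N - X I3)
     else X)"

definition run :: "nat \<Rightarrow> idx set \<Rightarrow> (idx \<Rightarrow> int) \<Rightarrow> (nat \<Rightarrow> nat) \<Rightarrow> (idx \<Rightarrow> int) \<Rightarrow> nat \<Rightarrow> idx \<Rightarrow> int" where
  "run N J a d X n = rec_nat X (\<lambda>m Y. move N J a (d m) Y) n"

definition abs_sum :: "(idx \<Rightarrow> int) \<Rightarrow> nat" where
  "abs_sum X = nat \<bar>X I1\<bar> + nat \<bar>X I2\<bar> + nat \<bar>X I3\<bar>"

text \<open>The number of steps is the number of lattice points in the box of radius
\<open>\<bar>X\<bar> + \<bar>Y\<bar> + C\<close>. A walk in the box that meets no point twice is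
not longer, and it is brought to exactly this length by idle steps.\<close>

definition conn :: "nat \<Rightarrow> idx set \<Rightarrow> (idx \<Rightarrow> int) \<Rightarrow> nat \<Rightarrow> (idx \<Rightarrow> int) \<Rightarrow> (idx \<Rightarrow> int) \<Rightarrow> bool" where
  "conn N J a C X Y \<longleftrightarrow>
     (\<exists>d. (\<forall>n. d n < 4) \<and> run N J a d X ((2 * (abs_sum X + abs_sum Y + C) + 1) ^ 3) = Y)"

text \<open>The digits of a walk of length \<open>L\<close> are those of a number below \<open>4 ^
L\<close>, so that a quantifier over walks is a bounded quantifier over numbers.\<close>

lemma ex_digits:
  assumes "\<And>n. d n < (4::nat)"
  shows "\<exists>w<4 ^ L. \<forall>n<L. w div 4 ^ n mod 4 = d n"
proof (induction L)
  case (Suc L)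
  then obtain w where w: "w < 4 ^ L" "\<And>n. n < L \<Longrightarrow> w div 4 ^ n mod 4 = d n" by blast
  have "(w + d L * 4 ^ L) div 4 ^ n mod 4 = d n" if "n < Suc L" for n
  proof (cases "n = L")
    case True
    then show ?thesis using w(1) assms[of L] by simp
  next
    case False
    then have n: "n < L" using that by simp
    then have "(4 :: nat) ^ L = 4 ^ n * 4 ^ Suc (L - Suc n)"
      by (simp flip: power_add del: power_Suc)
    then have "d L * 4 ^ L = 4 ^ n * (4 * (d L * 4 ^ (L - Suc n)))" by simp
    then have "(w + d L * 4 ^ L) div 4 ^ n = w div 4 ^ n + 4 * (d L * 4 ^ (L - Suc n))"
      by (simp only: div_mult_self2[of "4 ^ n"] power_not_zero zero_neq_numeral not_False_eq_True)
    then show ?thesis using w(2)[OF n] by simp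
  qed
  moreover have "w + d L * 4 ^ L < 4 ^ Suc L"
  proof -
    have "d L * 4 ^ L \<le> 3 * 4 ^ L" using assms[of L] by simp
    with w(1) show ?thesis unfolding power_Suc by linarith
  qed
  ultimately show ?case by blast
qed simp

lemma run_cong: "(\<And>n. n < L \<Longrightarrow> d n = d' n) \<Longrightarrow> run N J a d X L = run N J a d' X L"
  unfolding run_def by (induction L) auto

definition recursive_pt :: "nat \<Rightarrow> (nat list \<Rightarrow> idx \<Rightarrow> int) \<Rightarrow> bool" where
  "recursive_pt k F \<longleftrightarrow> (\<forall>i. recursive_int k (\<lambda>xs. F xs i))"

definition pt_code :: "(idx \<Rightarrow> int) \<Rightarrow> nat" where
  "pt_code X = sq_pair (int_encode (X I1)) (sq_pair (int_encode (X I2)) (int_encode (X I3)))"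

definition pt_decode :: "nat \<Rightarrow> idx \<Rightarrow> int" where
  "pt_decode c i = (case i of I1 \<Rightarrow> int_decode (sq_fst c)
     | I2 \<Rightarrow> int_decode (sq_fst (sq_snd c)) | I3 \<Rightarrow> int_decode (sq_snd (sq_snd c)))"

lemma pt_decode_code [simp]: "pt_decode (pt_code X) = X"
  by (auto simp: pt_decode_def pt_code_def split: idx.split)

lemma recursive_pt_code [recursive_intros]:
  "recursive_pt k F \<Longrightarrow> recursive k (\<lambda>xs. pt_code (F xs))"
  unfolding pt_code_def recursive_pt_def by (intro recursive_intros) auto

lemma recursive_pt_decode [recursive_intros]:
  assumes "recursive k F" shows "recursive_pt k (\<lambda>xs. pt_decode (F xs))"
  unfolding recursive_pt_def pt_decode_def
proof
  show "recursive_int k (\<lambda>xs. case i of I1 \<Rightarrow> int_decode (sq_fst (F xs))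
     | I2 \<Rightarrow> int_decode (sq_fst (sq_snd (F xs))) | I3 \<Rightarrow> int_decode (sq_snd (sq_snd (F xs))))" for i
    by (cases i; simp) (intro recursive_intros assms)+
qed

lemma recursive_pt_move [recursive_intros]:
  assumes "recursive k d" "recursive_pt k F"
  shows "recursive_pt k (\<lambda>xs. move N J a (d xs) (F xs))"
  unfolding recursive_pt_def
proof
  fix i
  have F: "recursive_int k (\<lambda>xs. F xs i)" for i using assms(2) by (simp add: recursive_pt_def)
  show "recursive_int k (\<lambda>xs. move N J a (d xs) (F xs) i)"
  proof (cases i)
    case I1
    have "move N J a (d xs) (F xs) i = (if d xs = 0 \<and> I1 \<in> J \<and>
        int N dvd F xs I2 * F xs I3
        then a I1 - F xs I2 * F xs I3 div int N - F xs I1 else F xs I1)" for xs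
      by (auto simp: move_def I1)
    then show ?thesis by (simp only:) (intro recursive_intros assms F)
  next
    case I2
    have "move N J a (d xs) (F xs) i = (if d xs = 1 \<and> I2 \<in> J \<and>
        int N dvd F xs I3 * F xs I1
        then a I2 - F xs I3 * F xs I1 div int N - F xs I2 else F xs I2)" for xs
      by (auto simp: move_def I2)
    then show ?thesis by (simp only:) (intro recursive_intros assms F)
  next
    case I3
    have "move N J a (d xs) (F xs) i = (if d xs = 2 \<and> I3 \<in> J \<and>
        int N dvd F xs I1 * F xs I2
        then a I3 - F xs I1 * F xs I2 div int N - F xs I3 else F xs I3)" for xs
      by (auto simp: move_def I3)
    then show ?thesis by (simp only:) (intro recursive_intros assms F)
  qed
qed

lemma decidable_pt_eq [recursive_intros]:
  assumes "recursive_pt k F" "recursive_pt k G" shows "decidable k (\<lambda>xs. F xs = G xs)"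
proof -
  have "decidable k (\<lambda>xs. F xs I1 = G xs I1 \<and> F xs I2 = G xs I2 \<and> F xs I3 = G xs I3)"
    using assms[unfolded recursive_pt_def, THEN spec] by (intro recursive_intros)
  moreover have "X = Y \<longleftrightarrow> X I1 = Y I1 \<and> X I2 = Y I2 \<and> X I3 = Y I3" for X Y :: "idx \<Rightarrow> int"
  proof (safe, rule ext)
    show "X i = Y i" if "X I1 = Y I1" "X I2 = Y I2" "X I3 = Y I3" for i
      using that by (cases i) auto
  qed
  ultimately show ?thesis by simp
qed

lemma recursive_pt_const [recursive_intros]: "recursive_pt k (\<lambda>xs. X)"
  unfolding recursive_pt_def by (intro allI recursive_intros)

lemma recursive_pt_drop2:
  assumes "recursive_pt k F" shows "recursive_pt (k + 2) (\<lambda>xs. F (drop 2 xs))"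
  unfolding recursive_pt_def
proof
  fix i
  obtain p m where p: "recursive k p" "recursive k m" and F: "\<And>xs. F xs i = int (p xs) - int (m xs)"
    using assms unfolding recursive_int_def recursive_pt_def by blast
  show "recursive_int (k + 2) (\<lambda>xs. F (drop 2 xs) i)"
    by (rule recursive_intI[OF p[THEN recursive_drop2]]) (rule F)
qed

lemma recursive_pt_run:
  assumes "recursive k G" "recursive_pt k F" "recursive k W"
  shows "recursive_pt k (\<lambda>xs. run N J a (\<lambda>n. W xs div 4 ^ n mod 4) (F xs) (G xs))"
proof -
  have "recursive_pt k (\<lambda>xs. pt_decode (rec_nat (pt_code (F xs))
     (\<lambda>n c. pt_code (move N J a (W xs div 4 ^ n mod 4) (pt_decode c))) (G xs)))"
    by (intro recursive_intros assms assms(3)[THEN recursive_drop2]) auto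
  moreover have "rec_nat (pt_code X) (\<lambda>n c. pt_code (move N J a (d n) (pt_decode c))) L
      = pt_code (run N J a d X L)" for d X L
    unfolding run_def by (induction L) auto
  ultimately show ?thesis by simp
qed

lemma decidable_conn:
  assumes "recursive_pt k F" "recursive_pt k G"
  shows "decidable k (\<lambda>xs. conn N J a C (F xs) (G xs))"
proof -
  define L where "L xs = (2 * (abs_sum (F xs) + abs_sum (G xs) + C) + 1) ^ 3" for xs
  have L: "recursive k L"
    using assms unfolding L_def abs_sum_def recursive_pt_def by (intro recursive_intros) auto
  have "decidable k (\<lambda>xs. \<exists>w<4 ^ L xs. run N J a (\<lambda>n. w div 4 ^ n mod 4) (F xs) (L xs) = G xs)"
    by (intro recursive_intros recursive_pt_run L assms[THEN recursive_pt_drop2] L[THEN recursive_drop2]) auto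
  moreover have "(\<exists>w<4 ^ L xs. run N J a (\<lambda>n. w div 4 ^ n mod 4) (F xs) (L xs) = G xs)
      \<longleftrightarrow> conn N J a C (F xs) (G xs)" (is "?A \<longleftrightarrow> ?B") for xs
  proof
    assume ?A
    then obtain w where "run N J a (\<lambda>n. w div 4 ^ n mod 4) (F xs) (L xs) = G xs" by blast
    then show ?B unfolding conn_def L_def by (intro exI[of _ "\<lambda>n. w div 4 ^ n mod 4"]) auto
  next
    assume ?B
    then have "\<exists>d. (\<forall>n. d n < 4) \<and> run N J a d (F xs) (L xs) = G xs"
      unfolding conn_def L_def .
    then obtain d where d: "\<And>n. d n < 4" "run N J a d (F xs) (L xs) = G xs" by auto
    obtain w where w: "w < 4 ^ L xs" "\<forall>n<L xs. w div 4 ^ n mod 4 = d n"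
      using ex_digits[of d "L xs", OF d(1)] by auto
    with d(2) run_cong[of "L xs" "\<lambda>n. w div 4 ^ n mod 4" d N J a "F xs"]
    show ?A by auto
  qed
  ultimately show ?thesis by simp
qed

lemma decidable_finite_Ex:
  assumes "finite T" "\<And>t. t \<in> T \<Longrightarrow> decidable k (P t)"
  shows "decidable k (\<lambda>xs. \<exists>t\<in>T. P t xs)"
  using assms
proof (induction rule: finite_induct)
  case (insert t T)
  then show ?case using decidable_disj[of k "P t" "\<lambda>xs. \<exists>t\<in>T. P t xs"] by simp
qed (simp add: decidable_const)

fun pt :: "'a triple \<Rightarrow> idx \<Rightarrow> 'a" where
  "pt (x1, x2, x3) i = (case i of I1 \<Rightarrow> x1 | I2 \<Rightarrow> x2 | I3 \<Rightarrow> x3)"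

text \<open>The numbers \<open>N\<close>, \<open>C\<close>, the \<open>a i\<close>, the set
\<open>J\<close> and the finite table \<open>T\<close> become constants of the program.\<close>

lemma decidable_on_template:
  assumes T: "finite T"
    and R: "\<And>x y. x \<in> D \<Longrightarrow> y \<in> D \<Longrightarrow> R x y \<longleftrightarrow>
      conn N J a C (\<lambda>i. int N * pt x i) (\<lambda>i. int N * pt y i) \<or>
      (\<exists>(g, h)\<in>T. conn N J a C (\<lambda>i. int N * pt x i) g \<and> conn N J a C (\<lambda>i. int N * pt y i) h)"
  shows "decidable_on D R"
proof -
  define Z :: "nat \<Rightarrow> nat list \<Rightarrow> idx \<Rightarrow> int" where
    "Z m xs i = int N * (case i of I1 \<Rightarrow> int_decode (xs ! m)
       | I2 \<Rightarrow> int_decode (xs ! (m + 1)) | I3 \<Rightarrow> int_decode (xs ! (m + 2)))" for m xs i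
  have Z: "recursive_pt 6 (Z m)" if "m + 2 < 6" for m
    unfolding recursive_pt_def
  proof
    show "recursive_int 6 (\<lambda>xs. Z m xs i)" for i
      using that by (cases i; simp add: Z_def) (intro recursive_intros; simp)+
  qed
  define P where "P xs \<longleftrightarrow> conn N J a C (Z 0 xs) (Z 3 xs) \<or>
    (\<exists>t\<in>T. conn N J a C (Z 0 xs) (fst t) \<and> conn N J a C (Z 3 xs) (snd t))" for xs
  have "decidable 6 P"
    unfolding P_def
    by (intro recursive_intros decidable_finite_Ex T decidable_conn Z) auto
  then obtain f where f: "\<And>xs. length xs = 6 \<Longrightarrow> computes f xs (of_bool (P xs))"
    unfolding decidable_def recursive_def by blast
  have "computes f (encode_triple x @ encode_triple y) (if R x y then 1 else 0)" if "x \<in> D" "y \<in> D" for x y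
  proof -
    obtain x1 x2 x3 y1 y2 y3 where xy: "x = (x1, x2, x3)" "y = (y1, y2, y3)"
      by (cases x, cases y) auto
    let ?xs = "encode_triple x @ encode_triple y"
    have "Z 0 ?xs i = int N * pt x i" "Z 3 ?xs i = int N * pt y i" for i
      by (cases i; simp add: Z_def xy)+
    then have "Z 0 ?xs = (\<lambda>i. int N * pt x i)" "Z 3 ?xs = (\<lambda>i. int N * pt y i)" by auto
    then have "P ?xs \<longleftrightarrow> R x y" using R[OF that] by (simp add: P_def case_prod_beta)
    moreover have "length ?xs = 6" by (simp add: xy)
    ultimately show ?thesis using f[of ?xs] by (cases "R x y") auto
  qed
  then show ?thesis unfolding decidable_on_def by blast
qed

section \<open>Valuation rings of the complex numbers\<close>

definition subring_of_complex :: "complex set \<Rightarrow> bool" where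
  "subring_of_complex B \<longleftrightarrow> 1 \<in> B \<and> (\<forall>x\<in>B. \<forall>y\<in>B. x - y \<in> B \<and> x * y \<in> B)"

context
  fixes B assumes B: "subring_of_complex B"
begin

lemma subring_1: "1 \<in> B" using B by (simp add: subring_of_complex_def)
lemma subring_diff: "x \<in> B \<Longrightarrow> y \<in> B \<Longrightarrow> x - y \<in> B" using B by (simp add: subring_of_complex_def)
lemma subring_mult: "x \<in> B \<Longrightarrow> y \<in> B \<Longrightarrow> x * y \<in> B" using B by (simp add: subring_of_complex_def)
lemma subring_0: "0 \<in> B" using subring_diff[OF subring_1 subring_1] by simp
lemma subring_uminus: "x \<in> B \<Longrightarrow> - x \<in> B" using subring_diff[OF subring_0] by fastforce
lemma subring_add: "x \<in> B \<Longrightarrow> y \<in> B \<Longrightarrow> x + y \<in> B" using subring_diff[OF _ subring_uminus] by fastforce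
lemma subring_power: "x \<in> B \<Longrightarrow> x ^ n \<in> B" by (induction n) (auto intro: subring_1 subring_mult)
lemma subring_of_nat: "of_nat n \<in> B" by (induction n) (auto intro: subring_0 subring_1 subring_add)
lemma subring_of_int: "of_int n \<in> B"
  by (cases n) (auto intro: subring_of_nat subring_uminus simp del: of_nat_Suc)
lemma subring_sum: "(\<And>i. i \<in> A \<Longrightarrow> f i \<in> B) \<Longrightarrow> sum f A \<in> B"
  by (induction A rule: infinite_finite_induct) (auto intro: subring_0 subring_add)

lemma subring_adjoin:
  "subring_of_complex {poly f y |f. \<forall>i. coeff f i \<in> B}" (is "subring_of_complex ?R")
proof -
  have "1 \<in> ?R"
    by (rule CollectI, rule exI[of _ 1])
       (auto simp: coeff_1 intro: subring_0 subring_1)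
  moreover have "a - b \<in> ?R" if ab: "a \<in> ?R" "b \<in> ?R" for a b
  proof -
    obtain f g where "a = poly f y" "b = poly g y" "\<forall>i. coeff f i \<in> B" "\<forall>i. coeff g i \<in> B"
      using ab by blast
    then show ?thesis by (intro CollectI exI[of _ "f - g"]) (auto intro: subring_diff)
  qed
  moreover have "a * b \<in> ?R" if ab: "a \<in> ?R" "b \<in> ?R" for a b
  proof -
    obtain f g where "a = poly f y" "b = poly g y" "\<forall>i. coeff f i \<in> B" "\<forall>i. coeff g i \<in> B"
      using ab by blast
    then show ?thesis
      by (intro CollectI exI[of _ "f * g"]) (auto simp: coeff_mult intro!: subring_sum subring_mult)
  qed
  ultimately show ?thesis unfolding subring_of_complex_def by blast
qed

end

locale valuation_ring =
  fixes B :: "complex set"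
  assumes subring: "subring_of_complex B"
    and total: "z \<noteq> 0 \<Longrightarrow> z \<in> B \<or> 1 / z \<in> B"

text \<open>Zorn's lemma applies because a union of a chain of rings without \<open>1/p\<close> is
such a ring, and because \<open>\<int>\<close> is one.\<close>

lemma maximal_subring_avoiding:
  assumes "p > (1::nat)"
  obtains M where "subring_of_complex M" "1 / of_nat p \<notin> M"
    "\<And>R. subring_of_complex R \<Longrightarrow> M \<subseteq> R \<Longrightarrow> 1 / of_nat p \<notin> R \<Longrightarrow> R = M"
proof -
  let ?S = "{R. subring_of_complex R \<and> 1 / of_nat p \<notin> R}"
  have "1 / of_nat p \<notin> (\<int> :: complex set)"
  proof
    assume "1 / of_nat p \<in> (\<int> :: complex set)"
    then obtain n where "1 / of_nat p = (of_int n :: complex)" by (elim Ints_cases)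
    then have "of_int (n * int p) = (of_int 1 :: complex)" using assms by (simp add: field_simps)
    then have "n * int p = 1" by (simp only: of_int_eq_iff)
    then show False using assms by (auto simp: zmult_eq_1_iff)
  qed
  then have "\<int> \<in> ?S" by (auto simp: subring_of_complex_def)
  then have "?S \<noteq> {}" by blast
  then have "\<exists>M\<in>?S. \<forall>X\<in>?S. M \<subseteq> X \<longrightarrow> X = M"
  proof (rule subset_Zorn_nonempty)
    fix C assume C: "C \<noteq> {}" "subset.chain ?S C"
    have sub: "subring_of_complex R" "1 / of_nat p \<notin> R" if "R \<in> C" for R
      using C(2) that by (auto simp: subset_chain_def)
    have "\<exists>R\<in>C. x \<in> R \<and> y \<in> R" if "x \<in> \<Union>C" "y \<in> \<Union>C" for x y
      using that C(2) unfolding subset_chain_def by blast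
    then have "x - y \<in> \<Union>C \<and> x * y \<in> \<Union>C" if "x \<in> \<Union>C" "y \<in> \<Union>C" for x y
      using that sub(1) subring_diff subring_mult by (meson UnionI)
    moreover have "1 \<in> \<Union>C" using C(1) sub(1) subring_1 by blast
    ultimately show "\<Union>C \<in> ?S" using sub(2) unfolding subring_of_complex_def by blast
  qed
  then show thesis using that by blast
qed

text \<open>A ring \<open>M\<close> that is maximal among those without \<open>1/p\<close> is a
valuation ring. If \<open>y \<notin> M\<close>, then \<open>1/p\<close> is a polynomial in
\<open>y\<close> over \<open>M\<close>, in other words 1 is a polynomial in \<open>y\<close>
over the ideal \<open>I = p M\<close>. If neither \<open>z\<close> nor \<open>1/z\<close> were
in \<open>M\<close>, then 1 would be a polynomial over \<open>I\<close> both in \<open>z\<close>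
and in \<open>1/z\<close>; taken of minimal degrees, the relation of the larger degree could be
shortened by means of the other one.\<close>

lemma valuation_ring_exists:
  assumes "p > (1::nat)"
  obtains M where "valuation_ring M" "1 / of_nat p \<notin> M"
proof -
  define P :: complex where "P = of_nat p"
  have P0: "P \<noteq> 0" using assms by (simp add: P_def)
  obtain M where M: "subring_of_complex M" and w: "1 / P \<notin> M"
    and max: "\<And>R. subring_of_complex R \<Longrightarrow> M \<subseteq> R \<Longrightarrow> 1 / P \<notin> R \<Longrightarrow> R = M"
    using maximal_subring_avoiding[OF assms] unfolding P_def by metis
  define I where "I = (\<lambda>b. P * b) ` M"
  have I0: "0 \<in> I" using subring_0[OF M] unfolding I_def by force
  have I_add: "a + b \<in> I" if "a \<in> I" "b \<in> I" for a b
    using that subring_add[OF M] unfolding I_def by (auto simp flip: distrib_left)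
  have I_mult: "a * b \<in> I" if "a \<in> I" "b \<in> M" for a b
    using that subring_mult[OF M] unfolding I_def by (auto simp: mult.assoc)
  have I_M: "a \<in> M" if "a \<in> I" for a
    using that subring_mult[OF M subring_of_nat[OF M]] unfolding I_def P_def by auto
  have one_I: "1 \<notin> I"
  proof
    assume "1 \<in> I"
    then obtain b where "b \<in> M" "1 = P * b" unfolding I_def by blast
    then have "1 / P = b" using P0 by (simp add: field_simps)
    with w \<open>b \<in> M\<close> show False by simp
  qed
  have adj: "\<exists>f. (\<forall>i. coeff f i \<in> M) \<and> poly f y = 1 / P" if "y \<notin> M" for y
  proof (rule ccontr)
    let ?R = "{poly f y |f. \<forall>i. coeff f i \<in> M}"
    assume "\<not> ?thesis"
    then have "1 / P \<notin> ?R" by force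
    moreover have "M \<subseteq> ?R"
    proof
      fix a assume "a \<in> M"
      then show "a \<in> ?R"
        using subring_0[OF M] by (intro CollectI exI[of _ "[:a:]"]) (auto simp: coeff_pCons split: nat.split)
    qed
    ultimately have "?R = M" using max subring_adjoin[OF M] by blast
    moreover have "y \<in> ?R"
      using subring_0[OF M] subring_1[OF M]
      by (intro CollectI exI[of _ "[:0, 1:]"]) (auto simp: coeff_pCons split: nat.split)
    ultimately show False using that by blast
  qed
  (* Numbers congruent to 1 modulo I are units of M. Otherwise 1/P is a polynomial in 1/u over
     M, so u^n / P lies in M for some n, and so does 1/P because u^n is congruent to 1 modulo I
     = P M. *)
  have unit: "u \<noteq> 0 \<and> 1 / u \<in> M" if "1 - u \<in> I" for u
  proof (rule ccontr)
    assume *: "\<not> ?thesis"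
    have u0: "u \<noteq> 0" using that one_I by auto
    then have "1 / u \<notin> M" using * by blast
    then obtain f where f: "\<And>i. coeff f i \<in> M" "poly f (1 / u) = 1 / P" using adj by blast
    have uM: "u \<in> M" using subring_diff[OF M subring_1[OF M] I_M[OF that]] by simp
    have "u ^ n - 1 \<in> I" for n
    proof (induction n)
      case (Suc n)
      have "u ^ Suc n - 1 = (u ^ n - 1) * u + (1 - u) * (- 1)" by (simp add: algebra_simps)
      then show ?case using I_add I_mult Suc uM that subring_uminus[OF M subring_1[OF M]] by metis
    qed (simp add: I0)
    then obtain b where b: "b \<in> M" "u ^ degree f - 1 = P * b" unfolding I_def by blast
    have "u ^ degree f * (1 / P) = (\<Sum>i\<le>degree f. coeff f i * u ^ (degree f - i))"
      unfolding f(2)[symmetric] poly_altdef sum_distrib_left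
      using u0 by (intro sum.cong) (auto simp: power_diff power_one_over field_simps)
    also have "\<dots> \<in> M" by (intro subring_sum[OF M] subring_mult[OF M] f(1) subring_power[OF M] uM)
    finally have "u ^ degree f * (1 / P) \<in> M" .
    moreover have "u ^ degree f * (1 / P) = 1 / P + b"
      using b(2) P0 by (simp add: field_simps)
    ultimately have "1 / P + b - b \<in> M" using b(1) subring_diff[OF M] by metis
    then show False using w by simp
  qed
  define rep where "rep y n \<longleftrightarrow> (\<exists>c. (\<forall>i. c i \<in> I) \<and> (\<Sum>i\<le>n. c i * y ^ i) = 1)" for y n
  have rep_ex: "\<exists>n. rep y n" if y: "y \<notin> M" for y
  proof -
    obtain f where f: "\<And>i. coeff f i \<in> M" "poly f y = 1 / P" using adj[OF y] by blast
    have "(\<Sum>i\<le>degree f. (P * coeff f i) * y ^ i) = P * poly f y"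
      by (simp add: poly_altdef sum_distrib_left mult.assoc)
    then have "(\<Sum>i\<le>degree f. (P * coeff f i) * y ^ i) = 1" using P0 f(2) by simp
    then show ?thesis unfolding rep_def I_def using f(1)
      by (intro exI[of _ "degree f"] exI[of _ "\<lambda>i. P * coeff f i"]) auto
  qed
  have rep_0: "\<not> rep y 0" for y
  proof
    assume "rep y 0"
    then obtain c where "\<And>i. c i \<in> I" "c (0 :: nat) = 1" unfolding rep_def by auto
    with one_I show False by metis
  qed
  (* The relation for 1/y, multiplied by y^n, expresses u y^n by lower powers of y, where u = 1
     - d 0 is a unit. This eliminates the leading term of the relation for y. *)
  have red: "rep y (n - 1)" if reps: "rep y n" "rep (1 / y) m" and that: "m \<le> n" "y \<noteq> 0" for y n m
  proof -
    obtain c d where c: "\<And>i. c i \<in> I" "(\<Sum>i\<le>n. c i * y ^ i) = 1"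
      and d: "\<And>i. d i \<in> I" "(\<Sum>i\<le>m. d i * (1 / y) ^ i) = 1"
      using reps unfolding rep_def by blast
    have "n > 0" using reps(1) rep_0 by (cases n) auto
    then obtain k where k: "n = Suc k" by (cases n) auto
    define u where "u = 1 - d 0"
    have u: "u \<noteq> 0" "1 / u \<in> M" using unit[of u] d(1) by (auto simp: u_def)
    have "u = (\<Sum>i\<in>{1..m}. d i * (1 / y) ^ i)"
    proof -
      have "(\<Sum>i\<le>m. d i * (1 / y) ^ i) = d 0 + (\<Sum>i\<in>{1..m}. d i * (1 / y) ^ i)"
        by (simp add: atMost_atLeast0 sum.atLeast_Suc_atMost)
      then show ?thesis using d(2) unfolding u_def by (metis add_diff_cancel_left')
    qed
    then have "u * y ^ n = (\<Sum>i\<in>{1..m}. d i * (1 / y) ^ i * y ^ n)" by (simp add: sum_distrib_right)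
    also have "\<dots> = (\<Sum>i\<in>{1..m}. d i * y ^ (n - i))"
      using that by (intro sum.cong) (auto simp: power_diff power_one_over field_simps)
    also have "\<dots> = (\<Sum>i\<in>{n-m..k}. d (n - i) * y ^ i)"
      by (rule sum.reindex_bij_witness[of _ "\<lambda>i. n - i" "\<lambda>i. n - i"]) (use that(1) k in auto)
    finally have uyn: "u * y ^ n = (\<Sum>i\<in>{n-m..k}. d (n - i) * y ^ i)" .
    have "y ^ n = (u * y ^ n) / u" using u(1) by simp
    also have "\<dots> = (\<Sum>i\<in>{n-m..k}. d (n - i) / u * y ^ i)"
      unfolding uyn sum_divide_distrib by (intro sum.cong) auto
    finally have yn: "y ^ n = (\<Sum>i\<in>{n-m..k}. d (n - i) / u * y ^ i)" .
    have "c n * y ^ n = (\<Sum>i\<in>{n-m..k}. c n * (d (n - i) * (1 / u)) * y ^ i)"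
      unfolding yn by (simp add: sum_distrib_left mult.assoc)
    also have "\<dots> = (\<Sum>i\<in>{..k}. if i \<in> {n-m..k} then c n * (d (n - i) * (1 / u)) * y ^ i else 0)"
      by (subst sum.inter_restrict[symmetric]) (auto intro: sum.cong)
    finally have "(\<Sum>i\<le>n. c i * y ^ i) = (\<Sum>i\<le>k. c i * y ^ i) +
        (\<Sum>i\<in>{..k}. if i \<in> {n-m..k} then c n * (d (n - i) * (1 / u)) * y ^ i else 0)"
      by (simp add: k)
    also have "\<dots> = (\<Sum>i\<le>k. (c i + (if i \<in> {n-m..k} then c n * (d (n - i) * (1 / u)) else 0)) * y ^ i)"
      by (subst sum.distrib[symmetric], intro sum.cong) (auto simp: algebra_simps)
    finally have "(\<Sum>i\<le>k. (c i + (if i \<in> {n-m..k} then c n * (d (n - i) * (1 / u)) else 0)) * y ^ i) = 1"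
      using c(2) by simp
    moreover have "c i + (if i \<in> {n-m..k} then c n * (d (n - i) * (1 / u)) else 0) \<in> I" for i
      using c(1) d(1) u(2) I0 I_add I_mult I_M by (metis (full_types))
    ultimately have "rep y k" unfolding rep_def by (intro exI conjI allI)
    then show ?thesis by (simp add: k)
  qed
  have "z \<in> M \<or> 1 / z \<in> M" if z: "z \<noteq> 0" for z
  proof (rule ccontr)
    assume "\<not> ?thesis"
    then have ex: "\<exists>n. rep z n" "\<exists>n. rep (1 / z) n" using rep_ex by auto
    define n m where "n = (LEAST n. rep z n)" and "m = (LEAST n. rep (1 / z) n)"
    have n: "rep z n" and m: "rep (1 / z) m" using LeastI_ex[OF ex(1)] LeastI_ex[OF ex(2)] by (auto simp: n_def m_def)
    then have pos: "n > 0" "m > 0" using rep_0 by (metis gr0I)+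
    show False
    proof (cases "m \<le> n")
      case True
      then have "rep z (n - 1)" using red n m z by blast
      then have "n \<le> n - 1" unfolding n_def by (rule Least_le)
      with pos show False by simp
    next
      case False
      then have "rep (1 / z) (m - 1)" using red[of "1 / z" m n] n m z by simp
      then have "m \<le> m - 1" unfolding m_def by (rule Least_le)
      with pos show False by simp
    qed
  qed
  then have "valuation_ring M" using M by unfold_locales auto
  then show thesis using that w unfolding P_def by blast
qed

text \<open>Divisibility in the valuation ring, extended to \<open>\<complex>\<close>, compares the
values of the associated non-archimedean absolute value: \<open>vle x y\<close> means
\<open>\<bar>x\<bar> \<le> \<bar>y\<bar>\<close>.\<close>

context valuation_ring
begin

definition vle :: "complex \<Rightarrow> complex \<Rightarrow> bool" where "vle x y \<longleftrightarrow> (\<exists>b\<in>B. x = b * y)"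
abbreviation vless :: "complex \<Rightarrow> complex \<Rightarrow> bool" where "vless x y \<equiv> \<not> vle y x"

lemma vle_refl [simp]: "vle x x" unfolding vle_def using subring_1[OF subring] by force
lemma vle_0 [simp]: "vle 0 x" unfolding vle_def using subring_0[OF subring] by force
lemma vle_trans: "vle x y \<Longrightarrow> vle y z \<Longrightarrow> vle x z"
  unfolding vle_def using subring_mult[OF subring] by (metis mult.assoc)
lemma vle_add: "vle x z \<Longrightarrow> vle y z \<Longrightarrow> vle (x + y) z"
  unfolding vle_def using subring_add[OF subring] by (metis distrib_right)
lemma vle_diff: "vle x z \<Longrightarrow> vle y z \<Longrightarrow> vle (x - y) z"
  unfolding vle_def using subring_diff[OF subring] by (metis left_diff_distrib)
lemma vle_mult: "vle a b \<Longrightarrow> vle c d \<Longrightarrow> vle (a * c) (b * d)"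
  unfolding vle_def using subring_mult[OF subring] by (metis mult.assoc mult.left_commute)
lemma vle_power: "vle a b \<Longrightarrow> vle (a ^ n) (b ^ n)"
  by (induction n) (auto intro: vle_mult)
lemma vle_1_iff: "vle x 1 \<longleftrightarrow> x \<in> B" unfolding vle_def by auto

lemma vle_total: "vle x y \<or> vle y x"
proof (cases "x = 0 \<or> y = 0")
  case False
  then have "x / y \<in> B \<or> y / x \<in> B" using total[of "x / y"] by simp
  then show ?thesis using False unfolding vle_def by (metis nonzero_eq_divide_eq)
qed auto

lemma vle_mult_cancel: "c \<noteq> 0 \<Longrightarrow> vle (a * c) (b * c) \<longleftrightarrow> vle a b"
  unfolding vle_def by (auto simp flip: mult.assoc)

lemma vless_imp_vle: "vless x y \<Longrightarrow> vle x y" using vle_total by blast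
lemma vle_vless_trans: "vle x y \<Longrightarrow> vless y z \<Longrightarrow> vless x z" using vle_trans by blast

lemma vless_add: "vless x z \<Longrightarrow> vless y z \<Longrightarrow> vless (x + y) z"
  using vle_total[of x y] vle_add vle_refl vle_trans by metis
lemma vle_uminus: "vle z (- x) \<longleftrightarrow> vle z x"
  unfolding vle_def using subring_uminus[OF subring] by (metis minus_mult_commute minus_minus)
lemma vless_diff: "vless x z \<Longrightarrow> vless y z \<Longrightarrow> vless (x - y) z"
  using vless_add[where x = x and z = z and y = "- y"] by (simp add: vle_uminus)

lemma vless_mult: "vle a b \<Longrightarrow> vless c d \<Longrightarrow> b \<noteq> 0 \<Longrightarrow> vless (a * c) (b * d)"
  by (metis vle_mult vle_mult_cancel vle_refl vle_trans mult.commute)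

lemma vle_of_int: "vle (of_int n) 1" by (simp add: vle_1_iff subring_of_int[OF subring])

text \<open>By Bezout, since \<open>\<bar>p\<bar> < 1\<close> and a sum of numbers smaller than 1 is
smaller than 1.\<close>

lemma vle_one_of_coprime:
  assumes p: "prime p" "1 / of_nat p \<notin> B" and a: "coprime a (int p)"
  shows "vle 1 (of_int a)"
proof (rule ccontr)
  assume "\<not> ?thesis"
  moreover have "vless (of_nat p) 1"
  proof
    assume "vle 1 (of_nat p)"
    then obtain b where "b \<in> B" "1 = b * of_nat p" unfolding vle_def by blast
    then have "1 / of_nat p = b" using prime_gt_0_nat[OF p(1)] by (simp add: field_simps)
    with p(2) \<open>b \<in> B\<close> show False by simp
  qed
  moreover obtain u v where uv: "a * u + int p * v = 1"
    using bezout_int[of a "int p"] a by (metis coprime_imp_gcd_eq_1 mult.commute)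
  ultimately have "vless (of_int u * of_int a) 1" "vless (of_int v * of_nat p) 1"
    using vle_mult[OF vle_of_int[of u] vle_refl[of "of_int a"]]
      vle_mult[OF vle_of_int[of v] vle_refl[of "of_nat p"]] vle_trans by auto
  from vless_add[OF this] have "vless (of_int (a * u + int p * v)) 1" by (simp add: mult.commute)
  then show False by (simp add: uv)
qed

lemma vle_prime_power_of_int:
  assumes p: "prime p" "1 / of_nat p \<notin> B" and a: "a \<noteq> 0"
  shows "\<exists>j. vle (of_nat p ^ j) (of_int a)"
proof -
  obtain c where c: "a = int p ^ multiplicity (int p) a * c" "\<not> int p dvd c"
  proof -
    have "\<not> is_unit (int p)" using p(1) prime_gt_1_nat by fastforce
    from multiplicity_decompose'[OF a this] that show thesis by metis
  qed
  then have "coprime c (int p)"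
    using p(1) by (metis coprime_commute prime_imp_coprime prime_int_nat_transfer nat_int of_nat_0_le_iff prime_nat_int_transfer)
  from vle_mult[OF vle_refl vle_one_of_coprime[OF p this], of "of_nat p ^ multiplicity (int p) a"]
  show ?thesis by (metis c(1) mult.right_neutral of_int_mult of_int_of_nat_eq of_int_power)
qed

text \<open>If \<open>t\<close> belongs to the ring, then the constant coefficient of an equation of
\<open>t\<close> over \<open>\<int>\<close> is a multiple of \<open>t\<close>, so it is a
nonzero integer that is not larger than \<open>t\<close>.\<close>

lemma vle_prime_power_of_algebraic:
  assumes p: "prime p" "1 / of_nat p \<notin> B" and t: "algebraic t" "t \<noteq> 0"
  shows "\<exists>j. vle (of_nat p ^ j) t"
proof (cases "t \<in> B")
  case True
  obtain h where h: "coeff h 0 \<noteq> 0" "poly (map_poly of_int h) t = 0"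
    using algebraicE'_nonzero[OF t] by metis
  define f :: "complex poly" where "f = map_poly of_int h"
  define a where "a = coeff h 0"
  have f: "coeff f i = of_int (coeff h i)" "poly f t = 0" for i
    using h(2) by (simp_all add: f_def coeff_map_poly)
  obtain d g where g: "f = pCons d g" by (cases f)
  have "of_int a = - (poly g t) * t" using f(2) f(1)[of 0] g by (simp add: a_def eq_neg_iff_add_eq_0 mult.commute)
  moreover have "poly g t \<in> B"
  proof -
    have "coeff g i \<in> B" for i
      using f(1)[of "Suc i"] g subring_of_int[OF subring] by simp
    then show ?thesis unfolding poly_altdef
      by (intro subring_sum[OF subring] subring_mult[OF subring] subring_power[OF subring] True)
  qed
  ultimately have "vle (of_int a) t" unfolding vle_def using subring_uminus[OF subring] by blast
  moreover have "a \<noteq> 0" using h(1) by (simp add: a_def)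
  ultimately show ?thesis using vle_prime_power_of_int[OF p] vle_trans by blast
next
  case False
  then have "vle 1 t" using vle_total vle_1_iff by blast
  then show ?thesis by (intro exI[of _ 0]) simp
qed

lemma vle_inverse: "a \<noteq> 0 \<Longrightarrow> b \<noteq> 0 \<Longrightarrow> vle a b \<Longrightarrow> vle (1 / b) (1 / a)"
  using vle_mult_cancel[of "1 / (a * b)" a b] by (simp add: field_simps)

lemma algebraic_vle_prime_power:
  assumes p: "prime p" "1 / of_nat p \<notin> B" and t: "algebraic t"
  shows "\<exists>j. vle t ((1 / of_nat p) ^ j)"
proof (cases "t = 0")
  case False
  then obtain j where "vle (of_nat p ^ j) (1 / t)"
    using vle_prime_power_of_algebraic[OF p, of "1 / t"] algebraic_inverse[OF t] by (auto simp: inverse_eq_divide)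
  from vle_inverse[OF _ _ this] show ?thesis
    using False prime_gt_0_nat[OF p(1)] by (auto simp: power_one_over)
qed simp

end

text \<open>If \<open>p\<close> divides the denominator of \<open>z\<close>, then in a valuation ring
that does not contain \<open>1/p\<close> the numerator of \<open>z\<close> is a unit.\<close>

lemma nonintegral_rational_prime:
  assumes z: "z \<in> \<rat>" "z \<notin> \<int>"
  obtains p B where "prime p" "valuation_ring B" "1 / of_nat p \<notin> B" "valuation_ring.vle B (1 / of_nat p) z"
proof -
  obtain q where q: "z = of_rat q" using z(1) by (elim Rats_cases)
  obtain a b where ab: "quotient_of q = (a, b)" by fastforce
  have b: "b > 0" "coprime a b" "q = of_int a / of_int b"
    using quotient_of_denom_pos[OF ab] quotient_of_coprime[OF ab] quotient_of_div[OF ab] by auto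
  have "b \<noteq> 1" using b(3) z(2) q by auto
  then obtain p' where p': "prime p'" "p' dvd nat b"
  proof -
    have "nat b \<noteq> 1" using \<open>b \<noteq> 1\<close> b(1) by auto
    from prime_factor_nat[OF this] that show thesis by blast
  qed
  define p where "p = p'"
  have p: "prime p" "int p dvd b" using p' b(1) unfolding p_def by (auto simp: int_dvd_int_iff[symmetric])
  obtain B where B: "valuation_ring B" "1 / of_nat p \<notin> B"
    using valuation_ring_exists prime_gt_1_nat[OF p(1)] by metis
  interpret valuation_ring B by (rule B(1))
  obtain c where c: "b = int p * c" using p(2) by blast
  have "\<not> int p dvd a"
  proof
    assume "int p dvd a"
    then have "is_unit (int p)" using coprime_common_divisor[OF b(2)] p(2) by blast
    then show False using prime_gt_1_nat[OF p(1)] by simp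
  qed
  then have "coprime a (int p)"
    using p(1) by (metis coprime_commute prime_imp_coprime prime_nat_int_transfer)
  from vle_one_of_coprime[OF p(1) B(2) this]
  have 1: "vle (of_int c) (of_int a)" using vle_of_int vle_trans by blast
  have c0: "c \<noteq> 0" using c b(1) by auto
  have p0: "of_nat p \<noteq> (0 :: complex)" using prime_gt_0_nat[OF p(1)] by simp
  have "z = of_int a * (1 / (of_nat p * of_int c))" using q b(3) c by (simp add: of_rat_divide of_rat_mult)
  moreover have "1 / of_nat p = of_int c * (1 / (of_nat p * of_int c :: complex))" using c0 by simp
  ultimately have "vle (1 / of_nat p) z" using vle_mult[OF 1 vle_refl] by metis
  then show thesis using that p(1) B by blast
qed

lemma rational_in_all_valuation_rings:
  assumes z: "z \<in> \<rat>" and all: "\<And>B. valuation_ring B \<Longrightarrow> z \<in> B"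
  shows "z \<in> \<int>"
proof (rule ccontr)
  assume "z \<notin> \<int>"
  then obtain p B where B: "valuation_ring B" "1 / of_nat p \<notin> B" "valuation_ring.vle B (1 / of_nat p) z"
    using nonintegral_rational_prime[OF z] by metis
  interpret valuation_ring B by (rule B(1))
  have "vle z 1" using all[OF B(1)] by (simp add: vle_1_iff)
  then have "1 / of_nat p \<in> B" using vle_trans[OF B(3), of 1] by (simp add: vle_1_iff)
  with B(2) show False by simp
qed

section \<open>Words in the Vieta involutions\<close>

definition vieta :: "(idx \<Rightarrow> 'a::comm_ring_1) \<Rightarrow> idx \<Rightarrow> (idx \<Rightarrow> 'a) \<Rightarrow> idx \<Rightarrow> 'a" where
  "vieta \<alpha> i x = x(i := \<alpha> i - (case i of I1 \<Rightarrow> x I2 * x I3 | I2 \<Rightarrow> x I3 * x I1 | I3 \<Rightarrow> x I1 * x I2) - x i)"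

definition cubic :: "(idx \<Rightarrow> 'a::comm_ring_1) \<Rightarrow> (idx \<Rightarrow> 'a) \<Rightarrow> 'a" where
  "cubic \<alpha> x = (x I1)\<^sup>2 + (x I2)\<^sup>2 + (x I3)\<^sup>2 + x I1 * x I2 * x I3
     - \<alpha> I1 * x I1 - \<alpha> I2 * x I2 - \<alpha> I3 * x I3"

definition act :: "(idx \<Rightarrow> 'a::comm_ring_1) \<Rightarrow> idx list \<Rightarrow> (idx \<Rightarrow> 'a) \<Rightarrow> idx \<Rightarrow> 'a" where
  "act \<alpha> w x = fold (vieta \<alpha>) w x"

definition distinct3 :: "idx \<Rightarrow> idx \<Rightarrow> idx \<Rightarrow> bool" where
  "distinct3 i j k \<longleftrightarrow> i \<noteq> j \<and> i \<noteq> k \<and> j \<noteq> k"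

lemma distinct3_cases: "distinct3 i j k \<Longrightarrow> l = i \<or> l = j \<or> l = k"
  unfolding distinct3_def by (cases i; cases j; cases k; cases l) auto

lemma distinct3_third: "i \<noteq> j \<Longrightarrow> \<exists>k. distinct3 i j k"
  unfolding distinct3_def by (cases i; cases j) (metis idx.distinct)+

lemma vieta_distinct3: "distinct3 i j k \<Longrightarrow> vieta \<alpha> i x = x(i := \<alpha> i - x j * x k - x i)"
  unfolding distinct3_def vieta_def by (cases i; cases j; cases k) (auto simp: mult.commute)

lemma cubic_distinct3: "distinct3 i j k \<Longrightarrow>
  cubic \<alpha> x = (x i)\<^sup>2 + (x j)\<^sup>2 + (x k)\<^sup>2 + x i * x j * x k - \<alpha> i * x i - \<alpha> j * x j - \<alpha> k * x k"
  unfolding distinct3_def cubic_def by (cases i; cases j; cases k) (auto simp: algebra_simps)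

lemma idx_ext: "distinct3 i j k \<Longrightarrow> x i = y i \<Longrightarrow> x j = y j \<Longrightarrow> x k = y k \<Longrightarrow> x = y"
  by (rule ext) (drule distinct3_cases, elim disjE, auto)

lemma vieta_other [simp]: "i \<noteq> l \<Longrightarrow> vieta \<alpha> i x l = x l"
  by (simp add: vieta_def)

lemma vieta_vieta [simp]: "vieta \<alpha> i (vieta \<alpha> i x) = x"
  by (cases i) (auto simp: vieta_def)

lemma cubic_vieta [simp]: "cubic \<alpha> (vieta \<alpha> i x) = cubic \<alpha> x"
  by (cases i) (auto simp: vieta_def cubic_def algebra_simps power2_eq_square)

lemma act_Nil [simp]: "act \<alpha> [] x = x"
  and act_Cons [simp]: "act \<alpha> (i # w) x = act \<alpha> w (vieta \<alpha> i x)"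
  and act_append [simp]: "act \<alpha> (v @ w) x = act \<alpha> w (act \<alpha> v x)"
  by (simp_all add: act_def)

lemma cubic_act [simp]: "cubic \<alpha> (act \<alpha> w x) = cubic \<alpha> x"
  by (induction w arbitrary: x) auto

lemma act_rev: "act \<alpha> w x = y \<Longrightarrow> act \<alpha> (rev w) y = x"
  by (induction w arbitrary: x) auto

text \<open>For \<open>J = UNIV\<close> this is orbit equivalence. Smaller sets \<open>J\<close>
restrict to the involutions that preserve a lattice.\<close>

definition linked :: "(idx \<Rightarrow> 'a::comm_ring_1) \<Rightarrow> idx set \<Rightarrow> (idx \<Rightarrow> 'a) \<Rightarrow> (idx \<Rightarrow> 'a) \<Rightarrow> bool" where
  "linked \<alpha> J x y \<longleftrightarrow> (\<exists>w. set w \<subseteq> J \<and> act \<alpha> w x = y)"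

lemma linked_sym: "linked \<alpha> J x y \<Longrightarrow> linked \<alpha> J y x"
  unfolding linked_def using act_rev by (metis set_rev)

lemma linked_trans: "linked \<alpha> J x y \<Longrightarrow> linked \<alpha> J y z \<Longrightarrow> linked \<alpha> J x z"
  unfolding linked_def by (metis act_append set_append Un_least)

lemma linked_mono: "linked \<alpha> J x y \<Longrightarrow> J \<subseteq> J' \<Longrightarrow> linked \<alpha> J' x y"
  unfolding linked_def by blast

definition minimal_word :: "(idx \<Rightarrow> 'a::comm_ring_1) \<Rightarrow> idx set \<Rightarrow> (idx \<Rightarrow> 'a) \<Rightarrow> idx list \<Rightarrow> bool" where
  "minimal_word \<alpha> J x w \<longleftrightarrow> set w \<subseteq> J \<and>
     (\<forall>v. set v \<subseteq> J \<longrightarrow> act \<alpha> v x = act \<alpha> w x \<longrightarrow> length w \<le> length v)"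

lemma linked_minimal_word:
  assumes "linked \<alpha> J x y"
  obtains w where "minimal_word \<alpha> J x w" "act \<alpha> w x = y"
proof -
  let ?P = "\<lambda>w. set w \<subseteq> J \<and> act \<alpha> w x = y"
  have "\<exists>w. ?P w" using assms unfolding linked_def .
  then obtain w where "?P w" "\<And>v. ?P v \<Longrightarrow> length w \<le> length v"
    using ex_has_least_nat[of ?P _ length] by metis
  then have "minimal_word \<alpha> J x w" "act \<alpha> w x = y" unfolding minimal_word_def by auto
  then show thesis by (rule that)
qed

lemma minimal_word_points_distinct:
  assumes "minimal_word \<alpha> J x w" "s < t" "t \<le> length w"
  shows "act \<alpha> (take s w) x \<noteq> act \<alpha> (take t w) x"
proof
  assume eq: "act \<alpha> (take s w) x = act \<alpha> (take t w) x"
  let ?v = "take s w @ drop t w"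
  have "act \<alpha> ?v x = act \<alpha> w x"
    by (metis act_append append_take_drop_id eq)
  moreover have "set ?v \<subseteq> J"
    using assms(1) set_take_subset set_drop_subset unfolding minimal_word_def by fastforce
  ultimately have "length w \<le> length ?v" using assms(1) unfolding minimal_word_def by blast
  with assms(2,3) show False by simp
qed

lemma act_take_Suc: "t < length w \<Longrightarrow> act \<alpha> (take (Suc t) w) x = vieta \<alpha> (w ! t) (act \<alpha> (take t w) x)"
  by (simp add: take_Suc_conv_app_nth)

lemma minimal_word_distinct_adj:
  assumes "minimal_word \<alpha> J x w" shows "distinct_adj w"
  unfolding distinct_adj_conv_nth
proof (intro allI impI notI)
  fix t assume t: "Suc t < length w" and eq: "w ! t = w ! Suc t"
  have "act \<alpha> (take (Suc (Suc t)) w) x = act \<alpha> (take t w) x"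
    using t by (simp add: act_take_Suc eq)
  moreover have "act \<alpha> (take t w) x \<noteq> act \<alpha> (take (Suc (Suc t)) w) x"
    using t by (intro minimal_word_points_distinct[OF assms]) auto
  ultimately show False by simp
qed

lemma linked_distinct_adj:
  assumes "linked \<alpha> J x y" obtains w where "set w \<subseteq> J" "distinct_adj w" "act \<alpha> w x = y"
  using linked_minimal_word[OF assms] minimal_word_distinct_adj unfolding minimal_word_def by metis

section \<open>Escape to infinity\<close>

text \<open>The situation just after a step in coordinate \<open>l\<close> that exceeded the bound
\<open>M\<close> of all coefficients: this coordinate dominates the others, and undoing the step
would make it smaller.\<close>

context valuation_ring
begin

definition rising :: "(idx \<Rightarrow> complex) \<Rightarrow> complex \<Rightarrow> idx \<Rightarrow> (idx \<Rightarrow> complex) \<Rightarrow> bool" where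
  "rising \<alpha> M l p \<longleftrightarrow> vless M (p l) \<and> (\<forall>j. vle (p j) (p l)) \<and> vless (vieta \<alpha> l p l) (p l)"

text \<open>Write \<open>x\<close>, \<open>y\<close>, \<open>z\<close> for the coordinates with
indices \<open>l\<close>, \<open>l'\<close> and the third one, and \<open>x'\<close>,
\<open>y'\<close> for the values that the involutions give to \<open>x\<close> and
\<open>y\<close>. Suppose that \<open>\<bar>y'\<bar> \<le> \<bar>x\<bar>\<close>. Then \<open>z
x = \<alpha> - y - y'\<close> gives \<open>\<bar>z\<bar> \<le> 1\<close>. As \<open>x\<close>
alone dominates \<open>\<alpha> - x'\<close>, the relation \<open>y z = \<alpha> - x -
x'\<close> gives \<open>\<bar>x\<bar> \<le> \<bar>y\<bar>\<close>. But by the equation of the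
surface \<open>y\<^sup>2\<close> is the sum of \<open>x x'\<close> and terms that are smaller
than \<open>x\<^sup>2\<close>, a contradiction.\<close>

lemma rising_step:
  assumes M: "vle 1 M" "\<And>i. vle (\<alpha> i) M" "vle (cubic \<alpha> p) M"
    and S: "rising \<alpha> M l p" and l': "l' \<noteq> l"
  shows "rising \<alpha> M l' (vieta \<alpha> l' p)"
proof -
  obtain k where k: "distinct3 l' l k" using distinct3_third[OF l'] by blast
  then have k2: "distinct3 l l' k" by (auto simp: distinct3_def)
  define x y z x' y' where "x = p l" and "y = p l'" and "z = p k"
    and "x' = vieta \<alpha> l p l" and "y' = vieta \<alpha> l' p l'"
  have x': "x' = \<alpha> l - y * z - x" and y': "y' = \<alpha> l' - x * z - y"
    by (simp_all add: x_def y_def z_def x'_def y'_def vieta_distinct3[OF k] vieta_distinct3[OF k2])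
  have Mx: "vless M x" and yx: "vle y x" and zx: "vle z x" and x'x: "vless x' x"
    using S by (auto simp: rising_def x_def y_def z_def x'_def)
  have x0: "x \<noteq> 0" using Mx by auto
  have one_x: "vless 1 x" using M(1) Mx vle_vless_trans by blast
  have small: "vless a x" if "vle a M" for a using that Mx vle_vless_trans by blast
  have "vless x y'"
  proof (rule ccontr)
    assume "\<not> vless x y'"
    then have y'x: "vle y' x" by simp
    have "vle (\<alpha> l' - y - y') x"
      using small[OF M(2), THEN vless_imp_vle] yx y'x by (intro vle_diff)
    then have "vle (z * x) (1 * x)" by (simp add: y' algebra_simps)
    then have z1: "vle z 1" using x0 vle_mult_cancel by blast
    have "vle (y * z) y" using vle_mult[OF vle_refl z1, of y] by simp
    moreover have "vle x (y * z)"
    proof (rule ccontr)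
      assume "vless (y * z) x"
      from vless_diff[OF vless_diff[OF small[OF M(2)] this] x'x] have "vless (\<alpha> l - y * z - x') x" .
      then show False by (simp add: x')
    qed
    ultimately have xy: "vle x y" using vle_trans by blast
    have big: "vless a (x * x)" if "vle a M" for a
      using vless_mult[OF vless_imp_vle[OF one_x] small[OF that] x0] by simp
    have "vle (z * z) 1" using vle_mult[OF z1 z1] by simp
    then have zz: "vless (z * z) (x * x)" using big M(1) vle_trans by blast
    have xx': "vless (x * x') (x * x)" using vless_mult[OF vle_refl x'x x0] .
    have ay: "vless (\<alpha> l' * y) (x * x)"
      using vless_mult[OF yx small[OF M(2)] x0] by (simp add: mult.commute)
    have az: "vless (\<alpha> k * z) (x * x)"
      using vle_mult[OF M(2) z1] by (intro big) simp
    have "vless (x * x' - z * z + \<alpha> l' * y + \<alpha> k * z + cubic \<alpha> p) (x * x)"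
      by (intro vless_add vless_diff xx' zz ay az big[OF M(3)])
    moreover have "x * x' - z * z + \<alpha> l' * y + \<alpha> k * z + cubic \<alpha> p = y * y"
      unfolding x' cubic_distinct3[OF k2]
      by (simp add: x_def y_def z_def algebra_simps power2_eq_square)
    ultimately show False using vle_mult[OF xy xy] by simp
  qed
  then have xy': "vle x y'" by (rule vless_imp_vle)
  have "vle (vieta \<alpha> l' p j) y'" for j
  proof -
    have "j = l' \<or> j = l \<or> j = k" by (rule distinct3_cases[OF k])
    then show ?thesis
    proof (elim disjE)
      assume "j = l'" then show ?thesis by (simp add: y'_def)
    next
      assume "j = l" then show ?thesis using l' xy' by (simp add: x_def)
    next
      assume "j = k" then show ?thesis using k zx xy' vle_trans by (auto simp: z_def distinct3_def)
    qed
  qed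
  moreover have "vless M y'" using Mx xy' vle_trans by blast
  moreover have "vless y y'" using yx \<open>vless x y'\<close> vle_vless_trans by blast
  ultimately show ?thesis by (simp add: rising_def flip: y'_def y_def)
qed

lemma rising_forever:
  assumes M: "vle 1 M" "\<And>i. vle (\<alpha> i) M" "vle (cubic \<alpha> p) M"
    and "rising \<alpha> M l p" "distinct_adj (l # w)"
  shows "\<exists>l'. rising \<alpha> M l' (act \<alpha> w p)"
  using assms(3-)
proof (induction w arbitrary: l p)
  case (Cons a w)
  from Cons.prems have "rising \<alpha> M a (vieta \<alpha> a p)" by (intro rising_step M) auto
  with Cons.IH[of "vieta \<alpha> a p" a] Cons.prems show ?case by simp
qed auto

text \<open>The first step out of the region bounded by \<open>M\<close> produces a rising coordinate,
and from then on the region is never entered again.\<close>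

lemma bounded_between_bounded_points:
  assumes M: "vle 1 M" "\<And>i. vle (\<alpha> i) M" "vle (cubic \<alpha> p) M"
    and "\<And>j. vle (p j) M" "distinct_adj (u @ v)" "\<And>j. vle (act \<alpha> (u @ v) p j) M"
  shows "vle (act \<alpha> u p j) M"
  using assms(3-)
proof (induction u arbitrary: p)
  case (Cons a u)
  have "\<forall>j. vle (vieta \<alpha> a p j) M"
  proof (rule ccontr)
    assume "\<not> ?thesis"
    then obtain j where j: "vless M (vieta \<alpha> a p j)" by blast
    with Cons.prems(2) have "j = a" by (metis vieta_other)
    with j have a: "vless M (vieta \<alpha> a p a)" by simp
    have "vle (vieta \<alpha> a p j) (vieta \<alpha> a p a)" for j
      using vle_trans[OF Cons.prems(2)[of j] vless_imp_vle[OF a]] by (cases "j = a") auto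
    moreover have "vless (p a) (vieta \<alpha> a p a)" by (rule vle_vless_trans[OF Cons.prems(2) a])
    ultimately have "rising \<alpha> M a (vieta \<alpha> a p)" using a by (simp add: rising_def)
    moreover have "vle (cubic \<alpha> (vieta \<alpha> a p)) M" "distinct_adj (a # u @ v)"
      using Cons.prems(1,3) by simp_all
    ultimately obtain l' where "rising \<alpha> M l' (act \<alpha> (u @ v) (vieta \<alpha> a p))"
      using rising_forever[where \<alpha> = \<alpha> and M = M, OF M(1,2)] by blast
    then show False using Cons.prems(4)[of l'] by (simp add: rising_def)
  qed
  then have "vle (act \<alpha> u (vieta \<alpha> a p) j) M"
    using Cons.prems distinct_adj_ConsD[of a "u @ v"] by (intro Cons.IH) simp_all
  then show ?case by simp
qed auto

end

text \<open>The analogue for the usual absolute value. Cancellation can make a single large coordinate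
small again, so all three are required to be large; then the product of two of them outweighs
the other terms in the formula for the third.\<close>

definition escaped :: "real \<Rightarrow> idx \<Rightarrow> (idx \<Rightarrow> complex) \<Rightarrow> bool" where
  "escaped K l p \<longleftrightarrow> (\<forall>j. K \<le> cmod (p j)) \<and> (\<forall>j. cmod (p j) \<le> cmod (p l))"

lemma cmod_triangle3: "cmod (a - b - c) \<ge> cmod b - cmod c - cmod a"
  using norm_triangle_ineq2[of b "a - c"] norm_triangle_ineq4[of a c]
  by (simp add: norm_minus_commute algebra_simps)

lemma escaped_step:
  assumes K: "3 \<le> K" "\<And>i. cmod (\<alpha> i) \<le> K" and e: "escaped K l p" and l': "l' \<noteq> l"
  shows "escaped K l' (vieta \<alpha> l' p)"
proof -
  obtain k where k: "distinct3 l' l k" using distinct3_third[OF l'] by blast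
  have ge: "K \<le> cmod (p j)" and le: "cmod (p j) \<le> cmod (p l)" for j using e by (auto simp: escaped_def)
  let ?y = "vieta \<alpha> l' p l'"
  have y: "?y = \<alpha> l' - p l * p k - p l'" by (simp add: vieta_distinct3[OF k])
  have "3 * cmod (p l) \<le> cmod (p k) * cmod (p l)"
    using ge[of k] K(1) by (intro mult_right_mono) auto
  then have "3 * cmod (p l) \<le> cmod (p l * p k)" by (simp add: norm_mult mult.commute)
  moreover have "cmod ?y \<ge> cmod (p l * p k) - cmod (p l') - cmod (\<alpha> l')"
    unfolding y by (rule cmod_triangle3)
  ultimately have "cmod (p l) \<le> cmod ?y"
    using le[of l'] ge[of l] K(2)[of l'] by linarith
  then have "cmod (vieta \<alpha> l' p j) \<le> cmod ?y \<and> K \<le> cmod (vieta \<alpha> l' p j)" for j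
    using le[of j] ge[of j] ge[of l] by (cases "j = l'") auto
  then show ?thesis by (simp add: escaped_def)
qed

lemma escaped_forever:
  assumes K: "3 \<le> K" "\<And>i. cmod (\<alpha> i) \<le> K" and "escaped K l p" "distinct_adj (l # w)"
  shows "escaped K (last (l # w)) (act \<alpha> w p)"
  using assms(3-)
proof (induction w arbitrary: l p)
  case (Cons a w)
  from Cons.prems have "escaped K a (vieta \<alpha> a p)" by (intro escaped_step[OF K]) auto
  with Cons.IH[of a "vieta \<alpha> a p"] Cons.prems show ?case by simp
qed auto

text \<open>The way in: two large coordinates make the third one large.\<close>

lemma escaped_vieta:
  assumes K: "3 \<le> K" "\<And>i. cmod (\<alpha> i) \<le> K" and d: "distinct3 i j k"
    and ij: "K \<le> cmod (p i)" "K \<le> cmod (p j)" and k: "cmod (p k) \<le> K"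
  shows "escaped K k (vieta \<alpha> k p)"
proof -
  have d': "distinct3 k i j" using d by (auto simp: distinct3_def)
  let ?z = "vieta \<alpha> k p k"
  have z: "?z = \<alpha> k - p i * p j - p k" by (simp add: vieta_distinct3[OF d'])
  have ge: "cmod ?z \<ge> cmod (p i * p j) - cmod (p k) - cmod (\<alpha> k)"
    unfolding z by (rule cmod_triangle3)
  have *: "a \<le> a * b - 2 * K" if "K \<le> a" "K \<le> b" for a b
  proof -
    have "a * 3 \<le> a * b" using that K(1) by (intro mult_left_mono) auto
    then show ?thesis using that by linarith
  qed
  have "cmod (p i) \<le> cmod ?z" "cmod (p j) \<le> cmod ?z"
    using ge *[OF ij] *[OF ij(2,1)] k K(2)[of k] unfolding norm_mult
    by (simp_all add: mult.commute)
  moreover have "vieta \<alpha> k p i = p i" "vieta \<alpha> k p j = p j" using d by (auto simp: distinct3_def)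
  ultimately have "cmod (vieta \<alpha> k p l) \<le> cmod ?z \<and> K \<le> cmod (vieta \<alpha> k p l)" for l
    using distinct3_cases[OF d, of l] ij by (elim disjE) simp_all
  then show ?thesis by (simp add: escaped_def)
qed

text \<open>The action is given by polynomials with integer coefficients, so it commutes with ring
homomorphisms, provided that the coefficients of the involutions in the word are mapped
accordingly.\<close>

lemma act_hom:
  assumes "\<And>a b. h (a - b) = h a - h b" "\<And>a b. h (a * b) = h a * h b"
    and "\<And>i. i \<in> set w \<Longrightarrow> \<alpha>' i = h (\<alpha> i)"
  shows "act \<alpha>' w (\<lambda>i. h (x i)) = (\<lambda>i. h (act \<alpha> w x i))"
  using assms(3)
proof (induction w arbitrary: x)
  case (Cons a w)
  have "vieta \<alpha>' a (\<lambda>i. h (x i)) = (\<lambda>i. h (vieta \<alpha> a x i))"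
    using Cons.prems[of a] by (cases a) (auto simp: vieta_def assms(1,2))
  then show ?case using Cons by simp
qed simp

section \<open>Local maxima of the height along a path\<close>

text \<open>At a local maximum of \<open>\<bar>x\<bar> + \<bar>y\<bar> + \<bar>z\<bar>\<close> along a path, neither of the two adjacent steps, which move
different coordinates \<open>x\<close> and \<open>y\<close>, increases the absolute value of the moved coordinate. The following
lemmas bound \<open>\<bar>x\<bar> + \<bar>y\<bar>\<close> at such a point. The argument depends on the quadratic form
\<open>x\<^sup>2 + z x y + y\<^sup>2\<close>, which is indefinite for \<open>\<bar>z\<bar> > 2\<close>, definite for \<open>\<bar>z\<bar> < 2\<close> and a square for
\<open>\<bar>z\<bar> = 2\<close>. Here \<open>\<bar>x z\<bar> \<le> 2 \<bar>y\<bar> + a\<close> and \<open>\<bar>y z\<bar> \<le> 2 \<bar>x\<bar> + a\<close>, which are added up.\<close>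

lemma local_max_large:
  fixes x y z :: real
  assumes "2 + e \<le> \<bar>z\<bar>" "\<bar>A - y * z - x\<bar> \<le> \<bar>x\<bar>" "\<bar>B - x * z - y\<bar> \<le> \<bar>y\<bar>"
    and "\<bar>A\<bar> \<le> a" "\<bar>B\<bar> \<le> a"
  shows "e * (\<bar>x\<bar> + \<bar>y\<bar>) \<le> 2 * a" "\<bar>x\<bar> * \<bar>z\<bar> \<le> 2 * \<bar>y\<bar> + a" "\<bar>y\<bar> * \<bar>z\<bar> \<le> 2 * \<bar>x\<bar> + a"
proof -
  have "\<bar>y * z\<bar> \<le> 2 * \<bar>x\<bar> + a" "\<bar>x * z\<bar> \<le> 2 * \<bar>y\<bar> + a" using assms by linarith+
  then show *: "\<bar>x\<bar> * \<bar>z\<bar> \<le> 2 * \<bar>y\<bar> + a" "\<bar>y\<bar> * \<bar>z\<bar> \<le> 2 * \<bar>x\<bar> + a" by (simp_all add: abs_mult)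
  have "\<bar>x\<bar> * (2 + e) \<le> \<bar>x\<bar> * \<bar>z\<bar>" "\<bar>y\<bar> * (2 + e) \<le> \<bar>y\<bar> * \<bar>z\<bar>"
    using assms(1) by (auto intro: mult_left_mono)
  with * show "e * (\<bar>x\<bar> + \<bar>y\<bar>) \<le> 2 * a" by (simp add: algebra_simps)
qed

text \<open>Every point of the surface with this \<open>z\<close> satisfies the bound, because the
definite form is at least \<open>(e/2) (x\<^sup>2 + y\<^sup>2)\<close>.\<close>

lemma local_max_small:
  fixes x y z :: real
  assumes "0 < e" "\<bar>z\<bar> \<le> 2 - e" "x\<^sup>2 + y\<^sup>2 + z\<^sup>2 + x * y * z - A * x - B * y - G * z = c"
    and "\<bar>A\<bar> \<le> a" "\<bar>B\<bar> \<le> a" "\<bar>G\<bar> \<le> a" "\<bar>c\<bar> \<le> a"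
  shows "e * (\<bar>x\<bar> + \<bar>y\<bar>) \<le> 16 * a + e"
proof -
  define S where "S = \<bar>x\<bar> + \<bar>y\<bar>"
  have a0: "0 \<le> a" using assms(4) by linarith
  have "2 * (\<bar>x\<bar> * \<bar>y\<bar>) \<le> x\<^sup>2 + y\<^sup>2"
    using sum_squares_bound[of "\<bar>x\<bar>" "\<bar>y\<bar>"] by simp
  moreover have "\<bar>x\<bar> * \<bar>y\<bar> * \<bar>z\<bar> \<le> \<bar>x\<bar> * \<bar>y\<bar> * (2 - e)" using assms(2) by (intro mult_left_mono) auto
  moreover have "- (x * y * z) \<le> \<bar>x\<bar> * \<bar>y\<bar> * \<bar>z\<bar>" by (metis abs_ge_minus_self abs_mult)
  moreover have e2: "e \<le> 2" using assms(1,2) by linarith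
  moreover have "(2 - e) * (2 * (\<bar>x\<bar> * \<bar>y\<bar>)) \<le> (2 - e) * (x\<^sup>2 + y\<^sup>2)"
    using calculation by (intro mult_left_mono) auto
  ultimately have "e * (x\<^sup>2 + y\<^sup>2) \<le> 2 * (x\<^sup>2 + y\<^sup>2 + x * y * z)" by (simp add: algebra_simps)
  moreover have "A * x \<le> a * \<bar>x\<bar>" "B * y \<le> a * \<bar>y\<bar>" "G * z \<le> a * 2"
  proof -
    have *: "A * x \<le> a * \<bar>x\<bar>" if "\<bar>A\<bar> \<le> a" for A x :: real
    proof -
      have "A * x \<le> \<bar>A\<bar> * \<bar>x\<bar>" by (metis abs_ge_self abs_mult)
      also have "\<dots> \<le> a * \<bar>x\<bar>" using that by (intro mult_right_mono) auto
      finally show ?thesis .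
    qed
    show "A * x \<le> a * \<bar>x\<bar>" "B * y \<le> a * \<bar>y\<bar>" using * assms by auto
    have "G * z \<le> a * \<bar>z\<bar>" using * assms by auto
    also have "\<dots> \<le> a * 2" using assms(1,2) a0 by (intro mult_left_mono) auto
    finally show "G * z \<le> a * 2" .
  qed
  moreover have "x\<^sup>2 + y\<^sup>2 + x * y * z \<le> A * x + B * y + G * z + c"
    using assms(3) zero_le_power2[of z] by linarith
  moreover have "a * S = a * \<bar>x\<bar> + a * \<bar>y\<bar>" by (simp add: S_def distrib_left)
  moreover have "c \<le> a" using assms(7) by linarith
  moreover have "r \<le> 2 * (t + 3 * a)" if "r \<le> 2 * q" "ax \<le> u" "bb \<le> v" "gz \<le> a * 2"
    "q \<le> ax + bb + gz + c" "t = u + v" "c \<le> a" for r t q ax u bb v gz :: real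
    using that by argo
  ultimately have "e * (x\<^sup>2 + y\<^sup>2) \<le> 2 * (a * S + 3 * a)" by blast
  moreover have "S\<^sup>2 \<le> 2 * (x\<^sup>2 + y\<^sup>2)"
    using sum_squares_bound[of "\<bar>x\<bar>" "\<bar>y\<bar>"] unfolding S_def power2_sum power2_abs by simp
  then have "e * S\<^sup>2 \<le> e * (2 * (x\<^sup>2 + y\<^sup>2))" using assms(1) by (intro mult_left_mono) auto
  then have "e * S\<^sup>2 \<le> 2 * (e * (x\<^sup>2 + y\<^sup>2))" by (simp only: mult.left_commute)
  ultimately have **: "e * S\<^sup>2 \<le> 4 * (a * S + 3 * a)" by argo
  show ?thesis
  proof (cases "S \<le> 1")
    case True
    then have "e * S \<le> e * 1" using assms(1) by (intro mult_left_mono) auto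
    then show ?thesis using a0 by (simp add: S_def)
  next
    case False
    then have "a * 1 \<le> a * S" using a0 by (intro mult_left_mono) auto
    then have "(e * S) * S \<le> (16 * a) * S" using ** by (simp add: power2_eq_square algebra_simps)
    then have "e * S \<le> 16 * a" using False by (simp add: mult_le_cancel_right)
    then show ?thesis using assms(1) by (simp add: S_def)
  qed
qed

lemma quadratic_bound:
  fixes S a :: real
  assumes "S\<^sup>2 \<le> a * \<bar>S\<bar> + 3 * a" "1 \<le> a" shows "\<bar>S\<bar> \<le> 4 * a"
proof (rule ccontr)
  assume n: "\<not> ?thesis"
  then have "1 \<le> \<bar>S\<bar>" using assms(2) by linarith
  then have "a * 1 \<le> a * \<bar>S\<bar>" using assms(2) by (intro mult_left_mono) auto
  moreover have "4 * a * \<bar>S\<bar> < \<bar>S\<bar> * \<bar>S\<bar>" using n assms(2) by (intro mult_strict_right_mono) auto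
  ultimately show False using assms(1) by (simp add: power2_eq_square abs_mult[symmetric])
qed

lemma shrinking_shift:
  fixes x d :: real assumes "\<bar>x + d\<bar> \<le> \<bar>x\<bar>" shows "0 < d \<Longrightarrow> x < 0" "d < 0 \<Longrightarrow> 0 < x"
  using assms by linarith+

text \<open>The case \<open>z = 2\<close>; the case \<open>z = -2\<close> follows by changing the sign
of \<open>y\<close>. The steps shift \<open>x\<close> by \<open>A - 2 (x + y)\<close> and
\<open>y\<close> by \<open>B - 2 (x + y)\<close>. A shift that does not increase the absolute
value points towards 0. If both shifts have the same sign, then so have \<open>x\<close> and
\<open>y\<close>, and the equation is a quadratic inequality for \<open>\<bar>x +
y\<bar>\<close>. Otherwise \<open>2 (x + y)\<close> lies between \<open>A\<close> and
\<open>B\<close>, and then the equation bounds \<open>(B - A) y\<close>. A vanishing first shift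
has to be excluded, since there are surfaces that contain the line \<open>x + y = A / 2\<close>
in the plane \<open>z = 2\<close>.\<close>

lemma local_max_parabolic:
  fixes x y :: real
  assumes eq: "(x + y)\<^sup>2 = A * x + B * y + c" and a: "\<bar>A\<bar> \<le> a" "\<bar>B\<bar> \<le> a" "\<bar>c\<bar> \<le> 3 * a" "1 \<le> a"
    and x: "\<bar>x + (A - 2 * (x + y))\<bar> \<le> \<bar>x\<bar>" and y: "\<bar>y + (B - 2 * (x + y))\<bar> \<le> \<bar>y\<bar>"
    and ne: "A \<noteq> 2 * (x + y)"
  shows "\<bar>x\<bar> + \<bar>y\<bar> \<le> 4 * a + 10 * a\<^sup>2 / \<bar>A - B\<bar>"
proof -
  define S where "S = x + y"
  have frac: "0 \<le> 10 * a\<^sup>2 / \<bar>A - B\<bar>" by simp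
  have same: "\<bar>x\<bar> + \<bar>y\<bar> \<le> 4 * a" if "\<bar>x\<bar> + \<bar>y\<bar> = \<bar>S\<bar>"
  proof -
    have "A * x \<le> a * \<bar>x\<bar>" "B * y \<le> a * \<bar>y\<bar>"
      using mult_right_mono[OF a(1), of "\<bar>x\<bar>"] mult_right_mono[OF a(2), of "\<bar>y\<bar>"]
        abs_ge_self[of "A * x"] abs_ge_self[of "B * y"] by (simp_all add: abs_mult)
    then have "S\<^sup>2 \<le> a * (\<bar>x\<bar> + \<bar>y\<bar>) + 3 * a" using eq a(3) by (simp add: S_def algebra_simps)
    then show ?thesis using quadratic_bound[of S a] a(4) that by simp
  qed
  define d1 d2 where "d1 = A - 2 * S" and "d2 = B - 2 * S"
  have sx: "0 < d1 \<Longrightarrow> x < 0" "d1 < 0 \<Longrightarrow> 0 < x" using shrinking_shift[OF x] by (simp_all add: d1_def S_def)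
  have sy: "0 < d2 \<Longrightarrow> y < 0" "d2 < 0 \<Longrightarrow> 0 < y" using shrinking_shift[OF y] by (simp_all add: d2_def S_def)
  have d1: "d1 \<noteq> 0" using ne by (simp add: d1_def S_def)
  have mixed: ?thesis if S: "\<bar>2 * S\<bar> \<le> a" and AB: "A \<noteq> B"
  proof -
    have "(B - A) * y = S\<^sup>2 - A * S - c" using eq by (simp add: S_def algebra_simps)
    also have "\<bar>\<dots>\<bar> \<le> S\<^sup>2 + \<bar>A * S\<bar> + \<bar>c\<bar>" using zero_le_power2[of S] by linarith
    also have "\<dots> \<le> a * a + a * a + 3 * (a * a)"
    proof -
      have "\<bar>S\<bar> \<le> a" using S by linarith
      then have "\<bar>S\<bar> * \<bar>S\<bar> \<le> a * a" "\<bar>A\<bar> * \<bar>S\<bar> \<le> a * a"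
        using a by (intro mult_mono; simp)+
      moreover have "1 * a \<le> a * a" using a(4) by (intro mult_right_mono) auto
      ultimately show ?thesis using a(3) by (simp add: power2_eq_square abs_mult)
    qed
    finally have "\<bar>A - B\<bar> * \<bar>y\<bar> \<le> 5 * a\<^sup>2"
      by (simp add: abs_mult abs_minus_commute power2_eq_square)
    then have "\<bar>y\<bar> \<le> 5 * a\<^sup>2 / \<bar>A - B\<bar>" using AB by (simp add: field_simps)
    moreover have "\<bar>x\<bar> \<le> \<bar>S\<bar> + \<bar>y\<bar>" by (simp add: S_def)
    moreover have "10 * a\<^sup>2 / \<bar>A - B\<bar> = 2 * (5 * a\<^sup>2 / \<bar>A - B\<bar>)" by simp
    ultimately show ?thesis using S a(4) by linarith
  qed
  consider "0 < d1 \<and> 0 < d2" | "d1 < 0 \<and> d2 < 0" | "0 < d1 \<and> d2 \<le> 0" | "d1 < 0 \<and> 0 \<le> d2"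
    using d1 by linarith
  then show ?thesis
  proof cases
    case 1
    then have "\<bar>x\<bar> + \<bar>y\<bar> = \<bar>S\<bar>" using sx sy by (auto simp: S_def)
    with same frac show ?thesis by linarith
  next
    case 2
    then have "\<bar>x\<bar> + \<bar>y\<bar> = \<bar>S\<bar>" using sx sy by (auto simp: S_def)
    with same frac show ?thesis by linarith
  next
    case 3
    then have "\<bar>2 * S\<bar> \<le> a" "A \<noteq> B" using a unfolding d1_def d2_def by linarith+
    then show ?thesis by (rule mixed)
  next
    case 4
    then have "\<bar>2 * S\<bar> \<le> a" "A \<noteq> B" using a unfolding d1_def d2_def by linarith+
    then show ?thesis by (rule mixed)
  qed
qed

definition abs_sum_real :: "(idx \<Rightarrow> real) \<Rightarrow> real" where
  "abs_sum_real p = \<bar>p I1\<bar> + \<bar>p I2\<bar> + \<bar>p I3\<bar>"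

lemma abs_sum_real_distinct3: "distinct3 i j k \<Longrightarrow> abs_sum_real p = \<bar>p i\<bar> + \<bar>p j\<bar> + \<bar>p k\<bar>"
  unfolding distinct3_def abs_sum_real_def by (cases i; cases j; cases k) auto

lemma lattice_ge:
  assumes "real N * x \<in> \<int>" "x \<noteq> 0" "N > 0" shows "1 \<le> real N * \<bar>x\<bar>"
proof -
  obtain n where n: "real N * x = of_int n" using assms(1) by (elim Ints_cases)
  then have "n \<noteq> 0" using assms(2,3) by auto
  then have "1 \<le> \<bar>real_of_int n\<bar>" by linarith
  then show ?thesis unfolding n[symmetric] by (simp add: abs_mult)
qed

text \<open>On the lattice, \<open>\<bar>z\<bar>\<close> is equal to 2 or differs from 2 by at least
\<open>1/N\<close>, so the previous bounds are uniform. If \<open>\<bar>z\<bar> > 2\<close>,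
then \<open>\<bar>z\<bar>\<close> itself is bounded by one of the inequalities for \<open>x
z\<close> and \<open>y z\<close> unless \<open>x = y = 0\<close>, in which case the equation of
the surface is a quadratic equation for \<open>z\<close>.\<close>

lemma lattice_local_max:
  fixes \<alpha> :: "idx \<Rightarrow> real" and N :: nat
  assumes N: "N > 0" and d: "distinct3 i j k"
  shows "\<exists>C. \<forall>p. (\<forall>l. real N * p l \<in> \<int>) \<longrightarrow> cubic \<alpha> p = \<beta> \<longrightarrow>
    \<bar>vieta \<alpha> i p i\<bar> \<le> \<bar>p i\<bar> \<longrightarrow> \<bar>vieta \<alpha> j p j\<bar> \<le> \<bar>p j\<bar> \<longrightarrow> C < abs_sum_real p \<longrightarrow> vieta \<alpha> i p = p"
proof -
  define a where "a = \<bar>\<alpha> i\<bar> + \<bar>\<alpha> j\<bar> + \<bar>\<alpha> k\<bar> + \<bar>\<beta>\<bar> + 4"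
  have a: "\<bar>\<alpha> i\<bar> \<le> a" "\<bar>\<alpha> j\<bar> \<le> a" "\<bar>\<alpha> k\<bar> \<le> a" "\<bar>\<beta>\<bar> \<le> a" "4 \<le> a"
    "\<bar>\<alpha> k\<bar> + \<bar>\<beta>\<bar> \<le> a" "2 * \<bar>\<alpha> k\<bar> + \<bar>\<beta>\<bar> + 4 \<le> 3 * a" by (simp_all add: a_def)
  define n where "n = real N"
  have n: "1 \<le> n" using N by (simp add: n_def)
  (* The three summands serve the cases abs z > 2, abs z < 2 and abs z = 2. *)
  define C where "C = (2 * a * n + n * (4 * a * n + a) + a) + (16 * a * n + 3) +
    (4 * a + 10 * a\<^sup>2 / \<bar>\<alpha> i - \<alpha> j\<bar> + 10 * a\<^sup>2 / \<bar>\<alpha> i + \<alpha> j\<bar> + 2)"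
  have nonneg: "0 \<le> 2 * a * n + n * (4 * a * n + a) + a" "0 \<le> 16 * a * n + 3"
    "0 \<le> 4 * a + 10 * a\<^sup>2 / \<bar>\<alpha> i - \<alpha> j\<bar> + 10 * a\<^sup>2 / \<bar>\<alpha> i + \<alpha> j\<bar> + 2"
    "0 \<le> 10 * a\<^sup>2 / \<bar>\<alpha> i - \<alpha> j\<bar>" "0 \<le> 10 * a\<^sup>2 / \<bar>\<alpha> i + \<alpha> j\<bar>"
    using a(5) n by simp_all
  have di: "distinct3 i j k" and dj: "distinct3 j i k" using d by (auto simp: distinct3_def)
  show ?thesis
  proof (intro exI[of _ C] allI impI)
    fix p assume lat: "\<forall>l. real N * p l \<in> \<int>" and surf: "cubic \<alpha> p = \<beta>"
      and vi: "\<bar>vieta \<alpha> i p i\<bar> \<le> \<bar>p i\<bar>" and vj: "\<bar>vieta \<alpha> j p j\<bar> \<le> \<bar>p j\<bar>" and C: "C < abs_sum_real p"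
    define x y z where "x = p i" and "y = p j" and "z = p k"
    have C: "C < \<bar>x\<bar> + \<bar>y\<bar> + \<bar>z\<bar>" using C abs_sum_real_distinct3[OF d] by (simp add: x_def y_def z_def)
    have vi: "\<bar>\<alpha> i - y * z - x\<bar> \<le> \<bar>x\<bar>" and vj: "\<bar>\<alpha> j - x * z - y\<bar> \<le> \<bar>y\<bar>"
      using vi vj by (simp_all add: vieta_distinct3[OF di] vieta_distinct3[OF dj] x_def y_def z_def)
    have surf: "x\<^sup>2 + y\<^sup>2 + z\<^sup>2 + x * y * z - \<alpha> i * x - \<alpha> j * y - \<alpha> k * z = \<beta>"
      using surf by (simp add: cubic_distinct3[OF d] x_def y_def z_def)
    show "vieta \<alpha> i p = p"
    proof (rule ccontr)
      assume "vieta \<alpha> i p \<noteq> p"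
      then have move: "\<alpha> i - y * z - x \<noteq> x"
        by (auto simp: vieta_distinct3[OF di] x_def y_def z_def)
      (* The four cases separate abs z > 2, abs z < 2, z = 2 and z = - 2. *)
      obtain m where m: "n * z = of_int m" using lat by (auto simp: n_def z_def elim: Ints_cases)
      consider "\<bar>m\<bar> \<ge> 2 * int N + 1" | "\<bar>m\<bar> \<le> 2 * int N - 1" | "m = 2 * int N" | "m = - 2 * int N"
        by linarith
      then show False
      proof cases
        case 1
        then have "real_of_int (2 * int N + 1) \<le> real_of_int \<bar>m\<bar>" by (simp only: of_int_le_iff)
        then have "2 * n + 1 \<le> \<bar>n * z\<bar>" unfolding m by (simp add: n_def)
        then have "2 + 1 / n \<le> \<bar>z\<bar>" using n by (simp add: abs_mult field_simps)
        note * = local_max_large[OF this vi vj a(1,2)]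
        have sum: "\<bar>x\<bar> + \<bar>y\<bar> \<le> 2 * a * n" using *(1) n by (simp add: field_simps)
        have "\<bar>z\<bar> \<le> n * (4 * a * n + a) + a"
        proof (cases "x = 0 \<and> y = 0")
          case True
          then have "z\<^sup>2 = \<alpha> k * z + \<beta>" using surf by simp
          also have "\<dots> \<le> \<bar>\<alpha> k\<bar> * \<bar>z\<bar> + \<bar>\<beta>\<bar> * \<bar>z\<bar>"
          proof -
            have "1 \<le> \<bar>z\<bar>" using \<open>2 + 1 / n \<le> \<bar>z\<bar>\<close> n by (smt (verit) divide_nonneg_nonneg)
            then have "\<bar>\<beta>\<bar> * 1 \<le> \<bar>\<beta>\<bar> * \<bar>z\<bar>" by (intro mult_left_mono) auto
            moreover have "\<alpha> k * z \<le> \<bar>\<alpha> k\<bar> * \<bar>z\<bar>" by (metis abs_ge_self abs_mult)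
            ultimately show ?thesis by linarith
          qed
          also have "\<dots> \<le> a * \<bar>z\<bar>" using mult_right_mono[OF a(6), of "\<bar>z\<bar>"] by (simp add: algebra_simps)
          finally have "\<bar>z\<bar> * \<bar>z\<bar> \<le> a * \<bar>z\<bar>" by (simp add: power2_eq_square)
          then have "\<bar>z\<bar> \<le> a" using a(5) by (smt (verit) mult_le_cancel_right)
          moreover have "0 \<le> n * (4 * a * n + a)" using a(5) n by simp
          ultimately show ?thesis by linarith
        next
          case False
          have bound: "\<bar>z\<bar> \<le> n * (4 * a * n + a)" if "\<bar>u\<bar> * \<bar>z\<bar> \<le> 2 * \<bar>v\<bar> + a" "1 \<le> n * \<bar>u\<bar>" "\<bar>v\<bar> \<le> 2 * a * n" for u v
          proof -
            have "1 * \<bar>z\<bar> \<le> n * \<bar>u\<bar> * \<bar>z\<bar>" using that(2) by (intro mult_right_mono) auto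
            also have "\<dots> = n * (\<bar>u\<bar> * \<bar>z\<bar>)" by simp
            also have "\<dots> \<le> n * (4 * a * n + a)" using that(1,3) n by (intro mult_left_mono) auto
            finally show ?thesis by simp
          qed
          have "\<bar>x\<bar> \<le> 2 * a * n" "\<bar>y\<bar> \<le> 2 * a * n" using sum by linarith+
          then have "\<bar>z\<bar> \<le> n * (4 * a * n + a)"
            using False bound[OF *(2)] bound[OF *(3)] lattice_ge[of N x] lattice_ge[of N y] lat N
            unfolding n_def x_def y_def by blast
          then show ?thesis using a(5) by linarith
        qed
        with sum C nonneg show False unfolding C_def by linarith
      next
        case 2
        then have "real_of_int \<bar>m\<bar> \<le> real_of_int (2 * int N - 1)" by (simp only: of_int_le_iff)
        then have "\<bar>n * z\<bar> \<le> 2 * n - 1" unfolding m by (simp add: n_def)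
        then have z: "\<bar>z\<bar> \<le> 2 - 1 / n" using n by (simp add: abs_mult field_simps)
        have "1 / n * (\<bar>x\<bar> + \<bar>y\<bar>) \<le> 16 * a + 1 / n"
          by (rule local_max_small[OF _ z surf a(1,2,3,4)]) (use n in auto)
        then have "n * (1 / n * (\<bar>x\<bar> + \<bar>y\<bar>)) \<le> n * (16 * a + 1 / n)" using n by (intro mult_left_mono) auto
        then have "\<bar>x\<bar> + \<bar>y\<bar> \<le> 16 * a * n + 1" using n by (simp add: distrib_left mult.commute)
        moreover have "\<bar>z\<bar> \<le> 2" using z n by (smt (verit) divide_nonneg_nonneg)
        ultimately show False using C nonneg unfolding C_def by linarith
      next
        case 3
        then have z: "z = 2" using m N by (simp add: n_def)
        have "\<bar>x\<bar> + \<bar>y\<bar> \<le> 4 * a + 10 * a\<^sup>2 / \<bar>\<alpha> i - \<alpha> j\<bar>"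
        proof (rule local_max_parabolic[where c = "2 * \<alpha> k + \<beta> - 4"])
          show "(x + y)\<^sup>2 = \<alpha> i * x + \<alpha> j * y + (2 * \<alpha> k + \<beta> - 4)"
            using surf by (simp add: z power2_eq_square algebra_simps)
          show "\<bar>2 * \<alpha> k + \<beta> - 4\<bar> \<le> 3 * a" using a(7) by linarith
          show "\<bar>x + (\<alpha> i - 2 * (x + y))\<bar> \<le> \<bar>x\<bar>" "\<bar>y + (\<alpha> j - 2 * (x + y))\<bar> \<le> \<bar>y\<bar>" "\<alpha> i \<noteq> 2 * (x + y)"
            using vi vj move by (simp_all add: z algebra_simps)
        qed (use a in auto)
        with C nonneg z show False unfolding C_def by linarith
      next
        case 4
        then have "(z + 2) * n = 0" using m by (simp add: n_def algebra_simps)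
        then have z: "z = - 2" using n by simp
        have "\<bar>x\<bar> + \<bar>- y\<bar> \<le> 4 * a + 10 * a\<^sup>2 / \<bar>\<alpha> i - (- \<alpha> j)\<bar>"
        proof (rule local_max_parabolic[where c = "- 2 * \<alpha> k + \<beta> - 4"])
          show "(x + - y)\<^sup>2 = \<alpha> i * x + - \<alpha> j * - y + (- 2 * \<alpha> k + \<beta> - 4)"
            using surf by (simp add: z power2_eq_square algebra_simps)
          show "\<bar>- 2 * \<alpha> k + \<beta> - 4\<bar> \<le> 3 * a" using a(7) by linarith
          show "\<bar>x + (\<alpha> i - 2 * (x + - y))\<bar> \<le> \<bar>x\<bar>" "\<alpha> i \<noteq> 2 * (x + - y)"
            using vi move by (simp_all add: z algebra_simps)
          show "\<bar>- y + (- \<alpha> j - 2 * (x + - y))\<bar> \<le> \<bar>- y\<bar>" using vj by (simp add: z algebra_simps)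
        qed (use a in auto)
        then have "\<bar>x\<bar> + \<bar>y\<bar> \<le> 4 * a + 10 * a\<^sup>2 / \<bar>\<alpha> i + \<alpha> j\<bar>" by simp
        with C nonneg z show False unfolding C_def by linarith
      qed
    qed
  qed
qed

section \<open>Bounded lattice paths\<close>

lemma lattice_local_max_uniform:
  fixes \<alpha> :: "idx \<Rightarrow> real" and N :: nat
  assumes N: "N > 0"
  obtains C where "\<And>p i j. i \<noteq> j \<Longrightarrow> (\<And>l. real N * p l \<in> \<int>) \<Longrightarrow> cubic \<alpha> p = \<beta> \<Longrightarrow>
    \<bar>vieta \<alpha> i p i\<bar> \<le> \<bar>p i\<bar> \<Longrightarrow> \<bar>vieta \<alpha> j p j\<bar> \<le> \<bar>p j\<bar> \<Longrightarrow> C < abs_sum_real p \<Longrightarrow> vieta \<alpha> i p = p"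
proof -
  let ?Q = "\<lambda>i j C. \<forall>p. (\<forall>l. real N * p l \<in> \<int>) \<longrightarrow> cubic \<alpha> p = \<beta> \<longrightarrow>
    \<bar>vieta \<alpha> i p i\<bar> \<le> \<bar>p i\<bar> \<longrightarrow> \<bar>vieta \<alpha> j p j\<bar> \<le> \<bar>p j\<bar> \<longrightarrow> C < abs_sum_real p \<longrightarrow> vieta \<alpha> i p = p"
  have "\<exists>C. ?Q i j C" if "i \<noteq> j" for i j
    using distinct3_third[OF that] lattice_local_max[OF N] by blast
  then have "\<forall>i j. \<exists>C. i \<noteq> j \<longrightarrow> ?Q i j C" by blast
  then obtain F where F: "\<And>i j. i \<noteq> j \<Longrightarrow> ?Q i j (F i j)" by metis
  define C where "C = Max {F i j |i j. i \<in> {I1, I2, I3} \<and> j \<in> {I1, I2, I3}}"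
  have "F i j \<le> C" for i j
    unfolding C_def by (rule Max_ge) (auto intro: finite_image_set2, metis idx.exhaust)
  then have less: "F i j < h" if "C < h" for i j h using that by (rule order_le_less_trans)
  show thesis
  proof (rule that[of C])
    fix p i j
    assume "i \<noteq> j" "\<And>l. real N * p l \<in> \<int>" "cubic \<alpha> p = \<beta>"
      "\<bar>vieta \<alpha> i p i\<bar> \<le> \<bar>p i\<bar>" "\<bar>vieta \<alpha> j p j\<bar> \<le> \<bar>p j\<bar>" "C < abs_sum_real p"
    then show "vieta \<alpha> i p = p" using F[of i j] less by blast
  qed
qed

text \<open>At an interior maximum above \<open>C\<close>, the step that leads there would be trivial,
but the points of a minimal path are distinct.\<close>

lemma minimal_word_heights:
  fixes \<alpha> :: "idx \<Rightarrow> real" and N :: nat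
  assumes C: "\<And>p i j. i \<noteq> j \<Longrightarrow> (\<And>l. real N * p l \<in> \<int>) \<Longrightarrow> cubic \<alpha> p = cubic \<alpha> x \<Longrightarrow>
      \<bar>vieta \<alpha> i p i\<bar> \<le> \<bar>p i\<bar> \<Longrightarrow> \<bar>vieta \<alpha> j p j\<bar> \<le> \<bar>p j\<bar> \<Longrightarrow> C < abs_sum_real p \<Longrightarrow> vieta \<alpha> i p = p"
    and w: "minimal_word \<alpha> J x w" and lat: "\<And>t l. real N * act \<alpha> (take t w) x l \<in> \<int>"
    and t: "t \<le> length w"
  shows "abs_sum_real (act \<alpha> (take t w) x) \<le> max C (max (abs_sum_real x) (abs_sum_real (act \<alpha> w x)))"
proof -
  define h where "h s = abs_sum_real (act \<alpha> (take s w) x)" for s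
  have "Max (h ` {..length w}) \<in> h ` {..length w}" by (rule Max_in) auto
  then obtain s where s: "Max (h ` {..length w}) = h s" "s \<in> {..length w}" by (rule imageE)
  have max: "h r \<le> h s" if "r \<le> length w" for r
    unfolding s(1)[symmetric] by (rule Max_ge) (use that in auto)
  have "h s \<le> max C (max (abs_sum_real x) (abs_sum_real (act \<alpha> w x)))"
  proof (rule ccontr)
    assume n: "\<not> ?thesis"
    have "s \<noteq> 0"
    proof
      assume "s = 0"
      then have "h s = abs_sum_real x" by (simp add: h_def)
      with n show False by simp
    qed
    moreover have "s \<noteq> length w"
    proof
      assume "s = length w"
      then have "h s = abs_sum_real (act \<alpha> w x)" by (simp add: h_def)
      with n show False by simp
    qed
    ultimately obtain r where r: "s = Suc r" "Suc r < length w" using s(2) by (cases s) auto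
    let ?p = "act \<alpha> (take s w) x"
    let ?i = "w ! r" and ?j = "w ! s"
    have nxt: "act \<alpha> (take (Suc s) w) x = vieta \<alpha> ?j ?p" using r by (intro act_take_Suc) simp
    have p: "?p = vieta \<alpha> ?i (act \<alpha> (take r w) x)" unfolding r(1) using r by (intro act_take_Suc) simp
    then have prev: "act \<alpha> (take r w) x = vieta \<alpha> ?i ?p" by simp
    have ij: "?i \<noteq> ?j" using distinct_adj_nth[OF minimal_word_distinct_adj[OF w], of r] r by simp
    have le: "\<bar>vieta \<alpha> l q l\<bar> \<le> \<bar>q l\<bar>" if "abs_sum_real (vieta \<alpha> l q) \<le> abs_sum_real q" for l q
      using that by (cases l) (simp_all add: abs_sum_real_def)
    have "vieta \<alpha> ?i ?p = ?p"
    proof (rule C[OF ij lat])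
      show "\<bar>vieta \<alpha> ?i ?p ?i\<bar> \<le> \<bar>?p ?i\<bar>" using max[of r] r by (intro le) (simp add: h_def prev)
      have "h (Suc s) \<le> h s" using r by (intro max) simp
      then show "\<bar>vieta \<alpha> ?j ?p ?j\<bar> \<le> \<bar>?p ?j\<bar>" by (intro le) (simp only: h_def nxt)
      show "C < abs_sum_real ?p" using n by (simp add: h_def)
    qed simp
    then have "act \<alpha> (take r w) x = act \<alpha> (take s w) x" using prev by simp
    then show False using minimal_word_points_distinct[OF w, of r s] r by simp
  qed
  then show ?thesis using max[OF t] unfolding h_def by linarith
qed

definition scaled :: "nat \<Rightarrow> (idx \<Rightarrow> int) \<Rightarrow> idx \<Rightarrow> complex" where
  "scaled N X i = of_int (X i) / of_nat N"

lemma scaled_inj: "N > 0 \<Longrightarrow> scaled N X = scaled N Y \<Longrightarrow> X = Y"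
  by (auto simp: scaled_def fun_eq_iff)

lemma scaled_move:
  assumes N: "N > 0" and \<alpha>: "\<And>i. i \<in> J \<Longrightarrow> \<alpha> i = of_int (a i) / of_nat N"
  shows "scaled N (move N J a d X) = scaled N X \<or> (\<exists>i\<in>J. scaled N (move N J a d X) = vieta \<alpha> i (scaled N X))"
proof -
  have div: "complex_of_int (b div int N) = of_int b / of_nat N" if "int N dvd b" for b
    using that N by (auto elim!: dvdE)
  have sq: "x * y / (of_nat N * of_nat N) = (x / of_nat N) * (y / of_nat N)" for x y :: complex by simp
  consider "d = 0 \<and> I1 \<in> J \<and> int N dvd X I2 * X I3" | "d = 1 \<and> I2 \<in> J \<and> int N dvd X I3 * X I1"
    | "d = 2 \<and> I3 \<in> J \<and> int N dvd X I1 * X I2" | "move N J a d X = X"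
    unfolding move_def by argo
  then show ?thesis
  proof cases
    case 1
    then have "scaled N (move N J a d X) = vieta \<alpha> I1 (scaled N X)"
      by (auto simp: fun_eq_iff scaled_def vieta_def move_def \<alpha> div diff_divide_distrib)
    then show ?thesis using 1 by blast
  next
    case 2
    then have "scaled N (move N J a d X) = vieta \<alpha> I2 (scaled N X)"
      by (auto simp: fun_eq_iff scaled_def vieta_def move_def \<alpha> div diff_divide_distrib)
    then show ?thesis using 2 by blast
  next
    case 3
    then have "scaled N (move N J a d X) = vieta \<alpha> I3 (scaled N X)"
      by (auto simp: fun_eq_iff scaled_def vieta_def move_def \<alpha> div diff_divide_distrib)
    then show ?thesis using 3 by blast
  qed simp
qed

lemma conn_imp_linked:
  assumes N: "N > 0" and \<alpha>: "\<And>i. i \<in> J \<Longrightarrow> \<alpha> i = of_int (a i) / of_nat N" and "conn N J a C X Y"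
  shows "linked \<alpha> J (scaled N X) (scaled N Y)"
proof -
  have L: "linked \<alpha> J (scaled N X) (scaled N (run N J a d X n))" for d n
  proof (induction n)
    case 0
    then show ?case unfolding linked_def run_def by (intro exI[of _ "[]"]) simp
  next
    case (Suc n)
    let ?Z = "run N J a d X n"
    have "scaled N (move N J a (d n) ?Z) = scaled N ?Z \<or>
        (\<exists>i\<in>J. scaled N (move N J a (d n) ?Z) = vieta \<alpha> i (scaled N ?Z))"
      by (rule scaled_move[OF N \<alpha>])
    then have "linked \<alpha> J (scaled N ?Z) (scaled N (move N J a (d n) ?Z))"
    proof (elim disjE bexE)
      assume "scaled N (move N J a (d n) ?Z) = scaled N ?Z"
      then show ?thesis unfolding linked_def by (intro exI[of _ "[]"]) simp
    next
      fix i assume "i \<in> J" "scaled N (move N J a (d n) ?Z) = vieta \<alpha> i (scaled N ?Z)"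
      then show ?thesis unfolding linked_def by (intro exI[of _ "[i]"]) simp
    qed
    with Suc show ?case unfolding run_def by (auto intro: linked_trans)
  qed
  obtain d where "run N J a d X ((2 * (abs_sum X + abs_sum Y + C) + 1) ^ 3) = Y"
    using assms(3) unfolding conn_def by blast
  then show ?thesis using L[of d "(2 * (abs_sum X + abs_sum Y + C) + 1) ^ 3"] by (simp only:)
qed

definition digit :: "idx \<Rightarrow> nat" where "digit i = (case i of I1 \<Rightarrow> 0 | I2 \<Rightarrow> 1 | I3 \<Rightarrow> 2)"

lemma move_digit:
  assumes N: "N > 0" and \<alpha>: "\<And>i. i \<in> J \<Longrightarrow> \<alpha> i = of_int (a i) / of_nat N"
    and i: "i \<in> J" and eq: "vieta \<alpha> i (scaled N X) = scaled N Y"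
  shows "move N J a (digit i) X = Y"
proof -
  have dvd: "int N dvd b \<and> a i - b div int N - X i = y"
    if "of_int (a i) / of_nat N - of_int b / (of_nat N * of_nat N) - of_int (X i) / of_nat N = (of_int y / of_nat N :: complex)" for b y
  proof -
    define n where "n = complex_of_nat N"
    have n: "n \<noteq> 0" using N by (simp add: n_def)
    have "of_int b / (n * n) = (of_int (a i) - of_int (X i) - of_int y) / n"
      using that by (simp add: n_def diff_divide_distrib add_divide_distrib algebra_simps)
    then have "of_int b = (of_nat N * of_int (a i - X i - y) :: complex)"
      using n by (simp add: field_simps flip: n_def)
    then have "of_int b = (of_int (int N * (a i - X i - y)) :: complex)" by simp
    then have "b = int N * (a i - X i - y)" by (simp only: of_int_eq_iff)
    then show ?thesis using N by simp
  qed
  have other: "X l = Y l" if "l \<noteq> i" for l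
    using fun_cong[OF eq, of l] that N by (simp add: scaled_def)
  show ?thesis
  proof (cases i)
    case I1
    then have "int N dvd X I2 * X I3 \<and> a I1 - X I2 * X I3 div int N - X I1 = Y I1"
      using dvd[of "X I2 * X I3" "Y I1"] fun_cong[OF eq, of I1] \<alpha>[OF i] by (simp add: vieta_def scaled_def)
    then show ?thesis using other i I1 by (auto simp: move_def digit_def fun_eq_iff)
  next
    case I2
    then have "int N dvd X I3 * X I1 \<and> a I2 - X I3 * X I1 div int N - X I2 = Y I2"
      using dvd[of "X I3 * X I1" "Y I2"] fun_cong[OF eq, of I2] \<alpha>[OF i] by (simp add: vieta_def scaled_def)
    then show ?thesis using other i I2 by (auto simp: move_def digit_def fun_eq_iff)
  next
    case I3
    then have "int N dvd X I1 * X I2 \<and> a I3 - X I1 * X I2 div int N - X I3 = Y I3"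
      using dvd[of "X I1 * X I2" "Y I3"] fun_cong[OF eq, of I3] \<alpha>[OF i] by (simp add: vieta_def scaled_def)
    then show ?thesis using other i I3 by (auto simp: move_def digit_def fun_eq_iff)
  qed
qed

lemma card_box:
  fixes H :: nat
  shows "finite {Z :: idx \<Rightarrow> int. \<forall>i. \<bar>Z i\<bar> \<le> int H}" (is "finite ?A")
    and "card {Z :: idx \<Rightarrow> int. \<forall>i. \<bar>Z i\<bar> \<le> int H} \<le> (2 * H + 1) ^ 3"
proof -
  let ?f = "\<lambda>Z :: idx \<Rightarrow> int. (Z I1, Z I2, Z I3)"
  let ?I = "{- int H..int H}"
  have inj: "inj_on ?f ?A" by (rule inj_onI, rule ext, rename_tac i, case_tac i) auto
  have sub: "?f ` ?A \<subseteq> ?I \<times> ?I \<times> ?I" by (auto simp: abs_le_iff) (metis minus_le_iff)+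
  show "finite ?A" using finite_imageD[OF finite_subset[OF sub] inj] by simp
  have "card ?A \<le> card (?I \<times> ?I \<times> ?I)" by (rule card_inj_on_le[OF inj sub]) simp
  also have "\<dots> = (2 * H + 1) ^ 3"
    by (simp add: card_cartesian_product power3_eq_cube nat_add_distrib nat_mult_distrib mult.assoc)
  finally show "card ?A \<le> (2 * H + 1) ^ 3" .
qed

text \<open>The points of a minimal path are distinct. If they lie in a box, then their number is at
most that of the lattice points in the box.\<close>

lemma conn_of_short_path:
  assumes N: "N > 0" and \<alpha>: "\<And>i. i \<in> J \<Longrightarrow> \<alpha> i = of_int (a i) / of_nat N"
    and w: "minimal_word \<alpha> J (scaled N X) w" "act \<alpha> w (scaled N X) = scaled N Y"
    and Z: "\<And>t. t \<le> length w \<Longrightarrow> act \<alpha> (take t w) (scaled N X) = scaled N (Z t)"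
      "\<And>t. t \<le> length w \<Longrightarrow> abs_sum (Z t) \<le> abs_sum X + abs_sum Y + C"
  shows "conn N J a C X Y"
proof -
  define H where "H = abs_sum X + abs_sum Y + C"
  let ?A = "{Z :: idx \<Rightarrow> int. \<forall>i. \<bar>Z i\<bar> \<le> int H}"
  have "inj_on Z {..length w}"
  proof (rule linorder_inj_onI')
    fix s t assume "s \<in> {..length w}" "t \<in> {..length w}" "s < t"
    then show "Z s \<noteq> Z t" using minimal_word_points_distinct[OF w(1), of s t] Z(1) by auto
  qed
  moreover have "Z ` {..length w} \<subseteq> ?A"
  proof -
    have "\<bar>Z t i\<bar> \<le> int H" if "t \<le> length w" for t i
    proof -
      have "\<bar>Z t i\<bar> \<le> int (abs_sum (Z t))" by (cases i) (simp_all add: abs_sum_def)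
      also have "\<dots> \<le> int H" using Z(2)[OF that] unfolding H_def by (simp only: of_nat_le_iff)
      finally show ?thesis .
    qed
    then show ?thesis by auto
  qed
  ultimately have "card {..length w} \<le> card ?A" by (rule card_inj_on_le) (rule card_box)
  then have len: "length w \<le> (2 * H + 1) ^ 3" using card_box(2)[of H] by simp
  define d where "d n = (if n < length w then digit (w ! n) else 3)" for n
  have d4: "d n < 4" for n by (auto simp: d_def digit_def split: idx.split)
  have "run N J a d X n = Z (min n (length w))" for n
  proof (induction n)
    case 0
    have "Z 0 = X" using Z(1)[of 0] scaled_inj[OF N] by simp
    then show ?case by (simp add: run_def)
  next
    case (Suc n)
    show ?case
    proof (cases "n < length w")
      case True
      then have "vieta \<alpha> (w ! n) (scaled N (Z n)) = scaled N (Z (Suc n))"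
        using Z(1)[of n] Z(1)[of "Suc n"] act_take_Suc[OF True, of \<alpha> "scaled N X"] by simp
      moreover have "w ! n \<in> J" using True w(1) unfolding minimal_word_def by auto
      ultimately have "move N J a (d n) (Z n) = Z (Suc n)"
        using move_digit[OF N \<alpha>] True by (simp add: d_def)
      then show ?thesis using Suc True by (simp add: run_def)
    next
      case False
      then have "move N J a (d n) V = V" for V by (simp add: d_def move_def)
      then show ?thesis using Suc False by (simp add: run_def)
    qed
  qed
  then have "run N J a d X ((2 * H + 1) ^ 3) = Z (length w)" using len by (simp add: min_absorb2)
  also have "\<dots> = Y" using Z(1)[of "length w"] w(2) scaled_inj[OF N] by simp
  finally show ?thesis using d4 unfolding conn_def H_def by blast
qed

text \<open>The words involve only the coefficients in \<open>J\<close>. The numbers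
\<open>\<gamma>\<close> are their real values, and with these the paths can be studied in real
space, where the result on local maxima applies.\<close>

lemma lattice_connectivity:
  fixes \<gamma> :: "idx \<Rightarrow> real"
  assumes N: "N > 0" and \<alpha>: "\<And>i. i \<in> J \<Longrightarrow> \<alpha> i = of_int (a i) / of_nat N"
    and \<gamma>: "\<And>i. i \<in> J \<Longrightarrow> \<alpha> i = of_real (\<gamma> i)"
  obtains C where "\<And>X Y w. cubic \<gamma> (\<lambda>i. of_int (X i) / of_nat N) = \<beta> \<Longrightarrow>
    minimal_word \<alpha> J (scaled N X) w \<Longrightarrow> act \<alpha> w (scaled N X) = scaled N Y \<Longrightarrow>
    (\<And>t. \<exists>Z. act \<alpha> (take t w) (scaled N X) = scaled N Z) \<Longrightarrow> conn N J a C X Y"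
proof -
  obtain C where C: "\<And>p i j. i \<noteq> j \<Longrightarrow> (\<And>l. real N * p l \<in> \<int>) \<Longrightarrow> cubic \<gamma> p = \<beta> \<Longrightarrow>
    \<bar>vieta \<gamma> i p i\<bar> \<le> \<bar>p i\<bar> \<Longrightarrow> \<bar>vieta \<gamma> j p j\<bar> \<le> \<bar>p j\<bar> \<Longrightarrow> C < abs_sum_real p \<Longrightarrow> vieta \<gamma> i p = p"
    using lattice_local_max_uniform[OF N] by metis
  show thesis
  proof (rule that[of "nat \<lceil>real N * C\<rceil>"])
    fix X Y w
    assume surf: "cubic \<gamma> (\<lambda>i. of_int (X i) / of_nat N) = \<beta>"
      and w: "minimal_word \<alpha> J (scaled N X) w" "act \<alpha> w (scaled N X) = scaled N Y"
      and ex: "\<And>t. \<exists>Z. act \<alpha> (take t w) (scaled N X) = scaled N Z"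
    from ex obtain Z where Z: "\<And>t. act \<alpha> (take t w) (scaled N X) = scaled N (Z t)" by metis
    define re where "re V i = real_of_int (V i) / of_nat N" for V and i :: idx
    have re: "scaled N V = (\<lambda>i. of_real (re V i))" for V by (auto simp: scaled_def re_def)
    have hom: "act \<alpha> v (scaled N X) = (\<lambda>i. of_real (act \<gamma> v (re X) i))" if "set v \<subseteq> J" for v
      unfolding re using that \<gamma> by (intro act_hom) auto
    have wJ: "set w \<subseteq> J" using w(1) by (simp add: minimal_word_def)
    have take: "act \<gamma> (take t w) (re X) = re (Z t)" for t
    proof -
      have "set (take t w) \<subseteq> J" using wJ set_take_subset by fast
      from hom[OF this] Z[of t] show ?thesis unfolding re by (auto simp: fun_eq_iff)
    qed
    have min: "minimal_word \<gamma> J (re X) w"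
      unfolding minimal_word_def
    proof (intro conjI allI impI wJ)
      fix v assume "set v \<subseteq> J" "act \<gamma> v (re X) = act \<gamma> w (re X)"
      then have "act \<alpha> v (scaled N X) = act \<alpha> w (scaled N X)" using hom wJ by simp
      then show "length w \<le> length v" using w(1) \<open>set v \<subseteq> J\<close> by (simp add: minimal_word_def)
    qed
    have sum: "real N * abs_sum_real (re V) = real (abs_sum V)" for V
      using N by (simp add: abs_sum_real_def abs_sum_def re_def distrib_left)
    have surf': "cubic \<gamma> (re X) = \<beta>" using surf by (simp add: re_def[abs_def])
    have Zw: "Z (length w) = Y" using Z[of "length w"] w(2) scaled_inj[OF N] by simp
    have "abs_sum (Z t) \<le> abs_sum X + abs_sum Y + nat \<lceil>real N * C\<rceil>" if t: "t \<le> length w" for t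
    proof -
      have "real N * act \<gamma> (take t w) (re X) l \<in> \<int>" for t l
        unfolding take using N by (simp add: re_def)
      from minimal_word_heights[where N = N and C = C, OF C min this t] surf'
      have "abs_sum_real (re (Z t)) \<le> max C (max (abs_sum_real (re X)) (abs_sum_real (re Y)))"
        using take[of "length w"] Zw by (simp add: take)
      then have "real N * abs_sum_real (re (Z t)) \<le> real N * max C (max (abs_sum_real (re X)) (abs_sum_real (re Y)))"
        by (intro mult_left_mono) auto
      also have "\<dots> = max (real N * C) (max (real (abs_sum X)) (real (abs_sum Y)))"
        using N by (simp add: max_mult_distrib_left sum)
      finally have "real (abs_sum (Z t)) \<le> max (real N * C) (max (real (abs_sum X)) (real (abs_sum Y)))"
        by (simp add: sum)
      then show ?thesis by linarith
    qed
    then show "conn N J a (nat \<lceil>real N * C\<rceil>) X Y"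
      using conn_of_short_path[OF N \<alpha> w, where Z = Z] Z by blast
  qed
qed

section \<open>Rational coefficients\<close>

definition emb :: "(idx \<Rightarrow> int) \<Rightarrow> idx \<Rightarrow> complex" where "emb x i = of_int (x i)"

text \<open>The form of the decision procedure. The table \<open>T\<close> contains pairs of
equivalent lattice points at which a path may pass from the lattice to other points and back.\<close>

definition orbits_by_lattice_paths :: "(idx \<Rightarrow> complex) \<Rightarrow> complex \<Rightarrow> bool" where
  "orbits_by_lattice_paths \<alpha> \<beta> \<longleftrightarrow> (\<exists>N J a C T. finite T \<and>
     (\<forall>x y. cubic \<alpha> (emb x) = \<beta> \<longrightarrow> cubic \<alpha> (emb y) = \<beta> \<longrightarrow>
       (linked \<alpha> UNIV (emb x) (emb y) \<longleftrightarrow>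
         conn N J a C (\<lambda>i. int N * x i) (\<lambda>i. int N * y i) \<or>
         (\<exists>(g, h)\<in>T. conn N J a C (\<lambda>i. int N * x i) g \<and> conn N J a C (\<lambda>i. int N * y i) h))))"

lemma scaled_mult: "N > 0 \<Longrightarrow> scaled N (\<lambda>i. int N * x i) = emb x"
  by (auto simp: scaled_def emb_def fun_eq_iff)

text \<open>Only completeness has to be shown, because lattice walks consist of steps of the action.\<close>

lemma orbits_by_lattice_pathsI:
  assumes N: "N > 0" and \<alpha>: "\<And>i. i \<in> J \<Longrightarrow> \<alpha> i = of_int (a i) / of_nat N"
    and T: "finite T" "\<And>g h. (g, h) \<in> T \<Longrightarrow> linked \<alpha> UNIV (scaled N g) (scaled N h)"
    and complete: "\<And>x y. cubic \<alpha> (emb x) = \<beta> \<Longrightarrow> cubic \<alpha> (emb y) = \<beta> \<Longrightarrow> linked \<alpha> UNIV (emb x) (emb y) \<Longrightarrow>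
         conn N J a C (\<lambda>i. int N * x i) (\<lambda>i. int N * y i) \<or>
         (\<exists>(g, h)\<in>T. conn N J a C (\<lambda>i. int N * x i) g \<and> conn N J a C (\<lambda>i. int N * y i) h)"
  shows "orbits_by_lattice_paths \<alpha> \<beta>"
proof -
  have lin: "linked \<alpha> UNIV (emb x) (scaled N g)" if "conn N J a C (\<lambda>i. int N * x i) g" for x g
    using linked_mono[OF conn_imp_linked[OF N \<alpha> that]] by (simp add: scaled_mult[OF N])
  have "linked \<alpha> UNIV (emb x) (emb y)" if "conn N J a C (\<lambda>i. int N * x i) (\<lambda>i. int N * y i)" for x y
    using lin[OF that] by (simp add: scaled_mult[OF N])
  moreover have "linked \<alpha> UNIV (emb x) (emb y)" if "(g, h) \<in> T"
    "conn N J a C (\<lambda>i. int N * x i) g" "conn N J a C (\<lambda>i. int N * y i) h" for x y g h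
    using linked_trans[OF linked_trans[OF lin[OF that(2)] T(2)[OF that(1)]] linked_sym[OF lin[OF that(3)]]] .
  ultimately have "linked \<alpha> UNIV (emb x) (emb y) \<longleftrightarrow>
         conn N J a C (\<lambda>i. int N * x i) (\<lambda>i. int N * y i) \<or>
         (\<exists>(g, h)\<in>T. conn N J a C (\<lambda>i. int N * x i) g \<and> conn N J a C (\<lambda>i. int N * y i) h)"
    if "cubic \<alpha> (emb x) = \<beta>" "cubic \<alpha> (emb y) = \<beta>" for x y
    using complete[OF that] by (safe; blast)
  then show ?thesis
    unfolding orbits_by_lattice_paths_def using T(1) by (intro exI conjI allI impI)
qed

lemma cubic_of_real: "cubic (\<lambda>i. of_real (\<gamma> i)) (\<lambda>i. of_real (p i)) = complex_of_real (cubic \<gamma> p)"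
  by (simp add: cubic_def)

lemma common_denominator:
  fixes S :: "complex set"
  assumes "finite S" "S \<subseteq> \<rat>"
  shows "\<exists>N>0. \<forall>z\<in>S. of_nat N * z \<in> \<int>"
  using assms
proof (induction S rule: finite_induct)
  case empty
  show ?case by (intro exI[of _ 1]) simp
next
  case (insert z S)
  then obtain N where N: "N > 0" "\<forall>z\<in>S. of_nat N * z \<in> \<int>" by auto
  have "z \<in> \<rat>" using insert.prems by simp
  then obtain a b where ab: "b > 0" "z = of_int a / of_int b" by (elim Rats_cases') auto
  define m where "m = nat b"
  have m: "m > 0" "of_nat m * z = of_int a" using ab by (simp_all add: m_def)
  have "of_nat (N * m) * y \<in> \<int>" if "y \<in> insert z S" for y
  proof (cases "y = z")
    case True
    then have "of_nat m * y = of_int a" using m(2) by simp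
    then have "of_nat (N * m) * y = of_nat N * of_int a" by (simp only: of_nat_mult mult.assoc)
    moreover have "of_nat N * of_int a \<in> (\<int> :: complex set)" by simp
    ultimately show ?thesis by (simp only:)
  next
    case False
    then have "of_nat N * y \<in> \<int>" using N(2) that by simp
    then have "of_nat m * (of_nat N * y) \<in> \<int>" by simp
    then show ?thesis by (simp add: mult_ac)
  qed
  then show ?case using N(1) m(1) by (intro exI[of _ "N * m"]) simp
qed

lemma act_induct:
  assumes "P x" "\<And>i y. i \<in> set w \<Longrightarrow> P y \<Longrightarrow> P (vieta \<alpha> i y)" shows "P (act \<alpha> w x)"
  using assms by (induction w arbitrary: x) auto

lemma act_rational:
  assumes "\<And>l. x l \<in> \<rat>" "\<And>l. \<alpha> l \<in> \<rat>" shows "act \<alpha> w x l \<in> (\<rat> :: complex set)"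
proof -
  have "\<forall>l. act \<alpha> w x l \<in> \<rat>"
  proof (rule act_induct[where P = "\<lambda>x. \<forall>l. x l \<in> \<rat>"])
    show "\<forall>l. vieta \<alpha> i y l \<in> \<rat>" if "\<forall>l. y l \<in> \<rat>" for i and y :: "idx \<Rightarrow> complex"
      using that assms(2) by (auto simp: vieta_def split: idx.split)
  qed (use assms in auto)
  then show ?thesis by blast
qed

text \<open>The lattice is given by a common denominator \<open>N\<close> of the coefficients. Paths
between integer points stay in it because they are bounded by \<open>1/N\<close> at every
valuation ring, and a rational number that lies in all valuation rings is an integer.\<close>

lemma rational_orbits:
  assumes \<alpha>: "\<And>i. \<alpha> i \<in> \<rat>"
  shows "orbits_by_lattice_paths \<alpha> \<beta>"
proof (cases "\<exists>x. cubic \<alpha> (emb x) = \<beta>")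
  case False
  then show ?thesis unfolding orbits_by_lattice_paths_def by blast
next
  case True
  have embQ: "emb x l \<in> \<rat>" for x l by (simp add: emb_def)
  from True have \<beta>: "\<beta> \<in> \<rat>" using embQ \<alpha> by (auto simp: cubic_def)
  have "finite (insert \<beta> (\<alpha> ` {I1, I2, I3}))" "insert \<beta> (\<alpha> ` {I1, I2, I3}) \<subseteq> \<rat>" using \<alpha> \<beta> by auto
  from common_denominator[OF this] obtain N where N: "N > 0"
    and N1: "of_nat N * \<beta> \<in> \<int>" and N2: "\<And>i. of_nat N * \<alpha> i \<in> \<int>"
    by (metis (full_types) idx.exhaust image_insert insertCI)
  obtain b where "of_nat N * \<beta> = of_int b" using N1 by (elim Ints_cases)
  then have b: "\<beta> = of_int b / of_nat N" using N by (simp add: field_simps)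
  have "\<forall>i. \<exists>n. of_nat N * \<alpha> i = of_int n" using N2 by (metis Ints_cases)
  then obtain a where a': "\<And>i. of_nat N * \<alpha> i = of_int (a i)" by metis
  then have a: "\<alpha> i = of_int (a i) / of_nat N" for i using N a'[of i] by (simp add: field_simps)
  define \<gamma> where "\<gamma> i = real_of_int (a i) / of_nat N" for i
  have \<gamma>: "\<alpha> i = of_real (\<gamma> i)" for i by (simp add: a \<gamma>_def)
  obtain C where C: "\<And>X Y w. cubic \<gamma> (\<lambda>i. of_int (X i) / of_nat N) = real_of_int b / real N \<Longrightarrow>
    minimal_word \<alpha> UNIV (scaled N X) w \<Longrightarrow> act \<alpha> w (scaled N X) = scaled N Y \<Longrightarrow>
    (\<And>t. \<exists>Z. act \<alpha> (take t w) (scaled N X) = scaled N Z) \<Longrightarrow> conn N UNIV a C X Y"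
    using lattice_connectivity[OF N, where \<alpha> = \<alpha> and J = UNIV and a = a and \<gamma> = \<gamma> and \<beta> = "real_of_int b / real N"] a \<gamma>
    by metis
  show ?thesis
  proof (rule orbits_by_lattice_pathsI[where J = UNIV and T = "{}" and C = C, OF N a])
    fix x y assume x: "cubic \<alpha> (emb x) = \<beta>" and y: "cubic \<alpha> (emb y) = \<beta>"
      and link: "linked \<alpha> UNIV (emb x) (emb y)"
    obtain w where w: "minimal_word \<alpha> UNIV (emb x) w" "act \<alpha> w (emb x) = emb y"
      using linked_minimal_word[OF link] .
    have "conn N UNIV a C (\<lambda>i. int N * x i) (\<lambda>i. int N * y i)"
    proof (rule C)
      have "complex_of_real (cubic \<gamma> (\<lambda>i. of_int (int N * x i) / of_nat N)) = cubic \<alpha> (emb x)"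
        unfolding cubic_of_real[symmetric] \<gamma>[symmetric] using N
        by (intro arg_cong2[of _ _ _ _ cubic]) (auto simp: fun_eq_iff \<gamma> emb_def)
      also have "\<dots> = complex_of_real (of_int b / of_nat N)" using x b by simp
      finally show "cubic \<gamma> (\<lambda>i. of_int (int N * x i) / of_nat N) = real_of_int b / real N"
        by (simp only: of_real_eq_iff)
      show "minimal_word \<alpha> UNIV (scaled N (\<lambda>i. int N * x i)) w"
        "act \<alpha> w (scaled N (\<lambda>i. int N * x i)) = scaled N (\<lambda>i. int N * y i)"
        using w by (simp_all add: scaled_mult[OF N])
      fix t
      have "of_nat N * act \<alpha> (take t w) (emb x) l \<in> \<int>" for l
      proof (rule rational_in_all_valuation_rings)
        show "of_nat N * act \<alpha> (take t w) (emb x) l \<in> \<rat>"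
          using act_rational[OF embQ \<alpha>] by simp
        fix B assume "valuation_ring B"
        then interpret valuation_ring B .
        define M :: complex where "M = 1 / of_nat N"
        have int: "vle (of_int n / of_nat N) M" for n
          unfolding M_def vle_def by (rule bexI[of _ "of_int n"]) (auto simp: subring_of_int[OF subring])
        have one: "vle 1 M" using int[of "int N"] N by simp
        have emb: "vle (emb z l) M" for z l
          using vle_trans[OF vle_of_int one] by (simp add: emb_def)
        have "vle (act \<alpha> (take t w) (emb x) l) M"
        proof (rule bounded_between_bounded_points[OF one])
          show "vle (\<alpha> i) M" for i using int a by simp
          show "vle (cubic \<alpha> (emb x)) M" using int x b by simp
          show "distinct_adj (take t w @ drop t w)" using minimal_word_distinct_adj[OF w(1)] by simp
          show "vle (act \<alpha> (take t w @ drop t w) (emb x) j) M" for j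
            using emb w(2) by (simp only: append_take_drop_id)
        qed (rule emb)
        then show "of_nat N * act \<alpha> (take t w) (emb x) l \<in> B"
          using N unfolding vle_def M_def by auto
      qed
      then have "\<forall>l. \<exists>n. of_nat N * act \<alpha> (take t w) (emb x) l = of_int n" by (metis Ints_cases)
      then obtain Z where "\<And>l. of_nat N * act \<alpha> (take t w) (emb x) l = of_int (Z l)" by metis
      then have "act \<alpha> (take t w) (emb x) = scaled N Z"
        using N by (auto simp: scaled_def fun_eq_iff field_simps)
      then show "\<exists>Z. act \<alpha> (take t w) (scaled N (\<lambda>i. int N * x i)) = scaled N Z"
        using scaled_mult[OF N] by auto
    qed
    then show "conn N UNIV a C (\<lambda>i. int N * x i) (\<lambda>i. int N * y i) \<or>
         (\<exists>(g, h)\<in>{}. conn N UNIV a C (\<lambda>i. int N * x i) g \<and> conn N UNIV a C (\<lambda>i. int N * y i) h)" ..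
  qed auto
qed

section \<open>One irrational coefficient\<close>

lemma quadratic_root_bound:
  fixes z b c :: complex
  assumes "z\<^sup>2 + b * z + c = 0" shows "cmod z \<le> 1 + cmod b + cmod c"
proof (rule ccontr)
  assume n: "\<not> ?thesis"
  then have 1: "1 \<le> cmod z" using norm_ge_zero[of b] norm_ge_zero[of c] by linarith
  have "z\<^sup>2 = - (b * z + c)" using assms by (metis add.assoc eq_neg_iff_add_eq_0)
  then have "cmod (z\<^sup>2) = cmod (b * z + c)" by (simp only: norm_minus_cancel)
  then have "cmod z * cmod z = cmod (b * z + c)" by (simp only: norm_mult power2_eq_square)
  also have "\<dots> \<le> cmod b * cmod z + cmod c" using norm_triangle_ineq[of "b * z" c] by (simp add: norm_mult)
  also have "\<dots> \<le> cmod b * cmod z + cmod c * cmod z" using mult_left_mono[OF 1, of "cmod c"] by simp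
  finally have "cmod z * cmod z \<le> (cmod b + cmod c) * cmod z" by (simp add: algebra_simps)
  then have "cmod z \<le> cmod b + cmod c" using 1 by (cases "z = 0") (simp_all add: mult_le_cancel_right)
  with n show False by linarith
qed

text \<open>The third coordinate is a root of a monic quadratic equation over the other two.\<close>

lemma third_coordinate_bounded:
  assumes d: "distinct3 i j k"
  obtains R' where "\<And>p. cubic \<alpha> p = \<beta> \<Longrightarrow> cmod (p i) \<le> R \<Longrightarrow> cmod (p j) \<le> R \<Longrightarrow> cmod (p k) \<le> R'"
proof
  fix p assume p: "cubic \<alpha> p = \<beta>" and R: "cmod (p i) \<le> R" "cmod (p j) \<le> R"
  have R0: "0 \<le> R" using R(1) norm_ge_zero order_trans by blast
  have "(p k)\<^sup>2 + (p i * p j - \<alpha> k) * p k + ((p i)\<^sup>2 + (p j)\<^sup>2 - \<alpha> i * p i - \<alpha> j * p j - \<beta>) = 0"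
    using p by (simp add: cubic_distinct3[OF d] algebra_simps)
  from quadratic_root_bound[OF this]
  have "cmod (p k) \<le> 1 + cmod (p i * p j - \<alpha> k) + cmod ((p i)\<^sup>2 + (p j)\<^sup>2 - \<alpha> i * p i - \<alpha> j * p j - \<beta>)" .
  also have "\<dots> \<le> 1 + (cmod (p i * p j) + cmod (\<alpha> k)) + (cmod ((p i)\<^sup>2) + cmod ((p j)\<^sup>2) + cmod (\<alpha> i * p i) + cmod (\<alpha> j * p j) + cmod \<beta>)"
    using norm_triangle_ineq4[of "p i * p j" "\<alpha> k"] norm_triangle_ineq[of "(p i)\<^sup>2" "(p j)\<^sup>2"]
      norm_triangle_ineq4[of "(p i)\<^sup>2 + (p j)\<^sup>2" "\<alpha> i * p i"]
      norm_triangle_ineq4[of "(p i)\<^sup>2 + (p j)\<^sup>2 - \<alpha> i * p i" "\<alpha> j * p j"]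
      norm_triangle_ineq4[of "(p i)\<^sup>2 + (p j)\<^sup>2 - \<alpha> i * p i - \<alpha> j * p j" \<beta>] by linarith
  also have "\<dots> \<le> 1 + (R * R + cmod (\<alpha> k)) + (R * R + R * R + cmod (\<alpha> i) * R + cmod (\<alpha> j) * R + cmod \<beta>)"
    unfolding norm_mult power2_eq_square using R R0 by (intro add_mono mult_mono order_refl) auto
  finally show "cmod (p k) \<le> 1 + (R * R + cmod (\<alpha> k)) + (R * R + R * R + cmod (\<alpha> i) * R + cmod (\<alpha> j) * R + cmod \<beta>)" .
qed

lemma finite_scaled_bounded:
  assumes N: "N > 0"
  shows "finite {X. \<forall>i. cmod (scaled N X i) \<le> R}"
proof (rule finite_subset[OF _ card_box(1)])
  show "{X. \<forall>i. cmod (scaled N X i) \<le> R} \<subseteq> {Z. \<forall>i. \<bar>Z i\<bar> \<le> int (nat \<lceil>real N * R\<rceil>)}"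
  proof (safe)
    fix X i assume "\<forall>i. cmod (scaled N X i) \<le> R"
    then have "\<bar>real_of_int (X i)\<bar> / real N \<le> R" by (simp add: scaled_def norm_divide)
    then have "\<bar>real_of_int (X i)\<bar> \<le> real N * R" using N by (simp add: field_simps)
    then show "\<bar>X i\<bar> \<le> int (nat \<lceil>real N * R\<rceil>)" by linarith
  qed
qed

text \<open>All integer points have the same coordinate \<open>\<tau>\<close> at \<open>k\<close>, for
otherwise the difference of their equations would express \<open>\<alpha> k\<close> rationally.
A reduced word between integer points that contains \<open>k\<close> first runs through the
lattice points of the fibre. When it leaves the fibre for the first time, one of the other two
coordinates is small, for otherwise it could not return. Then the equation bounds the third one
as well, and the point belongs to the finite set \<open>G\<close>. The same holds for the
reversed word.\<close>

lemma one_irrational_orbits: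
  assumes d: "distinct3 i j k" and \<alpha>: "\<alpha> i \<in> \<rat>" "\<alpha> j \<in> \<rat>" "\<alpha> k \<notin> \<rat>"
  shows "orbits_by_lattice_paths \<alpha> \<beta>"
proof (cases "\<exists>x. cubic \<alpha> (emb x) = \<beta>")
  case False
  then show ?thesis unfolding orbits_by_lattice_paths_def by blast
next
  case True
  then obtain o' where o': "cubic \<alpha> (emb o') = \<beta>" by blast
  define \<tau> where "\<tau> = o' k"
  have fibre: "x k = \<tau>" if "cubic \<alpha> (emb x) = \<beta>" for x
  proof (rule ccontr)
    assume ne: "x k \<noteq> \<tau>"
    define r where "r x = (emb x i)\<^sup>2 + (emb x j)\<^sup>2 + (emb x k)\<^sup>2 + emb x i * emb x j * emb x k
      - \<alpha> i * emb x i - \<alpha> j * emb x j" for x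
    have rQ: "r x \<in> \<rat>" for x using \<alpha>(1,2) by (simp add: r_def emb_def)
    have "r x - \<alpha> k * emb x k = r o' - \<alpha> k * emb o' k"
      using that o' by (simp add: r_def cubic_distinct3[OF d])
    then have "\<alpha> k * of_int (x k - \<tau>) = r x - r o'" by (simp add: emb_def \<tau>_def algebra_simps)
    then have "\<alpha> k = (r x - r o') / of_int (x k - \<tau>)" using ne by (simp add: nonzero_eq_divide_eq)
    then show False using \<alpha>(3) rQ by simp
  qed
  have "finite {\<alpha> i, \<alpha> j}" "{\<alpha> i, \<alpha> j} \<subseteq> \<rat>" using \<alpha> by auto
  from common_denominator[OF this] obtain N where N: "N > 0"
    and "of_nat N * \<alpha> i \<in> \<int>" "of_nat N * \<alpha> j \<in> \<int>" by blast
  then obtain ai aj where aij: "of_nat N * \<alpha> i = of_int ai" "of_nat N * \<alpha> j = of_int aj"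
    by (elim Ints_cases) auto
  define a where "a = (\<lambda>l. if l = i then ai else if l = j then aj else 0)"
  define J where "J = {i, j}"
  have ij: "i \<noteq> j" "k \<noteq> i" "k \<noteq> j" using d by (auto simp: distinct3_def)
  have a: "\<alpha> l = of_int (a l) / of_nat N" if "l \<in> J" for l
    using that aij ij N by (auto simp: J_def a_def nonzero_eq_divide_eq mult.commute)
  define \<gamma> where "\<gamma> l = real_of_int (a l) / of_nat N" for l
  have \<gamma>: "\<alpha> l = of_real (\<gamma> l)" if "l \<in> J" for l using a[OF that] by (simp add: \<gamma>_def)
  (* In the fibre the term of the irrational coefficient is a constant, and moving it to the
     right hand side leaves an equation with rational left hand side. *)
  define \<beta>' where "\<beta>' = Re (\<beta> + \<alpha> k * of_int \<tau>)"
  obtain C where C: "\<And>X Y w. cubic \<gamma> (\<lambda>i. of_int (X i) / of_nat N) = \<beta>' \<Longrightarrow>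
    minimal_word \<alpha> J (scaled N X) w \<Longrightarrow> act \<alpha> w (scaled N X) = scaled N Y \<Longrightarrow>
    (\<And>t. \<exists>Z. act \<alpha> (take t w) (scaled N X) = scaled N Z) \<Longrightarrow> conn N J a C X Y"
    using lattice_connectivity[OF N, where \<alpha> = \<alpha> and J = J and a = a and \<gamma> = \<gamma> and \<beta> = \<beta>'] a \<gamma>
    by metis
  define latt where "latt p \<longleftrightarrow> (\<exists>Z. p = scaled N Z) \<and> p k = of_int \<tau>" for p
  have latt_act: "latt (act \<alpha> w p)" if w: "set w \<subseteq> J" and p: "latt p" for w p
  proof (rule act_induct[where P = latt, OF p])
    fix l q assume l: "l \<in> set w" and q: "latt q"
    then obtain Z where Z: "q = scaled N Z" "q k = of_int \<tau>" by (auto simp: latt_def)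
    have lJ: "l \<in> J" using l w by blast
    have "distinct3 l i k \<or> distinct3 l j k" using lJ d by (auto simp: J_def distinct3_def)
    then obtain m where m: "distinct3 l m k" by blast
    have "vieta \<alpha> l q l = \<alpha> l - q m * q k - q l" by (simp add: vieta_distinct3[OF m])
    also have "\<dots> = of_int (a l - Z m * \<tau> - Z l) / of_nat N"
      using a[OF lJ] Z by (simp add: scaled_def diff_divide_distrib)
    finally have "vieta \<alpha> l q n = scaled N (Z(l := a l - Z m * \<tau> - Z l)) n" for n
      by (cases "n = l") (simp_all add: Z(1) scaled_def)
    moreover have "vieta \<alpha> l q k = of_int \<tau>" using m Z(2) by (simp add: distinct3_def)
    ultimately show "latt (vieta \<alpha> l q)" unfolding latt_def by blast
  qed
  have latt_emb: "latt (emb x)" if "cubic \<alpha> (emb x) = \<beta>" for x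
    unfolding latt_def using fibre[OF that] by (metis emb_def scaled_mult[OF N])
  have connJ: "conn N J a C (\<lambda>i. int N * x i) Y" if x: "cubic \<alpha> (emb x) = \<beta>"
    and link: "linked \<alpha> J (emb x) (scaled N Y)" for x Y
  proof -
    obtain w where w: "minimal_word \<alpha> J (emb x) w" "act \<alpha> w (emb x) = scaled N Y"
      using linked_minimal_word[OF link] .
    show ?thesis
    proof (rule C)
      have "complex_of_real (cubic \<gamma> (\<lambda>l. of_int (int N * x l) / of_nat N)) = cubic \<alpha> (emb x) + \<alpha> k * of_int \<tau>"
        using N fibre[OF x] \<gamma>[of i] \<gamma>[of j] ij
        by (simp add: cubic_distinct3[OF d] J_def emb_def) (simp add: \<gamma>_def a_def ij)
      also have "\<dots> = \<beta> + \<alpha> k * of_int \<tau>" using x by simp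
      finally show "cubic \<gamma> (\<lambda>l. of_int (int N * x l) / of_nat N) = \<beta>'"
        unfolding \<beta>'_def by (metis Re_complex_of_real)
      show "minimal_word \<alpha> J (scaled N (\<lambda>i. int N * x i)) w"
        "act \<alpha> w (scaled N (\<lambda>i. int N * x i)) = scaled N Y"
        using w by (simp_all add: scaled_mult[OF N])
      fix t
      have "set (take t w) \<subseteq> J" using w(1) set_take_subset unfolding minimal_word_def by fast
      from latt_act[OF this latt_emb[OF x]]
      show "\<exists>Z. act \<alpha> (take t w) (scaled N (\<lambda>i. int N * x i)) = scaled N Z"
        using scaled_mult[OF N] by (auto simp: latt_def)
    qed
  qed
  (* K exceeds the absolute value of tau, so an escaped point does not belong to the fibre. *)
  define K where "K = 3 + cmod (\<alpha> i) + cmod (\<alpha> j) + cmod (\<alpha> k) + \<bar>real_of_int \<tau>\<bar>"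
  have K3: "3 \<le> K" and Kt: "\<bar>real_of_int \<tau>\<bar> < K"
    using norm_ge_zero[of "\<alpha> i"] norm_ge_zero[of "\<alpha> j"] norm_ge_zero[of "\<alpha> k"] unfolding K_def by linarith+
  have K: "cmod (\<alpha> l) \<le> K" for l using distinct3_cases[OF d, of l] by (auto simp: K_def)
  obtain R1 where R1: "\<And>p. cubic \<alpha> p = \<beta> \<Longrightarrow> cmod (p i) \<le> K \<Longrightarrow> cmod (p k) \<le> K \<Longrightarrow> cmod (p j) \<le> R1"
    using third_coordinate_bounded[of i k j] ij by (metis distinct3_def)
  obtain R2 where R2: "\<And>p. cubic \<alpha> p = \<beta> \<Longrightarrow> cmod (p j) \<le> K \<Longrightarrow> cmod (p k) \<le> K \<Longrightarrow> cmod (p i) \<le> R2"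
    using third_coordinate_bounded[of j k i] ij by (metis distinct3_def)
  define R where "R = max K (max R1 R2)"
  define G where "G = {X. \<forall>i. cmod (scaled N X i) \<le> R}"
  define T where "T = {(X, Y). X \<in> G \<and> Y \<in> G \<and> linked \<alpha> UNIV (scaled N X) (scaled N Y)}"
  have exit: "\<exists>X\<in>G. linked \<alpha> J (emb x) (scaled N X) \<and> linked \<alpha> UNIV (emb x) (scaled N X)"
    if x: "cubic \<alpha> (emb x) = \<beta>" and y: "cubic \<alpha> (emb y) = \<beta>"
      and w: "distinct_adj w" "act \<alpha> w (emb x) = emb y" and k: "k \<in> set w" for x y w
  proof -
    obtain u v where uv: "w = u @ k # v" "k \<notin> set u" using k by (auto dest: split_list_first)
    have u: "set u \<subseteq> J" using uv(2) distinct3_cases[OF d] by (auto simp: J_def)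
    define p where "p = act \<alpha> u (emb x)"
    have p: "latt p" "cubic \<alpha> p = \<beta>" using latt_act[OF u latt_emb[OF x]] x by (simp_all add: p_def)
    then obtain X where X: "p = scaled N X" "p k = of_int \<tau>" by (auto simp: latt_def)
    have pk: "cmod (p k) \<le> K" using X(2) Kt by simp
    have "\<not> (K \<le> cmod (p i) \<and> K \<le> cmod (p j))"
    proof
      assume big: "K \<le> cmod (p i) \<and> K \<le> cmod (p j)"
      have "escaped K k (vieta \<alpha> k p)" by (rule escaped_vieta[OF K3 K d]) (use big pk in auto)
      moreover have "distinct_adj (k # v)" using w(1) uv(1) by auto
      ultimately have "escaped K (last (k # v)) (act \<alpha> v (vieta \<alpha> k p))" by (rule escaped_forever[where \<alpha> = \<alpha>, OF K3 K])
      moreover have "act \<alpha> v (vieta \<alpha> k p) = emb y" using w(2) uv(1) by (simp add: p_def)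
      ultimately have "K \<le> cmod (emb y k)" by (simp add: escaped_def)
      then show False using fibre[OF y] Kt by (simp add: emb_def)
    qed
    then have "cmod (p i) \<le> R \<and> cmod (p j) \<le> R"
      using R1[OF p(2) _ pk] R2[OF p(2) _ pk] unfolding R_def by fastforce
    then have "\<forall>l. cmod (p l) \<le> R" using pk distinct3_cases[OF d] unfolding R_def by (metis max.coboundedI1)
    then have "X \<in> G" using X(1) by (simp add: G_def)
    moreover have "linked \<alpha> J (emb x) p" using u unfolding linked_def p_def by blast
    ultimately show ?thesis using X(1) linked_mono by blast
  qed
  show ?thesis
  proof (rule orbits_by_lattice_pathsI[where J = J and T = T and C = C, OF N a])
    have "T \<subseteq> G \<times> G" by (auto simp: T_def)
    then show "finite T" using finite_scaled_bounded[OF N, of R] unfolding G_def by (auto intro: finite_subset)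
    show "linked \<alpha> UNIV (scaled N g) (scaled N h)" if "(g, h) \<in> T" for g h using that by (simp add: T_def)
    fix x y assume x: "cubic \<alpha> (emb x) = \<beta>" and y: "cubic \<alpha> (emb y) = \<beta>"
      and link: "linked \<alpha> UNIV (emb x) (emb y)"
    obtain w where w: "distinct_adj w" "act \<alpha> w (emb x) = emb y" using linked_distinct_adj[OF link] by metis
    show "conn N J a C (\<lambda>i. int N * x i) (\<lambda>i. int N * y i) \<or>
         (\<exists>(g, h)\<in>T. conn N J a C (\<lambda>i. int N * x i) g \<and> conn N J a C (\<lambda>i. int N * y i) h)"
    proof (cases "k \<in> set w")
      case False
      then have "set w \<subseteq> J" using distinct3_cases[OF d] by (auto simp: J_def)
      then have "linked \<alpha> J (emb x) (scaled N (\<lambda>i. int N * y i))"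
        using w(2) unfolding linked_def scaled_mult[OF N] by blast
      then show ?thesis using connJ[OF x] by blast
    next
      case True
      obtain X where X: "X \<in> G" "linked \<alpha> J (emb x) (scaled N X)" "linked \<alpha> UNIV (emb x) (scaled N X)"
        using exit[OF x y w True] by blast
      have "distinct_adj (rev w)" "act \<alpha> (rev w) (emb y) = emb x" "k \<in> set (rev w)"
        using w(1) True act_rev[OF w(2)] by simp_all
      from exit[OF y x this] obtain Y where
        Y: "Y \<in> G" "linked \<alpha> J (emb y) (scaled N Y)" "linked \<alpha> UNIV (emb y) (scaled N Y)" by blast
      have "linked \<alpha> UNIV (scaled N X) (scaled N Y)"
        using linked_trans[OF linked_trans[OF linked_sym[OF X(3)] link] Y(3)] .
      then have "(X, Y) \<in> T" using X Y by (simp add: T_def)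
      then show ?thesis using connJ[OF x X(2)] connJ[OF y Y(2)] by blast
    qed
  qed
qed

section \<open>Conjugates and specialisations\<close>

definition ring_hom :: "('a::comm_ring_1 \<Rightarrow> complex) \<Rightarrow> bool" where
  "ring_hom h \<longleftrightarrow> h 1 = 1 \<and> (\<forall>a b. h (a - b) = h a - h b \<and> h (a * b) = h a * h b)"

lemma ring_homD:
  assumes "ring_hom h"
  shows "h 1 = 1" "h (a - b) = h a - h b" "h (a * b) = h a * h b" "h 0 = 0" "h (- a) = - h a" "h (a + b) = h a + h b"
proof -
  show *: "h 1 = 1" "h (a - b) = h a - h b" "h (a * b) = h a * h b" for a b using assms by (auto simp: ring_hom_def)
  show 0: "h 0 = 0" using *(2)[of 0 0] by simp
  show m: "h (- a) = - h a" for a using *(2)[of 0 a] 0 by simp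
  show "h (a + b) = h a + h b" using *(2)[of a "- b"] m by simp
qed

lemma ring_hom_of_rat: "ring_hom (of_rat :: rat \<Rightarrow> complex)"
  by (simp add: ring_hom_def of_rat_diff of_rat_mult)

text \<open>The homomorphism on \<open>A[X]\<close> that extends \<open>h\<close> on \<open>A\<close>
and sends \<open>X\<close> to \<open>z\<close>. Iterating it once gives the evaluation of
polynomials in two variables at a pair of complex numbers.\<close>

definition eval_poly_at :: "('a::comm_ring_1 \<Rightarrow> complex) \<Rightarrow> complex \<Rightarrow> 'a poly \<Rightarrow> complex" where
  "eval_poly_at h z f = poly (map_poly h f) z"

lemma ring_hom_eval_poly_at:
  assumes h: "ring_hom h" shows "ring_hom (eval_poly_at h z)"
proof -
  have sum: "h (sum g A) = (\<Sum>i\<in>A. h (g i))" for g and A :: "nat set"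
    by (induction A rule: infinite_finite_induct) (simp_all add: ring_homD[OF h])
  have "map_poly h 1 = 1" by (rule poly_eqI) (simp add: coeff_map_poly ring_homD[OF h] coeff_1)
  moreover have "map_poly h (f - g) = map_poly h f - map_poly h g" for f g
    by (rule poly_eqI) (simp add: coeff_map_poly ring_homD[OF h])
  moreover have "map_poly h (f * g) = map_poly h f * map_poly h g" for f g
    by (rule poly_eqI) (simp add: coeff_map_poly ring_homD[OF h] coeff_mult sum)
  ultimately show ?thesis by (simp add: ring_hom_def eval_poly_at_def)
qed

lemma eval_poly_at_pCons:
  assumes h: "ring_hom h" shows "eval_poly_at h z (pCons a f) = h a + z * eval_poly_at h z f"
  by (simp add: eval_poly_at_def map_poly_pCons ring_homD[OF h])

lemma eval_poly_at_0 [simp]: "eval_poly_at h z 0 = 0" by (simp add: eval_poly_at_def)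

lemma eval_poly_at_smult:
  assumes h: "ring_hom h" shows "eval_poly_at h z (smult a f) = h a * eval_poly_at h z f"
  using ring_homD(3)[OF ring_hom_eval_poly_at[OF h], of z "[:a:]" f]
  by (simp add: eval_poly_at_pCons[OF h])

abbreviation eval_rat :: "complex \<Rightarrow> rat poly \<Rightarrow> complex" where
  "eval_rat \<equiv> eval_poly_at of_rat"

lemmas eval_rat_hom = ring_homD[OF ring_hom_eval_poly_at[OF ring_hom_of_rat]]
lemmas eval_rat_pCons = eval_poly_at_pCons[OF ring_hom_of_rat]

lemma algebraic_eval_rat: "f \<noteq> 0 \<Longrightarrow> eval_rat z f = 0 \<Longrightarrow> algebraic z"
proof (rule algebraicI'[of "map_poly of_rat f"])
  assume "f \<noteq> 0"
  then obtain i where "coeff f i \<noteq> 0" by (auto simp: poly_eq_iff)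
  then show "map_poly of_rat f \<noteq> (0 :: complex poly)" by (auto simp: poly_eq_iff coeff_map_poly)
qed (auto simp: coeff_map_poly eval_poly_at_def)

lemma minimal_polynomial:
  assumes "f \<noteq> 0" "eval_rat z f = 0"
  obtains m where "m \<noteq> 0" "eval_rat z m = 0" "\<And>g. eval_rat z g = 0 \<Longrightarrow> m dvd g" "degree m \<ge> 1"
proof -
  let ?P = "\<lambda>m. m \<noteq> 0 \<and> eval_rat z m = 0"
  obtain m where m: "?P m" "\<And>g. ?P g \<Longrightarrow> degree m \<le> degree g"
    using ex_has_least_nat[of ?P f degree] assms by blast
  have "m dvd g" if "eval_rat z g = 0" for g
  proof (rule ccontr)
    assume "\<not> m dvd g"
    then have "g mod m \<noteq> 0" by (simp add: dvd_eq_mod_eq_0)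
    moreover have "g mod m = g - m * (g div m)" by (simp add: minus_mult_div_eq_mod)
    then have "eval_rat z (g mod m) = 0" using that m(1) by (simp add: eval_rat_hom)
    ultimately have "degree m \<le> degree (g mod m)" using m(2) by blast
    moreover have "degree (g mod m) < degree m"
      using degree_mod_less[of m g] m(1) \<open>g mod m \<noteq> 0\<close> by simp
    ultimately show False by simp
  qed
  moreover have "degree m \<ge> 1"
  proof (rule ccontr)
    assume "\<not> ?thesis"
    then obtain a where "m = [:a:]" by (metis degree_eq_zeroE less_one not_le)
    then show False using m(1) by (simp add: eval_rat_pCons)
  qed
  ultimately show thesis using that m(1) by blast
qed

lemma poly_pderiv_linear_factor:
  fixes z :: complex shows "poly (pderiv ([:- z, 1:] * g)) z = poly g z"
  by (subst pderiv_mult) (simp add: pderiv_pCons algebra_simps)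

text \<open>If \<open>z\<close> is transcendental, then \<open>z + 1\<close> satisfies the same
equations, namely none. Otherwise the minimal polynomial of \<open>z\<close> has degree at least
2 and a simple root at \<open>z\<close>, so it has another root.\<close>

lemma conjugate_exists:
  assumes z: "z \<notin> \<rat>"
  obtains z' where "z' \<noteq> z" "\<And>f. eval_rat z f = 0 \<longleftrightarrow> eval_rat z' f = 0"
proof (cases "\<exists>f. f \<noteq> 0 \<and> eval_rat z f = 0")
  case False
  have "f = 0" if "eval_rat (z + 1) f = 0" for f
  proof -
    have "eval_rat z (pcompose f [:1, 1:]) = eval_rat (z + 1) f"
      by (induction f) (simp_all add: pcompose_pCons eval_rat_hom eval_rat_pCons algebra_simps)
    then have "pcompose f [:1, 1:] = 0" using False that by metis
    then show "f = 0" by (subst (asm) pcompose_eq_0_iff) auto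
  qed
  then have "eval_rat z f = 0 \<longleftrightarrow> eval_rat (z + 1) f = 0" for f
    using False eval_poly_at_0 by metis
  then show thesis by (intro that[of "z + 1"]) simp_all
next
  case True
  then obtain m where m: "m \<noteq> 0" "eval_rat z m = 0" "\<And>g. eval_rat z g = 0 \<Longrightarrow> m dvd g" "degree m \<ge> 1"
    using minimal_polynomial by metis
  let ?m = "map_poly of_rat m :: complex poly"
  have deg: "degree ?m = degree m" by (simp add: degree_map_poly)
  have "degree m \<noteq> 1"
  proof
    assume "degree m = 1"
    then obtain a b where ab: "m = [:a, b:]" "b \<noteq> 0" by (metis degree1_coeffs)
    then have "of_rat a + z * of_rat b = 0" using m(2) by (simp add: eval_rat_pCons)
    then have "z = of_rat (- a / b)" using ab(2)
      by (simp add: of_rat_divide of_rat_minus field_simps eq_neg_iff_add_eq_0)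
    then show False using z by simp
  qed
  then have deg2: "degree m \<ge> 2" using m(4) by simp
  have root: "poly ?m z = 0" using m(2) by (simp add: eval_poly_at_def)
  then obtain g where g: "?m = [:- z, 1:] * g" using poly_eq_0_iff_dvd by blast
  have "poly g z \<noteq> 0"
  proof
    assume "poly g z = 0"
    then have "poly (pderiv ?m) z = 0" unfolding g by (simp only: poly_pderiv_linear_factor)
    moreover have "pderiv ?m = map_poly of_rat (pderiv m)"
      by (rule poly_eqI) (simp add: coeff_pderiv coeff_map_poly of_rat_mult of_rat_add)
    ultimately have "eval_rat z (pderiv m) = 0" by (simp add: eval_poly_at_def)
    then have "m dvd pderiv m" using m(3) by blast
    then show False using not_dvd_pderiv[of m] m(4) by simp
  qed
  have "g \<noteq> 0" using \<open>poly g z \<noteq> 0\<close> by auto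
  then have "degree ?m = 1 + degree g" unfolding g by (subst degree_mult_eq) auto
  then have "degree g \<noteq> 0" using deg deg2 by simp
  then have "\<not> constant (poly g)" by (simp add: constant_degree)
  then obtain z' where z': "poly g z' = 0" using fundamental_theorem_of_algebra by blast
  then have ne: "z' \<noteq> z" using \<open>poly g z \<noteq> 0\<close> by auto
  have mz': "eval_rat z' m = 0" using z' g by (simp add: eval_poly_at_def)
  have 1: "eval_rat z' f = 0" if "eval_rat z f = 0" for f
    using m(3)[OF that] mz' by (auto simp: eval_rat_hom elim!: dvdE)
  have 2: "eval_rat z f = 0" if f: "eval_rat z' f = 0" for f
  proof -
    obtain m' where m': "m' \<noteq> 0" "eval_rat z' m' = 0" "\<And>g. eval_rat z' g = 0 \<Longrightarrow> m' dvd g" "degree m' \<ge> 1"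
      using minimal_polynomial[OF m(1) mz'] by metis
    obtain h where h: "m = m' * h" using m'(3)[OF mz'] by blast
    have "eval_rat z m' = 0"
    proof (rule ccontr)
      assume "eval_rat z m' \<noteq> 0"
      then have "eval_rat z h = 0" using m(2) h by (simp add: eval_rat_hom)
      then have "m dvd h" by (rule m(3))
      moreover have "h \<noteq> 0" using h m(1) by auto
      ultimately have "degree m \<le> degree h" by (rule dvd_imp_degree_le)
      moreover have "degree m = degree m' + degree h"
        using h \<open>h \<noteq> 0\<close> m'(1) by (simp add: degree_mult_eq)
      ultimately show False using m'(4) by simp
    qed
    then show ?thesis using m'(3)[OF f] by (auto simp: eval_rat_hom elim!: dvdE)
  qed
  show thesis using that[OF ne] 1 2 by blast
qed

text \<open>If no equation of \<open>c\<close> has a leading coefficient outside the kernel of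
\<open>h\<close>, then leading terms can be removed one after the other.\<close>

lemma coefficients_vanish:
  assumes h: "ring_hom h" and F: "eval_poly_at h c F = 0"
    and lead: "\<And>G. eval_poly_at h c G = 0 \<Longrightarrow> degree G \<le> degree F \<Longrightarrow> h (lead_coeff G) = 0"
  shows "h (coeff F i) = 0"
proof -
  have "\<forall>i. h (coeff G i) = 0" if "eval_poly_at h c G = 0" "degree G \<le> degree F" for G
    using that
  proof (induction "degree G" arbitrary: G rule: less_induct)
    case less
    have l: "h (lead_coeff G) = 0" by (rule lead[OF less.prems])
    show ?case
    proof (cases "degree G = 0")
      case True
      then show ?thesis using l ring_homD(4)[OF h] by (metis coeff_eq_0 gr0I)
    next
      case deg: False
      let ?R = "G - monom (lead_coeff G) (degree G)"
      have "eval_poly_at h c (monom (lead_coeff G) (degree G)) = 0"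
        using l ring_homD(4)[OF h] by (simp add: eval_poly_at_def map_poly_monom)
      then have R0: "eval_poly_at h c ?R = 0"
        using less.prems by (simp add: ring_homD[OF ring_hom_eval_poly_at[OF h]])
      have less_deg: "degree ?R < degree G"
        by (rule degree_lessI) (use deg in \<open>auto simp: coeff_eq_0\<close>)
      then have R: "h (coeff ?R i) = 0" for i using less.hyps[OF less_deg R0] less.prems(2) by simp
      show ?thesis
      proof
        show "h (coeff G i) = 0" for i using R[of i] l by (cases "i = degree G") simp_all
      qed
    qed
  qed
  then show ?thesis using F by blast
qed

text \<open>If \<open>z\<close> and \<open>z'\<close> satisfy the same equations over
\<open>\<rat>\<close>, then the specialisation \<open>z \<mapsto> z'\<close> extends to every
further number \<open>c\<close>. If \<open>c\<close> is transcendental over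
\<open>\<rat>(z)\<close>, then any value will do. Otherwise \<open>c'\<close> is a root of the
specialised equation \<open>G\<close> of minimal degree; pseudo-division by \<open>G\<close>
shows that it satisfies all specialised equations, without division in \<open>\<rat>(z)\<close>.\<close>

lemma extend_specialisation:
  assumes z: "\<And>f. eval_rat z f = 0 \<longleftrightarrow> eval_rat z' f = 0"
  obtains c' where "\<And>F. eval_poly_at (eval_rat z) c F = 0 \<Longrightarrow> eval_poly_at (eval_rat z') c' F = 0"
proof -
  note hz = ring_hom_eval_poly_at[OF ring_hom_of_rat, of z]
  note hz' = ring_hom_eval_poly_at[OF ring_hom_of_rat, of z']
  have vanish: "eval_poly_at (eval_rat z') c' F = 0" if "\<And>i. eval_rat z (coeff F i) = 0" for c' F
  proof -
    have "map_poly (eval_rat z') F = 0" using that z by (intro poly_eqI) (simp add: coeff_map_poly)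
    then show ?thesis by (simp add: eval_poly_at_def)
  qed
  show thesis
  proof (cases "\<exists>F. eval_poly_at (eval_rat z) c F = 0 \<and> eval_rat z (lead_coeff F) \<noteq> 0")
    case False
    then have "eval_rat z (coeff F i) = 0" if "eval_poly_at (eval_rat z) c F = 0" for F i
      using coefficients_vanish[OF hz that] by blast
    then show thesis by (intro that[of 0] vanish)
  next
    case True
    let ?P = "\<lambda>F. eval_poly_at (eval_rat z) c F = 0 \<and> eval_rat z (lead_coeff F) \<noteq> 0"
    obtain G where G: "?P G" "\<And>F. ?P F \<Longrightarrow> degree G \<le> degree F"
      using ex_has_least_nat[of ?P _ degree] True by metis
    have deg: "degree G \<noteq> 0"
    proof
      assume "degree G = 0"
      then obtain g where "G = [:g:]" by (metis degree_eq_zeroE)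
      then show False using G(1) by (simp add: eval_poly_at_pCons[OF hz])
    qed
    have G0: "G \<noteq> 0" using deg by auto
    have l': "eval_rat z' (lead_coeff G) \<noteq> 0" using G(1) z by blast
    have low: "eval_rat z (coeff R i) = 0" if "eval_poly_at (eval_rat z) c R = 0" "degree R < degree G" for R i
      by (rule coefficients_vanish[OF hz that(1)]) (use G(2) that(2) in force)
    let ?G' = "map_poly (eval_rat z') G"
    have "coeff ?G' (degree G) \<noteq> 0" using l' by (simp add: coeff_map_poly)
    then have "degree ?G' \<noteq> 0" using deg le_degree[of ?G' "degree G"] by simp
    then have "\<not> constant (poly ?G')" by (simp add: constant_degree)
    then obtain c' where c': "poly ?G' c' = 0" using fundamental_theorem_of_algebra by blast
    show thesis
    proof (rule that[of c'])
      fix F assume F: "eval_poly_at (eval_rat z) c F = 0"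
      obtain q r where qr: "pseudo_divmod F G = (q, r)" by fastforce
      have eq: "smult (lead_coeff G ^ (Suc (degree F) - degree G)) F = G * q + r"
        and r: "r = 0 \<or> degree r < degree G"
        using pseudo_divmod[OF G0 qr] by simp_all
      note E = ring_homD[OF ring_hom_eval_poly_at[OF hz]] eval_poly_at_smult[OF hz]
      note E' = ring_homD[OF ring_hom_eval_poly_at[OF hz']] eval_poly_at_smult[OF hz']
      have "eval_poly_at (eval_rat z) c r = 0"
        using arg_cong[OF eq, of "eval_poly_at (eval_rat z) c"] F G(1) by (simp add: E)
      then have "eval_rat z (coeff r i) = 0" for i using r low deg by (cases "r = 0") auto
      then have r0: "eval_poly_at (eval_rat z') c' r = 0" by (rule vanish)
      have "eval_poly_at (eval_rat z') c' G = 0" using c' by (simp add: eval_poly_at_def)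
      then have "eval_rat z' (lead_coeff G ^ (Suc (degree F) - degree G)) * eval_poly_at (eval_rat z') c' F = 0"
        using arg_cong[OF eq, of "eval_poly_at (eval_rat z') c'"] r0 by (simp add: E')
      moreover have "eval_rat z' (lead_coeff G ^ n) \<noteq> 0" for n
        using l' by (induction n) (simp_all add: ring_homD[OF hz'])
      ultimately show "eval_poly_at (eval_rat z') c' F = 0" by simp
    qed
  qed
qed
lemma ring_hom_of_int:
  assumes "ring_hom h" shows "h (of_int a) = of_int a"
proof -
  have nat: "h (of_nat b) = of_nat b" for b by (induction b) (simp_all add: ring_homD[OF assms])
  show ?thesis by (cases a rule: int_diff_cases) (simp add: ring_homD[OF assms] nat)
qed

text \<open>That a word leads to an integer point is a polynomial identity for the coefficients, so it
persists under specialisation. The coefficients and the point are images under \<open>h\<close>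
of elements of a polynomial ring, and \<open>h'\<close> is another evaluation of this ring.\<close>

lemma act_specialise:
  assumes h: "ring_hom h" and h': "ring_hom h'" and ker: "\<And>F. h F = 0 \<Longrightarrow> h' F = 0"
    and eq: "act (\<lambda>l. h (a l)) w (\<lambda>l. h (x l)) = emb y"
  shows "act (\<lambda>l. h' (a l)) w (\<lambda>l. h' (x l)) = emb y"
proof
  fix l
  have "h (act a w x l) = of_int (y l)"
    using eq act_hom[of h w "\<lambda>l. h (a l)" a x] ring_homD(2,3)[OF h] by (simp add: emb_def fun_eq_iff)
  then have "h (act a w x l - of_int (y l)) = 0" by (simp add: ring_homD(2)[OF h] ring_hom_of_int[OF h])
  then have "h' (act a w x l - of_int (y l)) = 0" by (rule ker)
  then have "h' (act a w x l) = of_int (y l)" by (simp add: ring_homD(2)[OF h'] ring_hom_of_int[OF h'])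
  then show "act (\<lambda>l. h' (a l)) w (\<lambda>l. h' (x l)) l = emb y l"
    using act_hom[of h' w "\<lambda>l. h' (a l)" a x] ring_homD(2,3)[OF h'] by (simp add: emb_def)
qed

section \<open>Separation of conjugates at a prime\<close>

lemma inverse_in_simple_extension:
  assumes m: "m \<noteq> 0" "eval_rat z m = 0" "\<And>g. eval_rat z g = 0 \<Longrightarrow> m dvd g" and f: "eval_rat z f \<noteq> 0"
  shows "\<exists>a. eval_rat z a * eval_rat z f = 1"
  using f
proof (induction "degree f" arbitrary: f rule: less_induct)
  case less
  have f0: "f \<noteq> 0" using less.prems by auto
  have "m = f * (m div f) + m mod f" by simp
  then have split: "0 = eval_rat z f * eval_rat z (m div f) + eval_rat z (m mod f)"
    using m(2) by (metis eval_rat_hom(3) eval_rat_hom(6))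
  show ?case
  proof (cases "degree f = 0")
    case True
    then obtain c where c: "f = [:c:]" by (metis degree_eq_zeroE)
    then have "c \<noteq> 0" using f0 by auto
    then have "eval_rat z [:1 / c:] * eval_rat z f = 1" by (simp add: c eval_rat_pCons flip: of_rat_mult)
    then show ?thesis by blast
  next
    case False
    have degm: "degree m \<noteq> 0"
    proof
      assume "degree m = 0"
      then obtain c where "m = [:c:]" by (metis degree_eq_zeroE)
      then show False using m(1,2) by (simp add: eval_rat_pCons)
    qed
    show ?thesis
    proof (cases "degree f < degree m")
      case big: False
      have "degree (f mod m) < degree m" using degm degree_mod_less[OF m(1), of f] by auto
      then have "degree (f mod m) < degree f" using big by simp
      moreover have "f = m * (f div m) + f mod m" by simp
      then have "eval_rat z f = eval_rat z (f mod m)"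
        using m(2) by (metis add_0 eval_rat_hom(3) eval_rat_hom(6) mult_zero_left)
      ultimately show ?thesis using less.hyps less.prems by metis
    next
      case small: True
      have deg: "degree (m mod f) < degree f" using False degree_mod_less[OF f0, of m] by auto
      have "eval_rat z (m mod f) \<noteq> 0"
      proof
        assume "eval_rat z (m mod f) = 0"
        then have dvd: "m dvd m mod f" "m dvd m div f" using split less.prems m(3) by auto
        have "m mod f = 0"
        proof (rule ccontr)
          assume "m mod f \<noteq> 0"
          then have "degree m \<le> degree (m mod f)" using dvd(1) by (intro dvd_imp_degree_le)
          then show False using deg small by simp
        qed
        then have eq: "m = f * (m div f)" by (metis add_0_right mult_div_mod_eq)
        then have ne: "m div f \<noteq> 0" using m(1) by auto
        then have "degree m \<le> degree (m div f)" using dvd(2) by (intro dvd_imp_degree_le)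
        moreover have "degree m = degree f + degree (m div f)"
          using degree_mult_eq[OF f0 ne] eq by simp
        ultimately show False using False by simp
      qed
      from less.hyps[OF deg this] obtain a where a: "eval_rat z a * eval_rat z (m mod f) = 1" by blast
      have "eval_rat z (m mod f) = - (eval_rat z f * eval_rat z (m div f))"
        using split by (metis add.commute minus_unique)
      with a have "eval_rat z (- a * (m div f)) * eval_rat z f = 1" by (simp add: eval_rat_hom mult_ac)
      then show ?thesis by blast
    qed
  qed
qed

text \<open>The numbers bounded by a power of \<open>1/p\<close> form the ring \<open>B[1/p]\<close>,
which contains all algebraic numbers.\<close>

context valuation_ring
begin

definition p_bounded :: "nat \<Rightarrow> complex \<Rightarrow> bool" where
  "p_bounded p x \<longleftrightarrow> (\<exists>j. vle x ((1 / of_nat p) ^ j))"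

context
  fixes p :: nat assumes p: "prime p"
begin

lemma one_vle_p: "vle 1 ((1 / of_nat p) ^ j)"
proof -
  have "vle 1 (1 / of_nat p)"
    unfolding vle_def by (rule bexI[of _ "of_nat p"]) (use prime_gt_0_nat[OF p] subring_of_nat[OF subring] in auto)
  from vle_power[OF this, of j] show ?thesis by simp
qed

lemma p_power_mono: "i \<le> j \<Longrightarrow> vle ((1 / of_nat p) ^ i) ((1 / of_nat p) ^ j)"
  using vle_mult[OF vle_refl[of "(1 / of_nat p) ^ i"] one_vle_p[of "j - i"]] by (simp flip: power_add)

lemma p_bounded_mult: "p_bounded p x \<Longrightarrow> p_bounded p y \<Longrightarrow> p_bounded p (x * y)"
  unfolding p_bounded_def using vle_mult by (metis power_add)

lemma p_bounded_common:
  assumes "p_bounded p x" "p_bounded p y"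
  obtains j where "vle x ((1 / of_nat p) ^ j)" "vle y ((1 / of_nat p) ^ j)"
proof -
  obtain a b where "vle x ((1 / of_nat p) ^ a)" "vle y ((1 / of_nat p) ^ b)"
    using assms unfolding p_bounded_def by blast
  then show thesis using that[of "max a b"] vle_trans p_power_mono by (metis max.cobounded1 max.cobounded2)
qed

lemma p_bounded_add: "p_bounded p x \<Longrightarrow> p_bounded p y \<Longrightarrow> p_bounded p (x + y)"
  using p_bounded_common vle_add unfolding p_bounded_def by metis

lemma p_bounded_diff: "p_bounded p x \<Longrightarrow> p_bounded p y \<Longrightarrow> p_bounded p (x - y)"
  using p_bounded_common vle_diff unfolding p_bounded_def by metis

lemma p_bounded_mem: "x \<in> B \<Longrightarrow> p_bounded p x"
  unfolding p_bounded_def by (intro exI[of _ 0]) (simp add: vle_1_iff)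

lemma p_bounded_power: "p_bounded p x \<Longrightarrow> p_bounded p (x ^ n)"
  by (induction n) (auto intro: p_bounded_mult p_bounded_mem subring_1[OF subring])

lemma p_bounded_sum: "(\<And>i. i \<in> A \<Longrightarrow> p_bounded p (f i)) \<Longrightarrow> p_bounded p (sum f A)"
  by (induction A rule: infinite_finite_induct) (auto intro: p_bounded_add p_bounded_mem subring_0[OF subring])

lemma p_bounded_poly: "(\<And>i. p_bounded p (coeff f i)) \<Longrightarrow> p_bounded p z \<Longrightarrow> p_bounded p (poly f z)"
  unfolding poly_altdef by (intro p_bounded_sum p_bounded_mult p_bounded_power)

text \<open>The coefficients of the quotient are obtained from those of \<open>f\<close> by Horner's
scheme, from the top down.\<close>

lemma p_bounded_synthetic_division:
  assumes f: "f = [:- c, 1:] * g" and c: "p_bounded p c" and coeffs: "\<And>i. p_bounded p (coeff f i)"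
  shows "p_bounded p (coeff g i)"
proof (cases "i > degree g")
  case True
  then show ?thesis by (simp add: coeff_eq_0 p_bounded_mem subring_0[OF subring])
next
  case False
  have step: "p_bounded p (coeff g i)" if "p_bounded p (coeff g (Suc i))" for i
  proof -
    have "coeff g i = coeff f (Suc i) + c * coeff g (Suc i)" by (simp add: f)
    then show ?thesis using that c coeffs by (simp add: p_bounded_add p_bounded_mult)
  qed
  have "i \<le> Suc (degree g)" using False by simp
  then show ?thesis
  proof (induction rule: inc_induct)
    case base
    show ?case by (simp add: coeff_eq_0 p_bounded_mem subring_0[OF subring])
  qed (rule step)
qed

context
  assumes pB: "1 / of_nat p \<notin> B"
begin

lemma p_bounded_algebraic: "algebraic x \<Longrightarrow> p_bounded p x"
  unfolding p_bounded_def by (rule algebraic_vle_prime_power[OF p pB])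

lemma p_bounded_of_rat: "p_bounded p (of_rat x)"
  by (intro p_bounded_algebraic rat_imp_algebraic) simp

text \<open>Let \<open>m\<close> be the minimal polynomial and \<open>m = (X - z) (X - z') h\<close>.
Then \<open>m'(z) = (z - z') h(z)\<close>. Since \<open>m'(z)\<close> is invertible in
\<open>\<rat>(z)\<close>, the inverse of \<open>z - z'\<close> is an expression in
\<open>B[1/p]\<close>.\<close>

lemma conjugates_p_separated:
  assumes m0: "m \<noteq> 0" "eval_rat z m = 0" and conj: "\<And>f. eval_rat z f = 0 \<Longrightarrow> eval_rat z' f = 0" and ne: "z' \<noteq> z"
  shows "p_bounded p (1 / (z - z'))"
proof -
  obtain m where m: "m \<noteq> 0" "eval_rat z m = 0" "\<And>g. eval_rat z g = 0 \<Longrightarrow> m dvd g" "degree m \<ge> 1"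
    using minimal_polynomial[OF m0] by metis
  have alg: "algebraic z" "algebraic z'" using algebraic_eval_rat m(1,2) conj by auto
  let ?m = "map_poly of_rat m :: complex poly"
  have "poly ?m z = 0" using m(2) by (simp add: eval_poly_at_def)
  then obtain g where g: "?m = [:- z, 1:] * g" using poly_eq_0_iff_dvd by blast
  have gb: "p_bounded p (coeff g i)" for i
    by (rule p_bounded_synthetic_division[OF g])
       (auto intro: p_bounded_algebraic[OF alg(1)] p_bounded_of_rat simp: coeff_map_poly)
  have "poly ?m z' = 0" using conj[OF m(2)] by (simp add: eval_poly_at_def)
  then have "poly g z' = 0" using g ne by simp
  then obtain h where h: "g = [:- z', 1:] * h" using poly_eq_0_iff_dvd by blast
  have hb: "p_bounded p (coeff h i)" for i
    by (rule p_bounded_synthetic_division[OF h p_bounded_algebraic[OF alg(2)] gb])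
  have "poly g z = poly (pderiv ?m) z" unfolding g by (simp only: poly_pderiv_linear_factor)
  also have "pderiv ?m = map_poly of_rat (pderiv m)"
    by (rule poly_eqI) (simp add: coeff_pderiv coeff_map_poly of_rat_mult of_rat_add)
  finally have gz: "poly g z = eval_rat z (pderiv m)" by (simp add: eval_poly_at_def)
  have "eval_rat z (pderiv m) \<noteq> 0"
  proof
    assume "eval_rat z (pderiv m) = 0"
    then have "m dvd pderiv m" by (rule m(3))
    then show False using not_dvd_pderiv[of m] m(4) by simp
  qed
  from inverse_in_simple_extension[OF m(1-3) this]
  obtain a where "eval_rat z a * poly g z = 1" using gz by auto
  then have "(eval_rat z a * poly h z) * (z - z') = 1" by (simp add: h algebra_simps)
  then have "1 / (z - z') = eval_rat z a * poly h z" using ne by (simp add: field_simps)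
  moreover have "p_bounded p (eval_rat z a * poly h z)"
    unfolding eval_poly_at_def
    by (intro p_bounded_mult p_bounded_poly hb p_bounded_algebraic[OF alg(1)])
       (simp add: coeff_map_poly p_bounded_of_rat)
  ultimately show ?thesis by simp
qed

end
end
end

section \<open>Rational lines in a fibre\<close>

text \<open>The two equations say that the line of points \<open>(u + m r, v + n r, \<tau>)\<close>,
with coordinates in the order \<open>i\<close>, \<open>j\<close>, \<open>k\<close>, lies in a
surface \<open>cubic \<alpha> = const\<close>: they express that the coefficients of
\<open>r\<^sup>2\<close> and of \<open>r\<close> vanish (\<open>cubic_point\<close> below).\<close>

locale rational_line =
  fixes \<alpha> :: "idx \<Rightarrow> complex" and i j k :: idx and u v m n :: int and \<tau> :: complex
  assumes d: "distinct3 i j k" and m0: "m \<noteq> 0" and n0: "n \<noteq> 0"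
    and tau: "of_int (m\<^sup>2 + n\<^sup>2) + \<tau> * of_int (m * n) = 0"
    and slope: "of_int (m * n) * (of_int m * \<alpha> i + of_int n * \<alpha> j) = of_int ((m\<^sup>2 - n\<^sup>2) * (n * u - m * v))"
begin

definition point :: "int \<Rightarrow> idx \<Rightarrow> complex" where
  "point r l = (if l = i then of_int (u + m * r) else if l = j then of_int (v + n * r) else \<tau>)"

text \<open>On the line the form \<open>x\<^sub>i\<^sup>2 + \<tau> x\<^sub>i x\<^sub>j +
x\<^sub>j\<^sup>2\<close> has the factor \<open>x\<^sub>j - q x\<^sub>i\<close>. An alternating
word in the involutions \<open>i\<close> and \<open>j\<close> replaces in each step the older of
the two coordinates. The new values are \<open>W r 1\<close>, \<open>W r 2\<close>, and so on;
\<open>W r 0\<close> is the initial coordinate \<open>x\<^sub>j\<close>, and \<open>W_prev r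
s\<close> is the value before \<open>W r s\<close>. The recursion is affine because each step
maps the line to a line.\<close>

definition q :: complex where "q = of_int n / of_int m"

definition D :: complex where "D = of_int (n * u - m * v)"

definition drift :: "nat \<Rightarrow> complex" where
  "drift t = (if even t then \<alpha> i - D / of_int n else - D / of_int m)"

fun W :: "int \<Rightarrow> nat \<Rightarrow> complex" where
  "W r 0 = of_int (v + n * r)"
| "W r (Suc t) = q * W r t + drift t"

definition W_prev :: "int \<Rightarrow> nat \<Rightarrow> complex" where
  "W_prev r s = (case s of 0 \<Rightarrow> of_int (u + m * r) | Suc t \<Rightarrow> W r t)"

definition alternating :: "nat \<Rightarrow> idx list" where
  "alternating s = map (\<lambda>t. if even t then i else j) [0..<s]"

lemma q0: "q \<noteq> 0" using m0 n0 by (simp add: q_def)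

text \<open>The factors of the form are \<open>x\<^sub>j - q x\<^sub>i\<close> and \<open>x\<^sub>j -
x\<^sub>i / q\<close>.\<close>

lemma tau_q: "\<tau> = - (q + 1 / q)"
proof -
  have "\<tau> * (of_int m * of_int n) = - (of_int m * of_int m + of_int n * of_int n)"
  proof -
    have "of_int m * of_int m + of_int n * of_int n + \<tau> * (of_int m * of_int n) = 0"
      using tau by (simp only: power2_eq_square of_int_add of_int_mult)
    from minus_unique[OF this] show ?thesis by (simp only:)
  qed
  then show ?thesis using m0 n0 unfolding q_def by (simp add: field_simps)
qed

lemma slope_q: "\<alpha> j + (\<alpha> i - D / of_int n) / q = - D / of_int m"
proof -
  define M N :: complex where "M = of_int m" and "N = of_int n"
  have MN: "M \<noteq> 0" "N \<noteq> 0" using m0 n0 by (simp_all add: M_def N_def)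
  have s: "M * N * (M * \<alpha> i + N * \<alpha> j) = (M\<^sup>2 - N\<^sup>2) * D"
    using slope by (simp only: M_def N_def D_def of_int_mult of_int_diff of_int_power)
  have "M * N\<^sup>2 * (\<alpha> j + (\<alpha> i - D / N) / (N / M)) = M * N * (M * \<alpha> i + N * \<alpha> j) - M\<^sup>2 * D"
    using MN by (simp add: field_simps power2_eq_square)
  also have "\<dots> = M * N\<^sup>2 * (- D / M)" unfolding s using MN by (simp add: field_simps power2_eq_square)
  finally have "M * N\<^sup>2 * (\<alpha> j + (\<alpha> i - D / N) / (N / M)) = M * N\<^sup>2 * (- D / M)" .
  moreover have "M * N\<^sup>2 \<noteq> 0" using MN by simp
  ultimately have "\<alpha> j + (\<alpha> i - D / N) / (N / M) = - D / M" by (metis mult_left_cancel)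
  then show ?thesis by (simp only: q_def M_def N_def)
qed

lemma W_rec: "W r s = q * W_prev r s + (if even s then - D / of_int m
    else \<alpha> i - D / of_int n)"
proof (cases s)
  case 0
  then show ?thesis using m0 by (simp add: W_prev_def q_def D_def field_simps)
next
  case (Suc t)
  then show ?thesis by (simp add: W_prev_def drift_def)
qed

lemma alternating_Suc: "alternating (Suc s) = alternating s @ [if even s then i else j]"
  by (simp add: alternating_def)

text \<open>On the line \<open>V\<^sub>i\<close> replaces \<open>x\<^sub>i\<close> by
\<open>\<alpha>\<^sub>i + q x\<^sub>j + x\<^sub>j / q - x\<^sub>i\<close>. The relation between
two consecutive values of \<open>W\<close> expresses \<open>x\<^sub>j / q - x\<^sub>i\<close> by
a constant, and the next step of the recursion remains. The condition on \<open>\<alpha>\<close>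
ensures that \<open>V\<^sub>j\<close> leads to the same recursion.\<close>

lemma act_alternating:
  "act \<alpha> (alternating s) (point r) = (\<lambda>l. if l = k then \<tau> else if (l = i) = odd s then W r s else W_prev r s)"
proof (induction s)
  case 0
  have "i \<noteq> j" "i \<noteq> k" "j \<noteq> k" using d by (auto simp: distinct3_def)
  then show ?case using distinct3_cases[OF d] by (fastforce simp: alternating_def point_def W_prev_def fun_eq_iff)
next
  case (Suc s)
  have ne: "i \<noteq> j" "i \<noteq> k" "j \<noteq> k" using d by (auto simp: distinct3_def)
  have di: "distinct3 i j k" and dj: "distinct3 j i k" using d by (auto simp: distinct3_def)
  let ?P = "act \<alpha> (alternating s) (point r)"
  have prev: "W_prev r (Suc s) = W r s" by (simp add: W_prev_def)
  have new: "vieta \<alpha> (if even s then i else j) ?P (if even s then i else j) = W r (Suc s)"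
  proof (cases "even s")
    case True
    have P: "?P i = W_prev r s" "?P j = W r s" "?P k = \<tau>" using Suc True ne by auto
    have "W r s = q * W_prev r s - D / of_int m" using W_rec[of r s] True by simp
    then have "W r s / q = W_prev r s - D / of_int m / q" using q0 by (simp add: diff_divide_distrib)
    moreover have "D / of_int m / q = D / of_int n"
      using m0 n0 by (simp add: q_def)
    ultimately have X: "W r s / q = W_prev r s - D / of_int n" by metis
    have "vieta \<alpha> i ?P i = \<alpha> i - W r s * \<tau> - W_prev r s" by (simp add: vieta_distinct3[OF di] P)
    also have "\<dots> = \<alpha> i + q * W r s + W r s / q - W_prev r s"
      unfolding tau_q by (simp add: algebra_simps)
    also have "\<dots> = W r (Suc s)" unfolding X using True by (simp add: drift_def)
    finally show ?thesis using True by simp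
  next
    case False
    have P: "?P i = W r s" "?P j = W_prev r s" "?P k = \<tau>" using Suc False ne by auto
    define e where "e = \<alpha> i - D / of_int n"
    have "W r s = q * W_prev r s + e" using W_rec[of r s] False by (simp add: e_def)
    then have X: "W r s / q = W_prev r s + e / q" using q0 by (simp add: add_divide_distrib)
    have "vieta \<alpha> j ?P j = \<alpha> j - W r s * \<tau> - W_prev r s" by (simp add: vieta_distinct3[OF dj] P)
    also have "\<dots> = \<alpha> j + q * W r s + W r s / q - W_prev r s"
      unfolding tau_q by (simp add: algebra_simps)
    also have "\<dots> = q * W r s + (\<alpha> j + e / q)" unfolding X by simp
    also have "\<dots> = W r (Suc s)" unfolding e_def slope_q using False by (simp add: drift_def)
    finally show ?thesis using False by simp
  qed
  show ?case
  proof
    fix l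
    show "act \<alpha> (alternating (Suc s)) (point r) l =
      (if l = k then \<tau> else if (l = i) = odd (Suc s) then W r (Suc s) else W_prev r (Suc s))"
    proof (cases "l = (if even s then i else j)")
      case True
      then show ?thesis using new ne by (auto simp: alternating_Suc)
    next
      case False
      then have "act \<alpha> (alternating (Suc s)) (point r) l = ?P l" by (auto simp: alternating_Suc)
      also have "\<dots> = (if l = k then \<tau> else W r s)"
        using False distinct3_cases[OF d, of l] ne unfolding Suc by (auto split: if_splits)
      also have "\<dots> = (if l = k then \<tau> else if (l = i) = odd (Suc s) then W r (Suc s) else W_prev r (Suc s))"
        using False distinct3_cases[OF d, of l] ne by (auto simp: prev split: if_splits)
      finally show ?thesis .
    qed
  qed
qed

text \<open>A reduced word that begins with \<open>i\<close> alternates between \<open>i\<close> and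
\<open>j\<close> until \<open>k\<close> occurs.\<close>

lemma alternating_prefix:
  assumes "distinct_adj w" "w \<noteq> []" "hd w = i"
  obtains s z where "s \<ge> 1" "w = alternating s @ z" "z = [] \<or> hd z = k"
proof -
  have ne: "i \<noteq> j" "i \<noteq> k" "j \<noteq> k" using d by (auto simp: distinct3_def)
  define a where "a = takeWhile (\<lambda>l. l \<noteq> k) w"
  define z where "z = dropWhile (\<lambda>l. l \<noteq> k) w"
  have w: "w = a @ z" by (simp add: a_def z_def)
  have z: "z = [] \<or> hd z = k" unfolding z_def using hd_dropWhile[of "\<lambda>l. l \<noteq> k" w] by blast
  have ak: "a ! t \<noteq> k" if "t < length a" for t
    using that set_takeWhileD[of "a ! t" "\<lambda>l. l \<noteq> k" w] unfolding a_def by (metis nth_mem)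
  have da: "distinct_adj a" using assms(1) w by (auto simp: distinct_adj_append_iff)
  have a0: "a \<noteq> []" "a ! 0 = i" using assms(2,3) ne(2) unfolding a_def by (cases w; simp)+
  have "a ! t = (if even t then i else j)" if "t < length a" for t
    using that
  proof (induction t)
    case (Suc t)
    have "a ! t \<noteq> a ! Suc t" by (rule distinct_adj_nth[OF da Suc.prems])
    then show ?case using Suc ak[of "Suc t"] distinct3_cases[OF d, of "a ! Suc t"] ne by (auto split: if_splits)
  qed (use a0 in simp)
  then have alt: "a = alternating (length a)" by (auto simp: alternating_def intro: nth_equalityI)
  have "length a \<ge> 1" using a0(1) by (cases a) auto
  moreover have "w = alternating (length a) @ z" by (subst alt[symmetric]) (rule w)
  ultimately show thesis using z by (rule that)
qed

text \<open>The coefficient of \<open>\<alpha> i\<close> in \<open>W r s\<close>; the rest of \<open>W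
r s\<close> is rational.\<close>

definition W_slope :: "nat \<Rightarrow> complex" where
  "W_slope s = rec_nat 0 (\<lambda>t b. q * b + (if even t then 1 else 0)) s"

lemma W_slope_simps [simp]: "W_slope 0 = 0" "W_slope (Suc t) = q * W_slope t + (if even t then 1 else 0)"
  by (simp_all add: W_slope_def)

lemma W_slope_rational: "W_slope s \<in> \<rat>" by (induction s) (auto simp: q_def)

lemma W_rational_part: "W r s - W_slope s * \<alpha> i \<in> \<rat>"
proof (induction s)
  case (Suc s)
  have "W r (Suc s) - W_slope (Suc s) * \<alpha> i = q * (W r s - W_slope s * \<alpha> i) +
      (if even s then - D / of_int n else - D / of_int m)"
    by (auto simp: drift_def algebra_simps)
  moreover have "q \<in> \<rat>" "D \<in> \<rat>" by (simp_all add: q_def D_def)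
  ultimately show ?case using Suc by auto
qed simp

definition q_real :: real where "q_real = of_int n / of_int m"

lemma q_of_real: "q = of_real q_real" by (simp add: q_def q_real_def)

lemma q_real_nonzero: "q_real \<noteq> 0" using m0 n0 by (simp add: q_real_def)

text \<open>At odd indices the coefficient is \<open>1 + q\<^sup>2 + q\<^sup>4 + \<dots>\<close>.\<close>

lemma W_slope_odd: "\<exists>b\<ge>1. W_slope (Suc (2 * l)) = of_real b"
proof (induction l)
  case (Suc l)
  then obtain b where b: "b \<ge> 1" "W_slope (Suc (2 * l)) = of_real b" by blast
  have "W_slope (Suc (2 * Suc l)) = q * (q * W_slope (Suc (2 * l))) + 1" by simp
  also have "\<dots> = of_real (q_real * (q_real * b) + 1)" by (simp only: b(2) q_of_real of_real_mult of_real_add of_real_1)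
  finally have "W_slope (Suc (2 * Suc l)) = of_real (q_real * (q_real * b) + 1)" .
  moreover have "0 \<le> q_real * (q_real * b)" using b(1) by (metis mult.assoc mult_nonneg_nonneg zero_le_square order_trans zero_le_one)
  ultimately show ?case by (intro exI[of _ "q_real * (q_real * b) + 1"]) simp
qed (auto intro: exI[of _ 1])

lemma W_slope_nonzero: "W_slope (Suc s) \<noteq> 0"
proof (cases "even s")
  case True
  then show ?thesis using W_slope_odd[of "s div 2"] by auto
next
  case False
  then have "W_slope (Suc s) = q * W_slope (Suc (2 * (s div 2)))" by simp
  then show ?thesis using W_slope_odd[of "s div 2"] q0 by auto
qed

lemma W_irrational:
  assumes "\<alpha> i \<notin> \<rat>" shows "W r (Suc s) \<notin> \<rat>"
proof
  assume "W r (Suc s) \<in> \<rat>"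
  from Rats_diff[OF this W_rational_part[of r "Suc s"]]
  have "W_slope (Suc s) * \<alpha> i \<in> \<rat>" by (simp only: diff_diff_eq2 add_diff_cancel_left')
  then have "W_slope (Suc s) * \<alpha> i / W_slope (Suc s) \<in> \<rat>" by (intro Rats_divide W_slope_rational)
  then show False using assms W_slope_nonzero[of s] by simp
qed

text \<open>Two lines with the same integer data and different coefficients \<open>\<alpha> i\<close>
have the same initial points, so their sequences differ only by the terms with \<open>\<alpha>
i\<close>.\<close>

lemma W_diff:
  assumes "rational_line \<alpha>' i j k u v m n \<tau>"
  shows "W r s - rational_line.W \<alpha>' i u v m n r s = W_slope s * (\<alpha> i - \<alpha>' i)"
proof -
  interpret L': rational_line \<alpha>' i j k u v m n \<tau> by (rule assms)
  have drift: "drift t - L'.drift t = (if even t then \<alpha> i - \<alpha>' i else 0)" for t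
    by (simp add: drift_def L'.drift_def)
  show ?thesis
  proof (induction s)
    case (Suc s)
    have "W r (Suc s) - L'.W r (Suc s) = q * (W r s - L'.W r s) + (drift s - L'.drift s)"
      by (simp add: algebra_simps)
    then show ?case unfolding Suc drift by (simp add: algebra_simps)
  qed simp
qed

definition drift_bound :: real where "drift_bound = cmod (drift 0) + cmod (drift 1)"

lemma drift_le: "cmod (drift t) \<le> drift_bound"
  by (cases "even t") (simp_all add: drift_bound_def drift_def)

lemma drift_bound_nonneg: "0 \<le> drift_bound" by (simp add: drift_bound_def)

lemma W_Suc_ge: "cmod (W r (Suc t)) \<ge> \<bar>q_real\<bar> * cmod (W r t) - drift_bound"
  using norm_diff_ineq[of "q * W r t" "drift t"] drift_le[of t] by (simp add: norm_mult q_of_real)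

lemma W_0_ge: "cmod (W r 0) \<ge> \<bar>real_of_int r\<bar> - \<bar>real_of_int v\<bar>"
proof -
  have "\<bar>real_of_int r\<bar> \<le> \<bar>real_of_int n\<bar> * \<bar>real_of_int r\<bar>"
    using n0 by (intro mult_le_cancel_right1[THEN iffD2]) auto
  then have "\<bar>real_of_int r\<bar> \<le> \<bar>real_of_int (n * r)\<bar>" by (simp add: abs_mult)
  moreover have "cmod (W r 0) = \<bar>real_of_int v + real_of_int (n * r)\<bar>"
    by (simp flip: of_int_mult of_int_add)
  ultimately show ?thesis by linarith
qed

lemma initial_W_large: "\<exists>R. \<forall>r. R \<le> \<bar>real_of_int r\<bar> \<longrightarrow> (\<forall>t\<le>s. K \<le> cmod (W r t))"
proof (induction s arbitrary: K)
  case 0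
  show ?case
  proof (intro exI[of _ "K + \<bar>real_of_int v\<bar>"] allI impI)
    fix r and t :: nat assume "K + \<bar>real_of_int v\<bar> \<le> \<bar>real_of_int r\<bar>" "t \<le> 0"
    moreover from this have "t = 0" by simp
    ultimately show "K \<le> cmod (W r t)" using W_0_ge[of r] by (simp del: W.simps)
  qed
next
  case (Suc s)
  obtain R where R: "\<And>r t. R \<le> \<bar>real_of_int r\<bar> \<Longrightarrow> t \<le> s \<Longrightarrow> max K ((K + drift_bound) / \<bar>q_real\<bar>) \<le> cmod (W r t)"
    using Suc[of "max K ((K + drift_bound) / \<bar>q_real\<bar>)"] by blast
  have "K \<le> cmod (W r t)" if r: "R \<le> \<bar>real_of_int r\<bar>" and t: "t \<le> Suc s" for r t
  proof (cases "t \<le> s")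
    case True
    then show ?thesis using R[OF r] by simp
  next
    case False
    then have t: "t = Suc s" using t by simp
    have "(K + drift_bound) / \<bar>q_real\<bar> \<le> cmod (W r s)" using R[OF r, of s] by simp
    then have "K + drift_bound \<le> \<bar>q_real\<bar> * cmod (W r s)" using q_real_nonzero by (simp add: field_simps)
    then show ?thesis using W_Suc_ge[of r s] unfolding t by linarith
  qed
  then show ?case by blast
qed

lemma expanding_W_large:
  assumes q: "\<bar>q_real\<bar> > 1" shows "\<exists>R. \<forall>r. R \<le> \<bar>real_of_int r\<bar> \<longrightarrow> (\<forall>t. K \<le> cmod (W r t))"
proof -
  define K' where "K' = max K (drift_bound / (\<bar>q_real\<bar> - 1))"
  obtain R where R: "\<And>r. R \<le> \<bar>real_of_int r\<bar> \<Longrightarrow> K' \<le> cmod (W r 0)"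
    using initial_W_large[of 0 K'] by blast
  have "K' \<le> cmod (W r t)" if "R \<le> \<bar>real_of_int r\<bar>" for r t
  proof (induction t)
    case 0
    show ?case by (rule R[OF that])
  next
    case (Suc t)
    have "drift_bound / (\<bar>q_real\<bar> - 1) \<le> K'" by (simp add: K'_def)
    then have "drift_bound \<le> K' * (\<bar>q_real\<bar> - 1)" using q by (simp add: field_simps)
    moreover have "\<bar>q_real\<bar> * K' \<le> \<bar>q_real\<bar> * cmod (W r t)" using Suc by (intro mult_left_mono) auto
    ultimately show ?case using W_Suc_ge[of r t] by (simp add: algebra_simps del: W.simps)
  qed
  then show ?thesis unfolding K'_def by (metis max.boundedE)
qed

end

section \<open>No return from a rational line\<close>

text \<open>Every integer point of the surface has, possibly after one step, a coordinate of size at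
most \<open>C\<close>. So a path that is already in the escape region does not reach an integer
point by a further step.\<close>

definition near_fibre :: "(idx \<Rightarrow> complex) \<Rightarrow> complex \<Rightarrow> real \<Rightarrow> bool" where
  "near_fibre \<alpha> \<beta> C \<longleftrightarrow> (\<forall>y. cubic \<alpha> (emb y) = \<beta> \<longrightarrow> (\<exists>i j k. distinct3 i j k \<and>
     (cmod (emb y k) \<le> C \<or> cmod (\<alpha> k - emb y i * emb y j - emb y k) \<le> C)))"

text \<open>The integer point \<open>y\<close> would be reached in the escape region, so its
coordinates are larger than \<open>C\<close>, and it is the coordinate \<open>k\<close> of its
neighbour that is small. If \<open>k\<close> was the last move, then this neighbour is the point
\<open>p\<close> of the escape region, up to the difference of the coefficients. If it was not,
then the product of the other two coordinates is too large for the neighbour to be small. The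
path may use coefficients \<open>\<alpha>'\<close> that differ from the coefficients
\<open>\<alpha>\<close> of the surface, as they do after specialisation.\<close>

lemma escaped_not_integral:
  assumes near: "near_fibre \<alpha> \<beta> C" and K: "3 \<le> K" "\<And>l. C + cmod (\<alpha> l) + cmod (\<alpha>' l) < K" "0 \<le> C"
    and e: "escaped K l p" and l': "l' \<noteq> l" and y: "vieta \<alpha>' l' p = emb y" "cubic \<alpha> (emb y) = \<beta>"
  shows False
proof -
  have K': "cmod (\<alpha>' l) \<le> K" for l using K(2)[of l] K(3) norm_ge_zero[of "\<alpha> l"] by linarith
  have "escaped K l' (emb y)" using escaped_step[where \<alpha> = \<alpha>', OF K(1) K' e l'] y(1) by simp
  then have ge: "K \<le> cmod (emb y a)" and le: "cmod (emb y a) \<le> cmod (emb y l')" for a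
    by (auto simp: escaped_def)
  obtain i j k where d: "distinct3 i j k"
    and "cmod (emb y k) \<le> C \<or> cmod (\<alpha> k - emb y i * emb y j - emb y k) \<le> C"
    using near y(2) unfolding near_fibre_def by blast
  moreover have "\<not> cmod (emb y k) \<le> C" using ge[of k] K(2)[of k] norm_ge_zero[of "\<alpha> k"] norm_ge_zero[of "\<alpha>' k"] by linarith
  ultimately have small: "cmod (\<alpha> k - emb y i * emb y j - emb y k) \<le> C" by blast
  have dk: "distinct3 k i j" using d by (auto simp: distinct3_def)
  show False
  proof (cases "k = l'")
    case True
    have "p k = vieta \<alpha>' k (emb y) k" using y(1) True vieta_vieta[of \<alpha>' k p] by simp
    also have "\<dots> = (\<alpha> k - emb y i * emb y j - emb y k) - \<alpha> k + \<alpha>' k" by (simp add: vieta_distinct3[OF dk])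
    finally have pk: "p k = (\<alpha> k - emb y i * emb y j - emb y k) - \<alpha> k + \<alpha>' k" .
    have "cmod (p k) \<le> C + cmod (\<alpha> k) + cmod (\<alpha>' k)"
      unfolding pk using small norm_triangle_ineq[of "(\<alpha> k - emb y i * emb y j - emb y k) - \<alpha> k" "\<alpha>' k"]
        norm_triangle_ineq4[of "\<alpha> k - emb y i * emb y j - emb y k" "\<alpha> k"] by linarith
    moreover have "K \<le> cmod (p k)" using e by (simp add: escaped_def)
    ultimately show False using K(2)[of k] by linarith
  next
    case False
    then have "l' = i \<or> l' = j" using distinct3_cases[OF d, of l'] by auto
    then have prod: "K * cmod (emb y l') \<le> cmod (emb y i * emb y j)"
    proof
      assume "l' = i"
      have "K * cmod (emb y i) \<le> cmod (emb y j) * cmod (emb y i)" using ge[of j] by (intro mult_right_mono) auto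
      then show ?thesis by (simp add: norm_mult mult.commute \<open>l' = i\<close>)
    next
      assume "l' = j"
      have "K * cmod (emb y j) \<le> cmod (emb y i) * cmod (emb y j)" using ge[of i] by (intro mult_right_mono) auto
      then show ?thesis by (simp add: norm_mult \<open>l' = j\<close>)
    qed
    have "3 * cmod (emb y l') \<le> K * cmod (emb y l')" using K(1) by (intro mult_right_mono) auto
    moreover have "cmod (emb y i * emb y j) \<le> C + cmod (\<alpha> k) + cmod (emb y k)"
      using cmod_triangle3[of "emb y i * emb y j" "emb y k" "\<alpha> k"] small by linarith
    ultimately show False using prod le[of k] ge[of l'] K(2)[of k] norm_ge_zero[of "\<alpha>' k"] norm_ge_zero[of "emb y l'"] by linarith
  qed
qed

lemma escaped_never_integral:
  assumes near: "near_fibre \<alpha> \<beta> C" and K: "3 \<le> K" "\<And>l. C + cmod (\<alpha> l) + cmod (\<alpha>' l) < K" "0 \<le> C"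
    and e: "escaped K l p" and z: "distinct_adj (l # z)" "z \<noteq> []"
    and y: "act \<alpha>' z p = emb y" "cubic \<alpha> (emb y) = \<beta>"
  shows False
proof -
  have K': "cmod (\<alpha>' l) \<le> K" for l using K(2)[of l] K(3) norm_ge_zero[of "\<alpha> l"] by linarith
  obtain x l' where x: "z = x @ [l']" using z(2) by (metis append_butlast_last_id)
  have "distinct_adj ((l # x) @ [l'])" using z(1) by (simp add: x)
  then have adj: "distinct_adj (l # x)" "l' \<noteq> last (l # x)" by (auto simp only: distinct_adj_append_iff list.sel)
  from escaped_forever[OF K(1) K' e adj(1)]
  have "escaped K (last (l # x)) (act \<alpha>' x p)" .
  moreover have "vieta \<alpha>' l' (act \<alpha>' x p) = emb y" using y(1) by (simp add: x)
  ultimately show False using escaped_not_integral[OF near K _ adj(2) _ y(2)] by blast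
qed

context rational_line
begin

lemma cubic_point: "cubic \<alpha> (point r) = cubic \<alpha> (point 0)"
proof -
  have ne: "i \<noteq> j" "i \<noteq> k" "j \<noteq> k" using d by (auto simp: distinct3_def)
  define M N U V R :: complex where "M = of_int m" and "N = of_int n" and "U = of_int u" and "V = of_int v" and "R = of_int r"
  have MN: "M \<noteq> 0" "N \<noteq> 0" using m0 n0 by (simp_all add: M_def N_def)
  have t: "M\<^sup>2 + N\<^sup>2 + \<tau> * (M * N) = 0" using tau by (simp only: M_def N_def of_int_add of_int_mult of_int_power)
  have s: "M * N * (M * \<alpha> i + N * \<alpha> j) = (M\<^sup>2 - N\<^sup>2) * (N * U - M * V)"
    using slope by (simp only: M_def N_def U_def V_def of_int_mult of_int_diff of_int_power)
  define L where "L = 2 * U * M + 2 * V * N + \<tau> * (U * N + V * M) - \<alpha> i * M - \<alpha> j * N"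
  have "M * N * L = M * N * (2 * U * M + 2 * V * N) + (\<tau> * (M * N)) * (U * N + V * M) - M * N * (M * \<alpha> i + N * \<alpha> j)"
    by (simp add: L_def algebra_simps)
  also have "\<tau> * (M * N) = - (M\<^sup>2 + N\<^sup>2)" using minus_unique[OF t] by simp
  also have "M * N * (2 * U * M + 2 * V * N) + - (M\<^sup>2 + N\<^sup>2) * (U * N + V * M) - M * N * (M * \<alpha> i + N * \<alpha> j) = 0"
    unfolding s by (simp add: algebra_simps power2_eq_square)
  finally have "L = 0" using MN by simp
  have "cubic \<alpha> (point r) - cubic \<alpha> (point 0) = R\<^sup>2 * (M\<^sup>2 + N\<^sup>2 + \<tau> * (M * N)) + R * L"
    using ne unfolding cubic_distinct3[OF d] point_def L_def M_def N_def U_def V_def R_def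
    by (simp add: algebra_simps power2_eq_square)
  then show ?thesis unfolding t \<open>L = 0\<close> by simp
qed

definition offset :: rat where "offset = of_int ((m\<^sup>2 - n\<^sup>2) * (n * u - m * v)) / of_int (m * n\<^sup>2)"
definition ratio :: rat where "ratio = - (of_int m / of_int n)"
definition tau_rat :: rat where "tau_rat = - (of_int (m\<^sup>2 + n\<^sup>2) / of_int (m * n))"

text \<open>The condition on the coefficients of the line determines \<open>\<alpha> j\<close> as an
affine function of \<open>\<alpha> i\<close> over \<open>\<rat>\<close>.\<close>

lemma slope_iff: "of_int (m * n) * (of_int m * a + of_int n * b) = of_int ((m\<^sup>2 - n\<^sup>2) * (n * u - m * v))
    \<longleftrightarrow> b = of_rat offset + of_rat ratio * (a :: complex)"
proof -
  define S M N :: complex where "S = of_int ((m\<^sup>2 - n\<^sup>2) * (n * u - m * v))" and "M = of_int m" and "N = of_int n"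
  have MN: "M \<noteq> 0" "N \<noteq> 0" using m0 n0 by (simp_all add: M_def N_def)
  have off: "of_rat offset = S / (M * N\<^sup>2)" "of_rat ratio = - (M / N)"
    by (simp_all only: offset_def ratio_def of_rat_divide of_rat_of_int_eq S_def M_def N_def of_int_mult of_int_power of_rat_minus of_rat_mult of_rat_power)
  have "M * N * (M * a + N * b) = S \<longleftrightarrow> b = S / (M * N\<^sup>2) + - (M / N) * a"
    using MN by (auto simp: field_simps power2_eq_square)
  then show ?thesis unfolding off by (simp only: S_def M_def N_def of_int_mult)
qed

lemma alpha_j: "\<alpha> j = of_rat offset + of_rat ratio * \<alpha> i"
  using slope slope_iff by blast

lemma tau_of_rat: "\<tau> = of_rat tau_rat"
proof -
  have "\<tau> * of_int (m * n) = - of_int (m\<^sup>2 + n\<^sup>2)" using minus_unique[OF tau] by simp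
  then have "\<tau> = - of_int (m\<^sup>2 + n\<^sup>2) / of_int (m * n)" using m0 n0 by (simp add: eq_divide_eq)
  then show ?thesis by (simp only: tau_rat_def of_rat_divide of_rat_minus of_rat_of_int_eq minus_divide_left)
qed

text \<open>The coefficients of a line with the same integer data: \<open>\<alpha> i\<close> and
\<open>\<alpha> k\<close> are free.\<close>

definition respecialised :: "complex \<Rightarrow> complex \<Rightarrow> idx \<Rightarrow> complex" where
  "respecialised z c l = (if l = i then z else if l = j then of_rat offset + of_rat ratio * z else c)"

lemma rational_line_respecialised: "rational_line (respecialised z c) i j k u v m n \<tau>"
proof
  show "of_int (m * n) * (of_int m * respecialised z c i + of_int n * respecialised z c j) =
    of_int ((m\<^sup>2 - n\<^sup>2) * (n * u - m * v))"
    unfolding slope_iff using d by (auto simp: respecialised_def distinct3_def)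
qed (rule d m0 n0 tau)+

lemma alpha_eq_respecialised: "\<alpha> = respecialised (\<alpha> i) (\<alpha> k)"
  using alpha_j distinct3_cases[OF d] by (fastforce simp: respecialised_def fun_eq_iff)

text \<open>If \<open>\<alpha> k\<close> is rational, then all coefficients are polynomials in
\<open>\<alpha> i\<close> over \<open>\<rat>\<close>.\<close>

lemma transfer_one_variable:
  assumes k: "\<alpha> k = of_rat \<kappa>" and z: "\<And>f. eval_rat (\<alpha> i) f = 0 \<Longrightarrow> eval_rat z f = 0"
    and eq: "act \<alpha> w (point r) = emb y"
  shows "act (respecialised z (\<alpha> k)) w (point r) = emb y"
proof -
  define a where "a l = (if l = i then [:0, 1:] else if l = j then [:offset, ratio:] else [:\<kappa>:])" for l
  define x where "x l = (if l = i then of_int (u + m * r) else if l = j then of_int (v + n * r) else [:tau_rat:])" for l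
  note hom = ring_hom_eval_poly_at[OF ring_hom_of_rat]
  have a: "(\<lambda>l. eval_rat z' (a l)) = respecialised z' (\<alpha> k)" for z'
    by (auto simp: fun_eq_iff a_def respecialised_def eval_rat_pCons k mult.commute)
  have x: "(\<lambda>l. eval_rat z' (x l)) = point r" for z'
    by (auto simp: fun_eq_iff x_def point_def ring_hom_of_int[OF hom] eval_rat_pCons tau_of_rat[symmetric] simp del: of_int_add of_int_mult)
  show ?thesis
    using act_specialise[OF hom[of "\<alpha> i"] hom[of z] z, where a = a and w = w and x = x and y = y] eq
    unfolding a x alpha_eq_respecialised[symmetric] by blast
qed

lemma transfer_two_variables:
  assumes z: "\<And>F. eval_poly_at (eval_rat (\<alpha> i)) (\<alpha> k) F = 0 \<Longrightarrow> eval_poly_at (eval_rat z) c F = 0"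
    and eq: "act \<alpha> w (point r) = emb y"
  shows "act (respecialised z c) w (point r) = emb y"
proof -
  define a where "a l = (if l = i then [:[:0, 1:]:] else if l = j then [:[:offset, ratio:]:] else [:0, 1:])" for l
  define x where "x l = (if l = i then of_int (u + m * r) else if l = j then of_int (v + n * r) else [:[:tau_rat:]:])" for l
  note hom1 = ring_hom_eval_poly_at[OF ring_hom_of_rat]
  note hom = ring_hom_eval_poly_at[OF hom1]
  have a: "(\<lambda>l. eval_poly_at (eval_rat z') c' (a l)) = respecialised z' c'" for z' c'
    by (auto simp: fun_eq_iff a_def respecialised_def eval_rat_pCons eval_poly_at_pCons[OF hom1] ring_homD[OF hom1] mult.commute)
  have x: "(\<lambda>l. eval_poly_at (eval_rat z') c' (x l)) = point r" for z' c'
    by (auto simp: fun_eq_iff x_def point_def ring_hom_of_int[OF hom] eval_rat_pCons eval_poly_at_pCons[OF hom1] tau_of_rat[symmetric] simp del: of_int_add of_int_mult)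
  show ?thesis
    using act_specialise[OF hom[of "\<alpha> i" "\<alpha> k"] hom[of z c] z, where a = a and w = w and x = x and y = y] eq
    unfolding a x alpha_eq_respecialised[symmetric] by blast
qed

text \<open>If the last two values of \<open>W\<close> are large when the fibre is left by
\<open>k\<close>, then the path has escaped.\<close>

lemma fibre_escape:
  assumes L': "rational_line \<alpha>' i j k u v m n \<tau>"
    and near: "near_fibre \<alpha> \<beta> C" and K: "3 \<le> K" "\<And>l. C + cmod (\<alpha> l) + cmod (\<alpha>' l) < K" "0 \<le> C" "cmod \<tau> \<le> K"
    and w: "distinct_adj (alternating (Suc s) @ k # z)" "z \<noteq> []"
    and y: "act \<alpha>' (alternating (Suc s) @ k # z) (point r) = emb y" "cubic \<alpha> (emb y) = \<beta>"
    and large: "K \<le> cmod (rational_line.W \<alpha>' i u v m n r s)" "K \<le> cmod (rational_line.W \<alpha>' i u v m n r (Suc s))"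
  shows False
proof -
  interpret L': rational_line \<alpha>' i j k u v m n \<tau> by (rule L')
  have ne: "i \<noteq> j" "i \<noteq> k" "j \<noteq> k" using d by (auto simp: distinct3_def)
  have K': "cmod (\<alpha>' l) \<le> K" for l using K(2)[of l] K(3) norm_ge_zero[of "\<alpha> l"] by linarith
  let ?p = "act \<alpha>' (alternating (Suc s)) (point r)"
  have p: "?p = (\<lambda>l. if l = k then \<tau> else if (l = i) = odd (Suc s) then L'.W r (Suc s) else L'.W_prev r (Suc s))"
    by (rule L'.act_alternating)
  have "K \<le> cmod (?p i)" "K \<le> cmod (?p j)" "cmod (?p k) \<le> K"
    unfolding p using ne large K(4) by (auto simp: L'.W_prev_def simp del: L'.W.simps)
  from escaped_vieta[OF K(1) K' d this] have "escaped K k (vieta \<alpha>' k ?p)" .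
  moreover have "distinct_adj (k # z)" using w(1) by auto
  moreover have "act \<alpha>' z (vieta \<alpha>' k ?p) = emb y" using y(1) by simp
  ultimately show False using escaped_never_integral[OF near K(1-3) _ _ w(2) _ y(2)] by blast
qed

text \<open>The escape argument needs a step after \<open>k\<close>, so \<open>z\<close> is nonempty.
If \<open>k\<close> is the last step, then it leaves the other two coordinates as they are, and
the last value of \<open>W\<close> among them is irrational.\<close>

definition no_fibre_return :: "complex \<Rightarrow> int \<Rightarrow> bool" where
  "no_fibre_return \<beta> r \<longleftrightarrow> (\<forall>s z y. distinct_adj (alternating (Suc s) @ k # z) \<longrightarrow> z \<noteq> [] \<longrightarrow>
     act \<alpha> (alternating (Suc s) @ k # z) (point r) = emb y \<longrightarrow> cubic \<alpha> (emb y) \<noteq> \<beta>)"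

lemma exists_threshold:
  assumes "0 \<le> C"
  obtains K where "3 \<le> K" "\<And>l. C + cmod (\<alpha> l) + cmod (\<alpha>' l) < K" "cmod \<tau> \<le> K"
proof
  let ?K = "3 + C + (cmod (\<alpha> i) + cmod (\<alpha> j) + cmod (\<alpha> k)) + (cmod (\<alpha>' i) + cmod (\<alpha>' j) + cmod (\<alpha>' k)) + cmod \<tau>"
  note nn = norm_ge_zero[of "\<alpha> i"] norm_ge_zero[of "\<alpha> j"] norm_ge_zero[of "\<alpha> k"]
    norm_ge_zero[of "\<alpha>' i"] norm_ge_zero[of "\<alpha>' j"] norm_ge_zero[of "\<alpha>' k"] norm_ge_zero[of \<tau>]
  show "3 \<le> ?K" using assms nn by linarith
  show "cmod \<tau> \<le> ?K" using assms nn by linarith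
  show "C + cmod (\<alpha> l) + cmod (\<alpha>' l) < ?K" for l
    using distinct3_cases[OF d, of l] by (elim disjE; simp only:; use assms nn in linarith)
qed

lemma no_return_expanding:
  assumes near: "near_fibre \<alpha> \<beta> C" "0 \<le> C" and q: "\<bar>q_real\<bar> > 1"
  shows "\<exists>R. \<forall>r. R \<le> \<bar>real_of_int r\<bar> \<longrightarrow> no_fibre_return \<beta> r"
proof -
  obtain K where K: "3 \<le> K" "\<And>l. C + cmod (\<alpha> l) + cmod (\<alpha> l) < K" "cmod \<tau> \<le> K"
    using exists_threshold[OF near(2)] by metis
  obtain R where R: "\<And>r t. R \<le> \<bar>real_of_int r\<bar> \<Longrightarrow> K \<le> cmod (W r t)"
    using expanding_W_large[OF q, of K] by blast
  have "no_fibre_return \<beta> r" if "R \<le> \<bar>real_of_int r\<bar>" for r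
    unfolding no_fibre_return_def
    using fibre_escape[OF rational_line_axioms near(1) K(1,2) near(2) K(3) _ _ _ _ R[OF that] R[OF that]] by blast
  then show ?thesis by blast
qed

lemma W_slope_parabolic:
  assumes q: "\<bar>q_real\<bar> = 1" shows "real t \<le> 2 * cmod (W_slope t)"
proof -
  have qq: "q * q = 1"
  proof -
    have "q_real * q_real = 1" using q by (metis abs_mult_self_eq mult_1)
    then show ?thesis unfolding q_of_real by (simp flip: of_real_mult)
  qed
  have odd: "W_slope (Suc (2 * l)) = of_nat (Suc l)" for l
  proof (induction l)
    case (Suc l)
    have "W_slope (Suc (2 * Suc l)) = (q * q) * W_slope (Suc (2 * l)) + 1" by simp
    then show ?case unfolding Suc qq by simp
  qed simp
  show ?thesis
  proof (cases "even t")
    case True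
    show ?thesis
    proof (cases "t = 0")
      case False
      then obtain l where l: "t = Suc (Suc (2 * l))" using True by (metis even_Suc oddE not0_implies_Suc Suc_eq_plus1)
      have "W_slope t = q * of_nat (Suc l)" unfolding l using odd[of l] by simp
      then have "cmod (W_slope t) = real (Suc l)" using q by (simp only: norm_mult q_of_real norm_of_real norm_of_nat mult_1)
      then show ?thesis by (simp add: l)
    qed simp
  next
    case False
    then obtain l where l: "t = Suc (2 * l)" by (metis oddE Suc_eq_plus1)
    show ?thesis unfolding l odd norm_of_nat by simp
  qed
qed

text \<open>The difference of the sequences \<open>W\<close> for \<open>\<alpha> i\<close> and for
another number with the same equations is the difference of these two numbers times
\<open>W_slope\<close>, which grows linearly. From some length \<open>s0\<close> on, one of the
sequences is therefore large, and the path escapes in the original or in the specialised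
surface. For smaller lengths \<open>W\<close> is large because \<open>r\<close> is.\<close>

lemma no_return_parabolic:
  assumes near: "near_fibre \<alpha> \<beta> C" "0 \<le> C" and q: "\<bar>q_real\<bar> = 1" and irr: "\<alpha> i \<notin> \<rat>"
  shows "\<exists>R. \<forall>r. R \<le> \<bar>real_of_int r\<bar> \<longrightarrow> no_fibre_return \<beta> r"
proof -
  obtain z' where z': "z' \<noteq> \<alpha> i" "\<And>f. eval_rat (\<alpha> i) f = 0 \<longleftrightarrow> eval_rat z' f = 0"
    using conjugate_exists[OF irr] by blast
  obtain c' where c': "\<And>F. eval_poly_at (eval_rat (\<alpha> i)) (\<alpha> k) F = 0 \<Longrightarrow> eval_poly_at (eval_rat z') c' F = 0"
    using extend_specialisation[OF z'(2)] by blast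
  define \<alpha>' where "\<alpha>' = respecialised z' c'"
  have L': "rational_line \<alpha>' i j k u v m n \<tau>" unfolding \<alpha>'_def by (rule rational_line_respecialised)
  interpret L': rational_line \<alpha>' i j k u v m n \<tau> by (rule L')
  have \<alpha>'i: "\<alpha>' i = z'" by (simp add: \<alpha>'_def respecialised_def)
  obtain K1 where K1: "3 \<le> K1" "\<And>l. C + cmod (\<alpha> l) + cmod (\<alpha> l) < K1" "cmod \<tau> \<le> K1"
    using exists_threshold[OF near(2)] by metis
  obtain K2 where K2: "3 \<le> K2" "\<And>l. C + cmod (\<alpha> l) + cmod (\<alpha>' l) < K2" "cmod \<tau> \<le> K2"
    using exists_threshold[OF near(2)] by metis
  define K where "K = max K1 K2"
  have K: "3 \<le> K" "\<And>l. C + cmod (\<alpha> l) + cmod (\<alpha> l) < K" "\<And>l. C + cmod (\<alpha> l) + cmod (\<alpha>' l) < K" "cmod \<tau> \<le> K"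
    using K1 K2 unfolding K_def by (auto simp: less_max_iff_disj)
  (* With abs q = 1 a single step changes the size of W by at most the drift, so a value above
     K' is followed by one above K. *)
  define K' where "K' = K + drift_bound + L'.drift_bound"
  define \<theta> where "\<theta> = cmod (\<alpha> i - z')"
  have \<theta>: "\<theta> > 0" using z'(1) by (simp add: \<theta>_def)
  obtain s0 :: nat where s0: "4 * K' / \<theta> \<le> real s0" using real_arch_simple by blast
  obtain R where R: "\<And>r t. R \<le> \<bar>real_of_int r\<bar> \<Longrightarrow> t \<le> Suc s0 \<Longrightarrow> K \<le> cmod (W r t)"
    using initial_W_large[of "Suc s0" K] by blast
  have "no_fibre_return \<beta> r" if r: "R \<le> \<bar>real_of_int r\<bar>" for r
    unfolding no_fibre_return_def
  proof (intro allI impI notI)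
    fix s z y
    assume w: "distinct_adj (alternating (Suc s) @ k # z)" "z \<noteq> []"
      and y: "act \<alpha> (alternating (Suc s) @ k # z) (point r) = emb y" "cubic \<alpha> (emb y) = \<beta>"
    have y': "act \<alpha>' (alternating (Suc s) @ k # z) (point r) = emb y"
      unfolding \<alpha>'_def by (rule transfer_two_variables[OF c' y(1)])
    note esc = fibre_escape[OF rational_line_axioms near(1) K(1,2) near(2) K(4) w y]
    note esc' = fibre_escape[OF L' near(1) K(1,3) near(2) K(4) w y' y(2)]
    have next_large: "K \<le> cmod (W r (Suc s))" if "K' \<le> cmod (W r s)"
      using W_Suc_ge[of r s] that q L'.drift_bound_nonneg by (simp add: K'_def del: W.simps)
    have next_large': "K \<le> cmod (L'.W r (Suc s))" if "K' \<le> cmod (L'.W r s)"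
      using L'.W_Suc_ge[of r s] that q drift_bound_nonneg by (simp add: K'_def del: L'.W.simps)
    have KK': "K \<le> K'" using drift_bound_nonneg L'.drift_bound_nonneg by (simp add: K'_def)
    show False
    proof (cases "s < s0")
      case True
      then show False using esc R[OF r, of s] R[OF r, of "Suc s"] by simp
    next
      case False
      have "4 * K' \<le> real s0 * \<theta>" using s0 \<theta> by (simp add: field_simps)
      also have "\<dots> \<le> real s * \<theta>" using False \<theta> by (intro mult_right_mono) auto
      also have "\<dots> \<le> (2 * cmod (W_slope s)) * \<theta>" using W_slope_parabolic[OF q, of s] \<theta> by (intro mult_right_mono) auto
      also have "\<dots> = 2 * cmod (W r s - L'.W r s)"
        unfolding W_diff[OF L'] \<alpha>'i by (simp add: norm_mult \<theta>_def)
      also have "\<dots> \<le> 2 * (cmod (W r s) + cmod (L'.W r s))" using norm_triangle_ineq4[of "W r s" "L'.W r s"] by simp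
      finally have "K' \<le> cmod (W r s) \<or> K' \<le> cmod (L'.W r s)" by argo
      then show False
      proof
        assume *: "K' \<le> cmod (W r s)"
        then show False using esc next_large[OF *] KK' by linarith
      next
        assume *: "K' \<le> cmod (L'.W r s)"
        then show False using esc' next_large'[OF *] KK' by linarith
      qed
    qed
  qed
  then show ?thesis by blast
qed

lemma q_rational: "q \<in> \<rat>" by (simp add: q_def)

text \<open>Let \<open>p\<close> be a prime in the denominator of \<open>q\<close>, and specialise
\<open>\<alpha> i\<close> to two algebraic numbers whose difference is \<open>p\<close>-adically
bounded from below: to \<open>\<alpha> i\<close> itself and a conjugate, or to 0 and 1 if
\<open>\<alpha> i\<close> is transcendental. Both paths lead to integer points, so
\<open>bounded_between_bounded_points\<close> bounds all coordinates on them, and with them the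
difference of the two sequences \<open>W\<close>, by a fixed power of \<open>1/p\<close>. This
difference is \<open>W_slope\<close> times a constant and at least of the order of
\<open>(1/p)\<^sup>s\<close>. Hence the length of the alternating part is bounded, and for
bounded lengths \<open>W\<close> is large in the usual absolute value because \<open>r\<close>
is.\<close>

lemma no_return_contracting:
  assumes near: "near_fibre \<alpha> \<beta> C" "0 \<le> C" and q: "\<bar>q_real\<bar> < 1" and irr: "\<alpha> i \<notin> \<rat>" and k: "\<alpha> k \<in> \<rat>"
  shows "\<exists>R. \<forall>r. R \<le> \<bar>real_of_int r\<bar> \<longrightarrow> no_fibre_return \<beta> r"
proof -
  obtain \<kappa> where \<kappa>: "\<alpha> k = of_rat \<kappa>" using k by (elim Rats_cases)
  have "q \<notin> \<int>"
  proof
    assume "q \<in> \<int>"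
    then obtain c where "q = of_int c" by (elim Ints_cases)
    then have "complex_of_real q_real = complex_of_real (of_int c)" by (simp add: q_of_real)
    then have "q_real = of_int c" by (simp only: of_real_eq_iff)
    then show False using q q_real_nonzero by simp
  qed
  then obtain p B where p: "prime p" "valuation_ring B" "1 / of_nat p \<notin> B" and pq: "valuation_ring.vle B (1 / of_nat p) q"
    using nonintegral_rational_prime[OF q_rational] by metis
  interpret valuation_ring B by (rule p(2))
  define P :: complex where "P = 1 / of_nat p"
  have P1: "vle 1 (P ^ a)" for a unfolding P_def by (rule one_vle_p[OF p(1)])
  have P_not: "\<not> vle P 1" using p(3) by (simp add: vle_1_iff P_def)
  have P0: "P \<noteq> 0" using P_not by auto
  have P_le: "a \<le> b" if "vle (P ^ a) (P ^ b)" for a b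
  proof (rule ccontr)
    assume "\<not> a \<le> b"
    then obtain c where c: "a = Suc (b + c)" by (metis less_iff_Suc_add not_le)
    have "vle (P ^ Suc b) (P ^ a)" using p_power_mono[OF p(1), of "Suc b" a] c by (simp only: P_def)
    then have "vle (P * P ^ b) (1 * P ^ b)" using that vle_trans by auto
    then show False using vle_mult_cancel[of "P ^ b" P 1] P0 P_not by simp
  qed
  have "\<exists>z1 z2. z1 \<noteq> z2 \<and> algebraic z1 \<and> algebraic z2 \<and> p_bounded p (1 / (z1 - z2)) \<and>
     (\<forall>f. eval_rat (\<alpha> i) f = 0 \<longrightarrow> eval_rat z1 f = 0 \<and> eval_rat z2 f = 0)"
  proof (cases "\<exists>f. f \<noteq> 0 \<and> eval_rat (\<alpha> i) f = 0")
    case True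
    then obtain f where f: "f \<noteq> 0" "eval_rat (\<alpha> i) f = 0" by blast
    obtain z' where z': "z' \<noteq> \<alpha> i" "\<And>f. eval_rat (\<alpha> i) f = 0 \<longleftrightarrow> eval_rat z' f = 0"
      using conjugate_exists[OF irr] by blast
    have "p_bounded p (1 / (\<alpha> i - z'))"
      using conjugates_p_separated[OF p(1,3) f _ z'(1)] z'(2) by blast
    moreover have "algebraic (\<alpha> i)" "algebraic z'" using algebraic_eval_rat[OF f(1)] f(2) z'(2) by auto
    ultimately show ?thesis using z' by (intro exI[of _ "\<alpha> i"] exI[of _ z']) auto
  next
    case False
    have "p_bounded p (1 / (0 - 1))" using p_bounded_algebraic[OF p(1,3), of "- 1"] by simp
    moreover have "algebraic (1 :: complex)" by (intro rat_imp_algebraic) simp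
    moreover have "eval_rat 0 f = 0 \<and> eval_rat 1 f = 0" if "eval_rat (\<alpha> i) f = 0" for f
    proof -
      have "f = 0" using False that by blast
      then show ?thesis by simp
    qed
    moreover have "algebraic (0 :: complex)" "(0 :: complex) \<noteq> 1" by simp_all
    ultimately show ?thesis by blast
  qed
  then obtain z1 z2 where z: "z1 \<noteq> z2" "algebraic z1" "algebraic z2" "p_bounded p (1 / (z1 - z2))"
    and sp: "\<And>f. eval_rat (\<alpha> i) f = 0 \<Longrightarrow> eval_rat z1 f = 0" "\<And>f. eval_rat (\<alpha> i) f = 0 \<Longrightarrow> eval_rat z2 f = 0"
    by blast
  have tau_b: "p_bounded p \<tau>" unfolding tau_of_rat by (rule p_bounded_of_rat[OF p(1,3)])
  have int_b: "p_bounded p (of_int a)" for a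
    using p_bounded_mem[OF p(1)] subring_of_int[OF subring] by blast
  have resp_b: "p_bounded p (respecialised t (\<alpha> k) l)" if "algebraic t" for t l
    unfolding respecialised_def \<kappa>
    using p_bounded_of_rat[OF p(1,3)] p_bounded_algebraic[OF p(1,3) that]
    by (simp add: p_bounded_add[OF p(1)] p_bounded_mult[OF p(1)])
  have point_b: "p_bounded p (point r l)" for r l
    unfolding point_def using int_b tau_b by (simp del: of_int_add of_int_mult)
  have cubic_b: "p_bounded p (cubic (respecialised t (\<alpha> k)) (point 0))" if "algebraic t" for t
    unfolding cubic_def power2_eq_square
    by (intro p_bounded_diff[OF p(1)] p_bounded_add[OF p(1)] p_bounded_mult[OF p(1)] resp_b[OF that] point_b)
  have common: "\<exists>J. \<forall>x\<in>S. vle x (P ^ J)" if "finite S" "\<forall>x\<in>S. p_bounded p x" for S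
    using that
  proof (induction S rule: finite_induct)
    case (insert x S)
    then obtain J where J: "\<forall>x\<in>S. vle x (P ^ J)" by auto
    obtain J' where J': "vle x (P ^ J')" using insert.prems by (auto simp: p_bounded_def P_def)
    have "vle (P ^ J) (P ^ max J J')" "vle (P ^ J') (P ^ max J J')"
      using p_power_mono[OF p(1)] by (simp_all add: P_def)
    then have "\<forall>x\<in>insert x S. vle x (P ^ max J J')" using J J' vle_trans by blast
    then show ?case ..
  qed simp
  (* None of these numbers depends on r, because the value of the cubic is the same at all
     points of the line. This makes the bound on the length uniform in r. *)
  define S where "S = {\<tau>, cubic (respecialised z1 (\<alpha> k)) (point 0), cubic (respecialised z2 (\<alpha> k)) (point 0)}
    \<union> (\<lambda>l. respecialised z1 (\<alpha> k) l) ` {i, j, k} \<union> (\<lambda>l. respecialised z2 (\<alpha> k) l) ` {i, j, k}"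
  have "finite S" "\<forall>x\<in>S. p_bounded p x"
    using tau_b cubic_b[OF z(2)] cubic_b[OF z(3)] resp_b[OF z(2)] resp_b[OF z(3)] by (auto simp: S_def)
  from common[OF this] obtain J where J: "\<And>x. x \<in> S \<Longrightarrow> vle x (P ^ J)" by blast
  obtain J' where J': "vle (1 / (z1 - z2)) (P ^ J')" using z(4) by (auto simp: p_bounded_def P_def)
  have bounded: "vle (rational_line.W (respecialised t (\<alpha> k)) i u v m n r (Suc s)) (P ^ J)"
    if t: "t = z1 \<or> t = z2" and w: "distinct_adj (alternating (Suc s) @ k # x)"
      and y: "act \<alpha> (alternating (Suc s) @ k # x) (point r) = emb y" for t s x y r
  proof -
    let ?a = "respecialised t (\<alpha> k)"
    interpret L': rational_line ?a i j k u v m n \<tau> by (rule rational_line_respecialised)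
    have ne: "i \<noteq> j" "i \<noteq> k" "j \<noteq> k" using d by (auto simp: distinct3_def)
    have tr: "act ?a (alternating (Suc s) @ k # x) (point r) = emb y"
      using t transfer_one_variable[OF \<kappa> _ y] sp by blast
    have ints: "vle (of_int c) (P ^ J)" for c using vle_trans[OF vle_of_int P1] .
    have "vle (act ?a (alternating (Suc s)) (point r) l) (P ^ J)" for l
    proof (rule bounded_between_bounded_points[OF P1])
      show "vle (?a l) (P ^ J)" for l
        using t distinct3_cases[OF d, of l] by (intro J) (auto simp: S_def)
      show "vle (cubic ?a (point r)) (P ^ J)"
        unfolding L'.cubic_point[of r] using t by (intro J) (auto simp: S_def)
      show "vle (point r l) (P ^ J)" for l
        using ints J[of \<tau>] unfolding point_def by (simp add: S_def del: of_int_add of_int_mult)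
      show "distinct_adj (alternating (Suc s) @ k # x)" by (rule w)
      show "vle (act ?a (alternating (Suc s) @ k # x) (point r) l) (P ^ J)" for l
        unfolding tr emb_def by (rule ints)
    qed
    from this[of "if odd (Suc s) then i else j"] show ?thesis
      unfolding L'.act_alternating using ne by (auto simp del: L'.W.simps split: if_splits)
  qed
  (* The leading term q^s of the coefficient is not cancelled by the terms of lower degree in q. *)
  have W_slope_ge: "vle (P ^ s) (W_slope (Suc s))" for s
  proof -
    have "vle (q ^ s) (W_slope (Suc s))"
    proof (induction s)
      case (Suc s)
      have qs: "vle (q ^ Suc s) (q * W_slope (Suc s))" using vle_mult[OF vle_refl[of q] Suc] by simp
      have "vle P (q ^ Suc s)"
      proof -
        have "vle 1 q" using vle_trans[OF P1[of 1]] pq by (simp add: P_def)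
        from vle_mult[OF _ vle_power[OF this, of s], of P q] pq show ?thesis by (simp add: P_def)
      qed
      then have one: "vless 1 (q * W_slope (Suc s))" using P_not qs vle_trans by blast
      show ?case
      proof (cases "even (Suc s)")
        case True
        have "vle (q * W_slope (Suc s)) (q * W_slope (Suc s) + 1)"
        proof (rule ccontr)
          assume "\<not> ?thesis"
          from vless_diff[OF this one] show False by simp
        qed
        then show ?thesis using True vle_trans[OF qs] by (simp only: W_slope_simps) simp
      next
        case False
        then show ?thesis using qs by (simp only: W_slope_simps) simp
      qed
    qed simp
    moreover have "vle (P ^ s) (q ^ s)" using pq by (intro vle_power) (simp add: P_def)
    ultimately show ?thesis using vle_trans by blast
  qed
  have short: "s \<le> J + J'" if w: "distinct_adj (alternating (Suc s) @ k # x)"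
      and y: "act \<alpha> (alternating (Suc s) @ k # x) (point r) = emb y" for s x y r
  proof -
    let ?W1 = "rational_line.W (respecialised z1 (\<alpha> k)) i u v m n r (Suc s)"
    let ?W2 = "rational_line.W (respecialised z2 (\<alpha> k)) i u v m n r (Suc s)"
    interpret L': rational_line "respecialised z1 (\<alpha> k)" i j k u v m n \<tau> by (rule rational_line_respecialised)
    have "vle (?W1 - ?W2) (P ^ J)" by (intro vle_diff; rule bounded[OF _ w y]; blast)
    also have "?W1 - ?W2 = W_slope (Suc s) * (respecialised z1 (\<alpha> k) i - respecialised z2 (\<alpha> k) i)"
      by (rule L'.W_diff[OF rational_line_respecialised])
    also have "respecialised z1 (\<alpha> k) i - respecialised z2 (\<alpha> k) i = z1 - z2"
      by (simp add: respecialised_def)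
    finally have "vle (W_slope (Suc s) * (z1 - z2)) (P ^ J)" .
    from vle_mult[OF this J'] have "vle (W_slope (Suc s)) (P ^ (J + J'))"
      using z(1) by (simp add: power_add del: W_slope_simps)
    then show ?thesis using P_le vle_trans[OF W_slope_ge] by blast
  qed
  obtain K where K: "3 \<le> K" "\<And>l. C + cmod (\<alpha> l) + cmod (\<alpha> l) < K" "cmod \<tau> \<le> K"
    using exists_threshold[OF near(2)] by metis
  obtain R where R: "\<And>r t. R \<le> \<bar>real_of_int r\<bar> \<Longrightarrow> t \<le> Suc (J + J') \<Longrightarrow> K \<le> cmod (W r t)"
    using initial_W_large[of "Suc (J + J')" K] by blast
  have "no_fibre_return \<beta> r" if r: "R \<le> \<bar>real_of_int r\<bar>" for r
    unfolding no_fibre_return_def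
  proof (intro allI impI notI)
    fix s x y
    assume w: "distinct_adj (alternating (Suc s) @ k # x)" "x \<noteq> []"
      and y: "act \<alpha> (alternating (Suc s) @ k # x) (point r) = emb y" "cubic \<alpha> (emb y) = \<beta>"
    have "s \<le> J + J'" by (rule short[OF w(1) y(1)])
    then show False
      using fibre_escape[OF rational_line_axioms near(1) K(1,2) near(2) K(3) w y] R[OF r, of s] R[OF r, of "Suc s"] by simp
  qed
  then show ?thesis by blast
qed

text \<open>Words that never use \<open>k\<close>, or end with it, leave the irrational number
\<open>W r s\<close> among the coordinates.\<close>

lemma no_return_starting_with_i:
  assumes near: "near_fibre \<alpha> \<beta> C" "0 \<le> C" and irr: "\<alpha> i \<notin> \<rat>" and k: "\<alpha> k \<in> \<rat> \<or> \<bar>q_real\<bar> = 1"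
  shows "\<exists>R. \<forall>r w y. R \<le> \<bar>real_of_int r\<bar> \<longrightarrow> distinct_adj w \<longrightarrow> w \<noteq> [] \<longrightarrow> hd w = i \<longrightarrow>
    act \<alpha> w (point r) = emb y \<longrightarrow> cubic \<alpha> (emb y) \<noteq> \<beta>"
proof -
  have "\<exists>R. \<forall>r. R \<le> \<bar>real_of_int r\<bar> \<longrightarrow> no_fibre_return \<beta> r"
    using no_return_expanding[OF near] no_return_parabolic[OF near _ irr] no_return_contracting[OF near _ irr] k
    by (cases "\<bar>q_real\<bar>" "1 :: real" rule: linorder_cases) auto
  then obtain R where R: "\<And>r. R \<le> \<bar>real_of_int r\<bar> \<Longrightarrow> no_fibre_return \<beta> r" by blast
  have ne: "i \<noteq> j" "i \<noteq> k" "j \<noteq> k" using d by (auto simp: distinct3_def)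
  have "False" if r: "R \<le> \<bar>real_of_int r\<bar>" and w: "distinct_adj w" "w \<noteq> []" "hd w = i"
    and y: "act \<alpha> w (point r) = emb y" "cubic \<alpha> (emb y) = \<beta>" for r w y
  proof -
    obtain s x where sx: "s \<ge> 1" "w = alternating s @ x" "x = [] \<or> hd x = k"
      using alternating_prefix[OF w] by blast
    obtain t where t: "s = Suc t" using sx(1) by (cases s) auto
    let ?l = "if odd s then i else j"
    have Wl: "act \<alpha> (alternating s) (point r) ?l = W r s"
      unfolding act_alternating using ne by auto
    have irrW: "W r s \<notin> \<rat>" unfolding t by (rule W_irrational[OF irr])
    have emb_rat: "emb y l \<in> \<rat>" for l by (simp add: emb_def)
    show False
    proof (cases x)
      case Nil
      then have "emb y ?l = W r s" using Wl y(1) sx(2) by simp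
      then show False using irrW emb_rat by metis
    next
      case (Cons k' z)
      then have k': "k' = k" using sx(3) by simp
      show False
      proof (cases "z = []")
        case True
        then have "emb y = vieta \<alpha> k (act \<alpha> (alternating s) (point r))" using y(1) sx(2) Cons k' by simp
        moreover have "k \<noteq> ?l" using ne by simp
        ultimately have "emb y ?l = W r s" using Wl by simp
        then show False using irrW emb_rat by metis
      next
        case False
        then show False using R[OF r] w(1) y sx(2) Cons k' t unfolding no_fibre_return_def by blast
      qed
    qed
  qed
  then show ?thesis by blast
qed

end

section \<open>Rigid points\<close>

text \<open>The only integer points of the surface that are equivalent to \<open>p\<close> are at most
\<open>p\<close> itself and its neighbour in direction \<open>k\<close>.\<close>

definition rigid :: "(idx \<Rightarrow> complex) \<Rightarrow> complex \<Rightarrow> idx \<Rightarrow> (idx \<Rightarrow> complex) \<Rightarrow> bool" where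
  "rigid \<alpha> \<beta> k p \<longleftrightarrow> (\<forall>w y. distinct_adj w \<longrightarrow> act \<alpha> w p = emb y \<longrightarrow> cubic \<alpha> (emb y) = \<beta> \<longrightarrow> w = [] \<or> w = [k])"

lemma (in rational_line) rational_line_swap: "rational_line \<alpha> j i k v u n m \<tau>"
proof
  show "distinct3 j i k" using d by (auto simp: distinct3_def)
  show "of_int (n\<^sup>2 + m\<^sup>2) + \<tau> * of_int (n * m) = 0" using tau by (simp add: algebra_simps)
  have "of_int (n * m) * (of_int n * \<alpha> j + of_int m * \<alpha> i) = of_int ((m\<^sup>2 - n\<^sup>2) * (n * u - m * v))"
    using slope by (simp only: mult.commute add.commute)
  also have "(m\<^sup>2 - n\<^sup>2) * (n * u - m * v) = (n\<^sup>2 - m\<^sup>2) * (m * v - n * u)" by (simp add: algebra_simps)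
  finally show "of_int (n * m) * (of_int n * \<alpha> j + of_int m * \<alpha> i) = of_int ((n\<^sup>2 - m\<^sup>2) * (m * v - n * u))" .
qed (rule n0 m0)+

text \<open>Words that begin with \<open>i\<close> or \<open>j\<close> are excluded by the results of
the previous section for the line and for the line with \<open>i\<close> and \<open>j\<close>
exchanged. A longer word that begins with \<open>k\<close> escapes at once.\<close>

lemma (in rational_line) points_rigid:
  assumes near: "near_fibre \<alpha> \<beta> C" "0 \<le> C" and irr: "\<alpha> i \<notin> \<rat>" "\<alpha> j \<notin> \<rat>" and k: "\<alpha> k \<in> \<rat> \<or> \<bar>q_real\<bar> = 1"
  shows "\<exists>R. \<forall>r. R \<le> \<bar>real_of_int r\<bar> \<longrightarrow> rigid \<alpha> \<beta> k (point r)"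
proof -
  interpret S: rational_line \<alpha> j i k v u n m \<tau> by (rule rational_line_swap)
  have ne: "i \<noteq> j" "i \<noteq> k" "j \<noteq> k" using d by (auto simp: distinct3_def)
  have pt: "S.point r = point r" for r using ne by (auto simp: S.point_def point_def fun_eq_iff)
  have kS: "\<alpha> k \<in> \<rat> \<or> \<bar>S.q_real\<bar> = 1" using k m0 n0 by (auto simp: S.q_real_def q_real_def abs_divide)
  obtain R1 where R1: "\<And>r w y. R1 \<le> \<bar>real_of_int r\<bar> \<Longrightarrow> distinct_adj w \<Longrightarrow> w \<noteq> [] \<Longrightarrow> hd w = i \<Longrightarrow>
    act \<alpha> w (point r) = emb y \<Longrightarrow> cubic \<alpha> (emb y) \<noteq> \<beta>"
    using no_return_starting_with_i[OF near irr(1) k] by blast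
  obtain R2 where R2: "\<And>r w y. R2 \<le> \<bar>real_of_int r\<bar> \<Longrightarrow> distinct_adj w \<Longrightarrow> w \<noteq> [] \<Longrightarrow> hd w = j \<Longrightarrow>
    act \<alpha> w (point r) = emb y \<Longrightarrow> cubic \<alpha> (emb y) \<noteq> \<beta>"
    using S.no_return_starting_with_i[OF near irr(2) kS] unfolding pt by blast
  obtain K where K: "3 \<le> K" "\<And>l. C + cmod (\<alpha> l) + cmod (\<alpha> l) < K" "cmod \<tau> \<le> K"
    using exists_threshold[OF near(2)] by metis
  have K': "cmod (\<alpha> l) \<le> K" for l using K(2)[of l] near(2) norm_ge_zero[of "\<alpha> l"] by linarith
  define R where "R = max (max R1 R2) (K + \<bar>real_of_int u\<bar> + \<bar>real_of_int v\<bar>)"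
  have "rigid \<alpha> \<beta> k (point r)" if r: "R \<le> \<bar>real_of_int r\<bar>" for r
    unfolding rigid_def
  proof (intro allI impI)
    fix w y assume w: "distinct_adj w" and y: "act \<alpha> w (point r) = emb y" "cubic \<alpha> (emb y) = \<beta>"
    show "w = [] \<or> w = [k]"
    proof (rule ccontr)
      assume n: "\<not> ?thesis"
      then obtain l z where lz: "w = l # z" by (cases w) auto
      have r12: "R1 \<le> \<bar>real_of_int r\<bar>" "R2 \<le> \<bar>real_of_int r\<bar>" and rK: "K + \<bar>real_of_int u\<bar> + \<bar>real_of_int v\<bar> \<le> \<bar>real_of_int r\<bar>"
        using r by (simp_all add: R_def)
      consider "l = i" | "l = j" | "l = k" using distinct3_cases[OF d] by blast
      then show False
      proof cases
        case 1 then show False using R1[OF r12(1) w] y lz by simp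
      next
        case 2 then show False using R2[OF r12(2) w] y lz by simp
      next
        case 3
        then have z: "z \<noteq> []" "distinct_adj (k # z)" "act \<alpha> z (vieta \<alpha> k (point r)) = emb y"
          using n w y(1) lz by auto
        have "K \<le> cmod (point r j)" using W_0_ge[of r] rK ne by (simp add: point_def)
        moreover have "K \<le> cmod (point r i)" using S.W_0_ge[of r] rK by (simp add: point_def)
        moreover have "cmod (point r k) \<le> K" using K(3) ne by (auto simp: point_def)
        ultimately have "escaped K k (vieta \<alpha> k (point r))" by (intro escaped_vieta[OF K(1) K' d])
        then show False using escaped_never_integral[OF near(1) K(1,2) near(2) _ z(2,1,3) y(2)] by blast
      qed
    qed
  qed
  then show ?thesis by blast
qed

lemma uniform_threshold:
  fixes h :: "'x \<Rightarrow> int"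
  assumes "finite S" "\<And>s. s \<in> S \<Longrightarrow> \<exists>H. \<forall>x. H < h x \<longrightarrow> Q s x"
  shows "\<exists>H. \<forall>s\<in>S. \<forall>x. H < h x \<longrightarrow> Q s x"
  using assms
proof (induction S rule: finite_induct)
  case (insert s S)
  then obtain H H' where "\<forall>s\<in>S. \<forall>x. H < h x \<longrightarrow> Q s x" "\<forall>x. H' < h x \<longrightarrow> Q s x" by blast
  then show ?case by (intro exI[of _ "max H H'"]) auto
qed auto

definition fibre_point :: "idx \<Rightarrow> idx \<Rightarrow> complex \<Rightarrow> int \<times> int \<Rightarrow> idx \<Rightarrow> complex" where
  "fibre_point i j \<tau> e l = (if l = i then of_int (fst e) else if l = j then of_int (snd e) else \<tau>)"

text \<open>A prime divisor of \<open>m\<close> would divide \<open>n\<^sup>2\<close>.\<close>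

lemma coprime_sum_squares_dvd:
  fixes m n t :: int
  assumes "coprime m n" "m\<^sup>2 + n\<^sup>2 = t * (m * n)" shows "\<bar>m\<bar> = 1"
proof -
  have "n\<^sup>2 = m * (t * n - m)" using assms(2) by (simp add: algebra_simps power2_eq_square)
  then have "m dvd n\<^sup>2" by simp
  moreover have "coprime m (n\<^sup>2)" using assms(1) by simp
  ultimately have "is_unit m" using coprime_common_divisor[of m "n\<^sup>2" m] by simp
  then show ?thesis by simp
qed

text \<open>The candidates lie on a line with rational direction. If there are infinitely many of
them, then the equation of the surface, a quadratic equation on the line, holds identically, so
the line is a \<open>rational_line\<close>. If \<open>\<tau>\<close> is an integer, then
\<open>m\<^sup>2 + n\<^sup>2 = - \<tau> m n\<close> with coprime \<open>m\<close> and
\<open>n\<close> forces \<open>\<bar>q\<bar> = 1\<close>. If \<open>\<tau> - \<alpha> k\<close>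
is an integer, then \<open>\<alpha> k\<close> is rational because \<open>\<tau>\<close> is.
These are the cases in which no return is possible.\<close>

lemma fibre_line_rigid:
  assumes d: "distinct3 i j k" and near: "near_fibre \<alpha> \<beta> C" "0 \<le> C" and irr: "\<not> (\<alpha> i \<in> \<rat> \<and> \<alpha> j \<in> \<rat>)"
    and bi: "bi \<noteq> 0" and bj: "bj \<noteq> 0" and tau_mod: "\<tau> \<in> \<int> \<or> \<tau> - \<alpha> k \<in> \<int>"
  shows "\<exists>H. \<forall>e. H < \<bar>fst e\<bar> + \<bar>snd e\<bar> \<longrightarrow> bi * fst e + bj * snd e = c \<longrightarrow>
    cubic \<alpha> (fibre_point i j \<tau> e) = \<beta> \<longrightarrow> rigid \<alpha> \<beta> k (fibre_point i j \<tau> e)"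
proof -
  define S where "S = {e. bi * fst e + bj * snd e = c \<and> cubic \<alpha> (fibre_point i j \<tau> e) = \<beta>}"
  show ?thesis
  proof (cases "finite S")
    case True
    define H where "H = Max (insert 0 ((\<lambda>e. \<bar>fst e\<bar> + \<bar>snd e\<bar>) ` S))"
    have "\<bar>fst e\<bar> + \<bar>snd e\<bar> \<le> H" if "e \<in> S" for e
      unfolding H_def using True that by (intro Max_ge) auto
    then show ?thesis unfolding S_def by (intro exI[of _ H]) force
  next
    case False
    then have "S \<noteq> {}" by auto
    then obtain e0 where e0: "e0 \<in> S" by blast
    define u v where "u = fst e0" and "v = snd e0"
    define m n where "m = bj div gcd bi bj" and "n = - (bi div gcd bi bj)"
    have g: "gcd bi bj \<noteq> 0" using bi by simp
    have mg: "bj = m * gcd bi bj" and ng: "bi = - n * gcd bi bj" by (simp_all add: m_def n_def)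
    have cop: "coprime m n" unfolding m_def n_def
      using div_gcd_coprime[of bi bj] bi by (simp add: coprime_commute)
    have m0: "m \<noteq> 0" and n0: "n \<noteq> 0" using mg ng bi bj by auto
    have param: "\<exists>r. e = (u + m * r, v + n * r)" if e: "e \<in> S" for e
    proof -
      have "bi * (fst e - u) + bj * (snd e - v) = 0"
        using e e0 by (simp add: S_def u_def v_def algebra_simps)
      then have "gcd bi bj * (m * (snd e - v)) = gcd bi bj * (n * (fst e - u))"
        using mg ng by (metis (no_types, opaque_lifting) add.commute eq_neg_iff_add_eq_0 mult.assoc mult.commute mult_minus_left)
      then have eq: "m * (snd e - v) = n * (fst e - u)" using bi by simp
      then have "m dvd n * (fst e - u)" by (metis dvd_triv_left)
      then have "m dvd fst e - u" using cop by (simp add: coprime_dvd_mult_right_iff)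
      then obtain r where r: "fst e - u = m * r" by blast
      then have "m * (snd e - v) = m * (n * r)" using eq by (simp add: mult_ac)
      then have "snd e - v = n * r" using m0 by simp
      then have "e = (u + m * r, v + n * r)" using r by (cases e) simp
      then show ?thesis by blast
    qed
    define A L where "A = of_int (m\<^sup>2 + n\<^sup>2) + \<tau> * of_int (m * n)"
      and "L = of_int (2 * u * m + 2 * v * n) + \<tau> * of_int (u * n + v * m) - \<alpha> i * of_int m - \<alpha> j * of_int n"
    have ne: "i \<noteq> j" "i \<noteq> k" "j \<noteq> k" using d by (auto simp: distinct3_def)
    have quad: "of_int r * (of_int r * A + L) = 0" if "(u + m * r, v + n * r) \<in> S" for r
    proof -
      have "cubic \<alpha> (fibre_point i j \<tau> (u + m * r, v + n * r)) - cubic \<alpha> (fibre_point i j \<tau> (u, v)) = of_int r * (of_int r * A + L)"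
        using ne unfolding cubic_distinct3[OF d] fibre_point_def A_def L_def
        by (simp add: algebra_simps power2_eq_square)
      then show ?thesis using that e0 by (simp add: S_def u_def v_def)
    qed
    have ex: "\<exists>r. r \<notin> X \<and> (u + m * r, v + n * r) \<in> S" if X: "finite X" for X
    proof -
      have "\<not> S \<subseteq> (\<lambda>r. (u + m * r, v + n * r)) ` X" using False X finite_subset by blast
      then obtain e where e: "e \<in> S" "e \<notin> (\<lambda>r. (u + m * r, v + n * r)) ` X" by blast
      obtain r where "e = (u + m * r, v + n * r)" using param[OF e(1)] by blast
      with e show ?thesis by blast
    qed
    obtain r1 where r1: "r1 \<noteq> 0" "(u + m * r1, v + n * r1) \<in> S" using ex[of "{0}"] by auto
    obtain r2 where r2: "r2 \<noteq> 0" "r2 \<noteq> r1" "(u + m * r2, v + n * r2) \<in> S" using ex[of "{0, r1}"] by auto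
    have 1: "of_int r1 * A + L = 0" and 2: "of_int r2 * A + L = 0"
      using quad[OF r1(2)] quad[OF r2(3)] r1(1) r2(1) by simp_all
    have "(of_int r1 - of_int r2) * A = (of_int r1 * A + L) - (of_int r2 * A + L)" by (simp add: algebra_simps)
    also have "\<dots> = 0" unfolding 1 2 by simp
    finally have "(of_int r1 - of_int r2) * A = 0" .
    then have A0: "A = 0" using r2(2) by simp
    then have L0: "L = 0" using 1 by simp
    define M N U V :: complex where "M = of_int m" and "N = of_int n" and "U = of_int u" and "V = of_int v"
    have t: "M\<^sup>2 + N\<^sup>2 + \<tau> * (M * N) = 0" using A0 by (simp only: A_def M_def N_def of_int_add of_int_mult of_int_power)
    have Lc: "2 * U * M + 2 * V * N + \<tau> * (U * N + V * M) = M * \<alpha> i + N * \<alpha> j"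
      using L0 unfolding L_def M_def N_def U_def V_def by (simp add: algebra_simps)
    have "M * N * (M * \<alpha> i + N * \<alpha> j) = M * N * (2 * U * M + 2 * V * N) + (\<tau> * (M * N)) * (U * N + V * M)"
      unfolding Lc[symmetric] by (simp add: algebra_simps)
    also have "\<tau> * (M * N) = - (M\<^sup>2 + N\<^sup>2)" using minus_unique[OF t] by simp
    also have "M * N * (2 * U * M + 2 * V * N) + - (M\<^sup>2 + N\<^sup>2) * (U * N + V * M) = (M\<^sup>2 - N\<^sup>2) * (N * U - M * V)"
      by (simp add: algebra_simps power2_eq_square)
    finally have slope: "of_int (m * n) * (of_int m * \<alpha> i + of_int n * \<alpha> j) = of_int ((m\<^sup>2 - n\<^sup>2) * (n * u - m * v))"
      by (simp only: M_def N_def U_def V_def of_int_mult of_int_diff of_int_power)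
    interpret rational_line \<alpha> i j k u v m n \<tau>
      by unfold_locales (use d m0 n0 A0 slope in \<open>simp_all add: A_def\<close>)
    have ai: "\<alpha> i \<notin> \<rat>" and aj: "\<alpha> j \<notin> \<rat>"
    proof -
      have *: "\<alpha> j = of_rat offset + of_rat ratio * \<alpha> i" by (rule alpha_j)
      have r0: "of_rat ratio \<noteq> (0 :: complex)" using m0 n0 by (simp add: ratio_def)
      then have "\<alpha> i = (\<alpha> j - of_rat offset) / of_rat ratio" using * by simp
      then have "\<alpha> j \<in> \<rat> \<Longrightarrow> \<alpha> i \<in> \<rat>" by simp
      moreover have "\<alpha> i \<in> \<rat> \<Longrightarrow> \<alpha> j \<in> \<rat>" using * by simp
      ultimately show "\<alpha> i \<notin> \<rat>" "\<alpha> j \<notin> \<rat>" using irr by auto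
    qed
    have k: "\<alpha> k \<in> \<rat> \<or> \<bar>q_real\<bar> = 1"
      using tau_mod
    proof
      assume "\<tau> \<in> \<int>"
      then obtain t' where t': "\<tau> = of_int t'" by (elim Ints_cases)
      have "of_int (m\<^sup>2 + n\<^sup>2 + t' * (m * n)) = (0 :: complex)"
        using A0 unfolding A_def t' by (simp only: of_int_add of_int_mult)
      then have "m\<^sup>2 + n\<^sup>2 + t' * (m * n) = 0" by (simp only: of_int_eq_0_iff)
      then have e: "m\<^sup>2 + n\<^sup>2 = (- t') * (m * n)" by simp
      then have e': "n\<^sup>2 + m\<^sup>2 = (- t') * (n * m)" by (simp add: mult.commute add.commute)
      have "\<bar>m\<bar> = 1" using coprime_sum_squares_dvd[OF cop e] .
      moreover have "\<bar>n\<bar> = 1" using coprime_sum_squares_dvd[OF _ e'] cop by (simp add: coprime_commute)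
      ultimately have "\<bar>q_real\<bar> = 1" by (simp add: q_real_def abs_divide flip: of_int_abs)
      then show ?thesis ..
    next
      assume "\<tau> - \<alpha> k \<in> \<int>"
      then obtain t' where "\<tau> - \<alpha> k = of_int t'" by (elim Ints_cases)
      then have "\<alpha> k = \<tau> - of_int t'" by (simp add: algebra_simps)
      then have "\<alpha> k \<in> \<rat>" by (simp add: tau_of_rat)
      then show ?thesis ..
    qed
    obtain R where R: "\<And>r. R \<le> \<bar>real_of_int r\<bar> \<Longrightarrow> rigid \<alpha> \<beta> k (point r)"
      using points_rigid[OF near ai aj k] by blast
    define H where "H = \<bar>u\<bar> + \<bar>v\<bar> + (\<bar>m\<bar> + \<bar>n\<bar>) * \<lceil>\<bar>R\<bar>\<rceil>"
    have "rigid \<alpha> \<beta> k (fibre_point i j \<tau> e)" if e: "e \<in> S" "H < \<bar>fst e\<bar> + \<bar>snd e\<bar>" for e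
    proof -
      obtain r where r: "e = (u + m * r, v + n * r)" using param[OF e(1)] by blast
      have "R \<le> \<bar>real_of_int r\<bar>"
      proof (rule ccontr)
        assume "\<not> ?thesis"
        then have "\<bar>r\<bar> \<le> \<lceil>\<bar>R\<bar>\<rceil>" by linarith
        then have "(\<bar>m\<bar> + \<bar>n\<bar>) * \<bar>r\<bar> \<le> (\<bar>m\<bar> + \<bar>n\<bar>) * \<lceil>\<bar>R\<bar>\<rceil>" by (intro mult_left_mono) auto
        moreover have "\<bar>fst e\<bar> + \<bar>snd e\<bar> \<le> \<bar>u\<bar> + \<bar>v\<bar> + (\<bar>m\<bar> + \<bar>n\<bar>) * \<bar>r\<bar>"
          unfolding r fst_conv snd_conv distrib_right abs_mult[symmetric] by linarith
        ultimately show False using e(2) by (simp add: H_def)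
      qed
      moreover have "fibre_point i j \<tau> e = point r" by (simp add: r fun_eq_iff fibre_point_def point_def)
      ultimately show ?thesis using R by simp
    qed
    then show ?thesis unfolding S_def by blast
  qed
qed

section \<open>Integer points lie on a plane\<close>

text \<open>If \<open>z2\<close> lies in the span of 1 and \<open>z1\<close> over
\<open>\<rat>\<close>, then it has a nonzero component at \<open>z1\<close>; otherwise the
values at \<open>z1\<close> and \<open>z2\<close> can be prescribed independently.\<close>

lemma rational_functional:
  assumes "z1 \<notin> \<rat>" "z2 \<notin> (\<rat> :: complex set)"
  obtains \<phi> :: "complex \<Rightarrow> rat" where "\<And>x y. \<phi> (x + y) = \<phi> x + \<phi> y" "\<And>q x. \<phi> (of_rat q * x) = q * \<phi> x"
    "\<phi> 1 = 0" "\<phi> z1 \<noteq> 0" "\<phi> z2 \<noteq> 0"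
proof -
  interpret P: vector_space_pair "\<lambda>(q :: rat) (z :: complex). of_rat q * z" "(*) :: rat \<Rightarrow> rat \<Rightarrow> rat"
    by unfold_locales (simp_all add: algebra_simps of_rat_add of_rat_mult)
  have ext: "\<exists>g. (\<forall>x y. g (x + y) = g x + g y) \<and> (\<forall>q x. g (of_rat q * x) = q * g x) \<and> (\<forall>x\<in>S. g x = f x)"
    if S: "P.vs1.independent S" for S and f :: "complex \<Rightarrow> rat"
  proof -
    obtain g where "Vector_Spaces.linear (\<lambda>(q :: rat) (z :: complex). of_rat q * z) (*) g" "\<forall>x\<in>S. g x = f x"
      using P.linear_independent_extend[OF S, of f] by blast
    then show ?thesis
      by (intro exI[of _ g]) (simp add: P.linear_add P.linear_scale)
  qed
  have span1: "x \<in> P.vs1.span {1} \<longleftrightarrow> x \<in> \<rat>" for x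
    unfolding P.vs1.span_singleton by (auto simp: Rats_def)
  have one: "P.vs1.independent {1}" by (simp add: P.vs1.dependent_single)
  have z1: "P.vs1.independent {z1, 1}"
    using one span1[of z1] assms(1) P.vs1.independent_insert[of z1 "{1}"] by (auto split: if_splits)
  have span2: "x \<in> P.vs1.span {z1, 1} \<longleftrightarrow> (\<exists>c. x - of_rat c * z1 \<in> \<rat>)" for x
    using P.vs1.span_breakdown_eq[of x z1 "{1}"] by (simp only: span1)
  have ne: "z1 \<noteq> 1" "z2 \<noteq> 1" using assms by auto
  show thesis
  proof (cases "z2 \<in> P.vs1.span {z1, 1}")
    case True
    then obtain c where "z2 - of_rat c * z1 \<in> \<rat>" using span2 by blast
    then obtain b where b: "z2 - of_rat c * z1 = of_rat b" by (elim Rats_cases)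
    obtain g where g: "\<And>x y. g (x + y) = g x + g y" "\<And>q x. g (of_rat q * x) = q * g x"
      "\<forall>x\<in>{z1, 1}. g x = (if x = 1 then 0 else (1 :: rat))"
      using ext[OF z1, of "\<lambda>x. if x = 1 then 0 else 1"] by blast
    have g1: "g 1 = 0" "g z1 = 1" using g(3) ne by auto
    have "z2 = of_rat b * 1 + of_rat c * z1" using b by (simp add: algebra_simps)
    then have "g z2 = b * g 1 + c * g z1" by (simp only: g(1,2))
    then have gz2: "g z2 = c" using g1 by simp
    have "c \<noteq> 0"
    proof
      assume "c = 0"
      then have "z2 \<in> \<rat>" using b by simp
      then show False using assms(2) by simp
    qed
    then show thesis using that[of g] g(1,2) g1 gz2 by simp
  next
    case False
    then have "P.vs1.independent {z2, z1, 1}"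
      using z1 P.vs1.independent_insert[of z2 "{z1, 1}"] P.vs1.span_superset[of "{z1, 1}"] by (auto split: if_splits)
    then obtain g where g: "\<And>x y. g (x + y) = g x + g y" "\<And>q x. g (of_rat q * x) = q * g x"
      "\<forall>x\<in>{z2, z1, 1}. g x = (if x = 1 then 0 else (1 :: rat))"
      using ext[of "{z2, z1, 1}" "\<lambda>x. if x = 1 then 0 else 1"] by blast
    then show thesis using that[of g] ne by simp
  qed
qed

text \<open>The functional annihilates all terms of the equation with integer coefficients, and a
linear equation in the coordinates remains.\<close>

lemma integer_points_in_plane:
  assumes ij: "i \<noteq> j" and irr: "\<alpha> i \<notin> \<rat>" "\<alpha> j \<notin> \<rat>"
  obtains b c where "b i \<noteq> (0 :: int)" "b j \<noteq> 0"
    "\<And>y. cubic \<alpha> (emb y) = \<beta> \<Longrightarrow> b I1 * y I1 + b I2 * y I2 + b I3 * y I3 = c"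
proof -
  obtain \<phi> :: "complex \<Rightarrow> rat" where \<phi>: "\<And>x y. \<phi> (x + y) = \<phi> x + \<phi> y" "\<And>q x. \<phi> (of_rat q * x) = q * \<phi> x"
    "\<phi> 1 = 0" "\<phi> (\<alpha> i) \<noteq> 0" "\<phi> (\<alpha> j) \<noteq> 0"
    using rational_functional[OF irr] by blast
  have \<phi>_int: "\<phi> (of_int n * x) = of_int n * \<phi> x" for n x using \<phi>(2)[of "of_int n" x] by simp
  have \<phi>_0: "\<phi> (of_int n) = 0" for n using \<phi>_int[of n 1] \<phi>(3) by simp
  let ?S = "complex_of_rat ` {\<phi> \<beta>, \<phi> (\<alpha> I1), \<phi> (\<alpha> I2), \<phi> (\<alpha> I3)}"
  have "\<exists>N>0. \<forall>z\<in>?S. of_nat N * z \<in> \<int>" by (rule common_denominator) auto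
  then obtain N where N: "N > 0" "\<forall>z\<in>?S. of_nat N * z \<in> \<int>" by blast
  have int: "\<exists>n. of_nat N * r = rat_of_int n" if "complex_of_rat r \<in> ?S" for r
  proof -
    have "of_nat N * complex_of_rat r \<in> \<int>" using N(2) that by blast
    then obtain n where "of_nat N * complex_of_rat r = of_int n" by (elim Ints_cases)
    then have "complex_of_rat (of_nat N * r) = complex_of_rat (of_int n)" by (simp add: of_rat_mult)
    then have "of_nat N * r = of_int n" by (simp only: of_rat_eq_iff)
    then show ?thesis ..
  qed
  have "\<exists>n. of_nat N * \<phi> (\<alpha> l) = rat_of_int n" for l by (rule int) (cases l; simp)
  then obtain b where b: "\<And>l. of_nat N * \<phi> (\<alpha> l) = rat_of_int (b l)" by metis
  obtain c where c: "of_nat N * \<phi> \<beta> = rat_of_int c" using int[of "\<phi> \<beta>"] by auto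
  show thesis
  proof (rule that[of b "- c"])
    show "b i \<noteq> 0" "b j \<noteq> 0" using b[of i] b[of j] \<phi>(4,5) N(1) by auto
    fix y assume y: "cubic \<alpha> (emb y) = \<beta>"
    let ?n = "(y I1)\<^sup>2 + (y I2)\<^sup>2 + (y I3)\<^sup>2 + y I1 * y I2 * y I3"
    have "of_int ?n = \<beta> + of_int (y I1) * \<alpha> I1 + of_int (y I2) * \<alpha> I2 + of_int (y I3) * \<alpha> I3"
      using y by (simp add: cubic_def emb_def algebra_simps)
    then have "\<phi> (of_int ?n) = \<phi> \<beta> + of_int (y I1) * \<phi> (\<alpha> I1) + of_int (y I2) * \<phi> (\<alpha> I2) + of_int (y I3) * \<phi> (\<alpha> I3)"
      by (simp only: \<phi>(1) \<phi>_int)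
    then have "of_nat N * (\<phi> \<beta> + of_int (y I1) * \<phi> (\<alpha> I1) + of_int (y I2) * \<phi> (\<alpha> I2) + of_int (y I3) * \<phi> (\<alpha> I3)) = 0"
      unfolding \<phi>_0 by simp
    then have "of_nat N * \<phi> \<beta> + of_int (y I1) * (of_nat N * \<phi> (\<alpha> I1)) + of_int (y I2) * (of_nat N * \<phi> (\<alpha> I2))
        + of_int (y I3) * (of_nat N * \<phi> (\<alpha> I3)) = 0"
      by (simp add: algebra_simps)
    then have "rat_of_int (c + y I1 * b I1 + y I2 * b I2 + y I3 * b I3) = 0"
      unfolding b c by simp
    then have "c + y I1 * b I1 + y I2 * b I2 + y I3 * b I3 = 0" by (simp only: of_int_eq_0_iff)
    then show "b I1 * y I1 + b I2 * y I2 + b I3 * y I3 = - c" by (simp add: algebra_simps)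
  qed
qed

lemma sum_distinct3:
  fixes b y :: "idx \<Rightarrow> int"
  shows "distinct3 i j k \<Longrightarrow> b I1 * y I1 + b I2 * y I2 + b I3 * y I3 = b i * y i + b j * y j + b k * y k"
  unfolding distinct3_def by (cases i; cases j; cases k) auto

lemma cubic_terms_bound:
  assumes d: "distinct3 i j k" and p: "cubic \<alpha> p = \<beta>" and X: "1 \<le> X" "\<And>l. cmod (p l) \<le> X"
  shows "cmod (p i * p j * p k) \<le> (3 + cmod (\<alpha> i) + cmod (\<alpha> j) + cmod (\<alpha> k) + cmod \<beta>) * (X * X)"
proof -
  have e: "p i * p j * p k = \<beta> + \<alpha> i * p i + \<alpha> j * p j + \<alpha> k * p k - p i * p i - p j * p j - p k * p k"
    using p by (simp add: cubic_distinct3[OF d] power2_eq_square algebra_simps)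
  have XX: "X \<le> X * X" using X(1) by (simp add: mult_le_cancel_left1)
  have sq: "cmod (p l * p l) \<le> X * X" for l
    unfolding norm_mult using X(2)[of l] X(1) by (intro mult_mono) auto
  have al: "cmod (\<alpha> l * p l) \<le> cmod (\<alpha> l) * (X * X)" for l
    unfolding norm_mult using X(2)[of l] XX by (intro mult_left_mono) auto
  have be: "cmod \<beta> \<le> cmod \<beta> * (X * X)"
    using mult_left_mono[of 1 "X * X" "cmod \<beta>"] XX X(1) by simp
  have "cmod (p i * p j * p k) \<le> cmod \<beta> + cmod (\<alpha> i * p i) + cmod (\<alpha> j * p j) + cmod (\<alpha> k * p k)
      + cmod (p i * p i) + cmod (p j * p j) + cmod (p k * p k)"
    unfolding e by (intro order_trans[OF norm_triangle_ineq4] add_mono order_trans[OF norm_triangle_ineq] order_refl)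
  also have "\<dots> \<le> cmod \<beta> * (X * X) + cmod (\<alpha> i) * (X * X) + cmod (\<alpha> j) * (X * X) + cmod (\<alpha> k) * (X * X) + X * X + X * X + X * X"
    using sq al be by (intro add_mono)
  also have "\<dots> = (3 + cmod (\<alpha> i) + cmod (\<alpha> j) + cmod (\<alpha> k) + cmod \<beta>) * (X * X)" by (simp add: algebra_simps)
  finally show ?thesis .
qed

lemma le_abs_int_mult:
  fixes a :: int and X :: real
  assumes "a \<noteq> 0" "0 \<le> X" shows "X \<le> \<bar>real_of_int a\<bar> * X"
proof -
  have "1 \<le> \<bar>real_of_int a\<bar>" using assms(1) by linarith
  from mult_right_mono[OF this assms(2)] show ?thesis by simp
qed

text \<open>Order the coordinates by size as \<open>\<bar>x\<bar> \<ge> \<bar>y\<bar> \<ge>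
\<bar>z\<bar>\<close>. The equation of the plane gives \<open>x = O(y)\<close>, and the equation
of the surface gives \<open>x y z = O(x\<^sup>2)\<close>. Hence \<open>z = O(1)\<close>.\<close>

lemma plane_all_coefficients:
  assumes plane: "\<And>y. cubic \<alpha> (emb y) = \<beta> \<Longrightarrow> b I1 * y I1 + b I2 * y I2 + b I3 * y I3 = c"
    and b: "\<And>l. b l \<noteq> (0 :: int)"
  obtains C where "0 \<le> C" "\<And>y. cubic \<alpha> (emb y) = \<beta> \<Longrightarrow> \<exists>i j k. distinct3 i j k \<and> cmod (emb y k) \<le> C"
proof -
  define G where "G = 3 + cmod (\<alpha> I1) + cmod (\<alpha> I2) + cmod (\<alpha> I3) + cmod \<beta>"
  define M where "M = 1 + \<bar>real_of_int c\<bar> + \<bar>real_of_int (b I1)\<bar> + \<bar>real_of_int (b I2)\<bar> + \<bar>real_of_int (b I3)\<bar>"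
  have G: "1 \<le> G"
    using norm_ge_zero[of "\<alpha> I1"] norm_ge_zero[of "\<alpha> I2"] norm_ge_zero[of "\<alpha> I3"] norm_ge_zero[of \<beta>] unfolding G_def by linarith
  have M: "1 \<le> M" "\<bar>real_of_int c\<bar> \<le> M" "\<bar>real_of_int (b l)\<bar> \<le> M" for l
    by (cases l; simp add: M_def)+
  show thesis
  proof (rule that[of "3 * G * M"])
    show "0 \<le> 3 * G * M" using G M(1) by simp
    fix y assume y: "cubic \<alpha> (emb y) = \<beta>"
    have "\<exists>i j k. distinct3 i j k \<and> \<bar>y k\<bar> \<le> \<bar>y j\<bar> \<and> \<bar>y j\<bar> \<le> \<bar>y i\<bar>"
    proof -
      have D: "distinct3 I1 I2 I3" "distinct3 I1 I3 I2" "distinct3 I2 I1 I3" "distinct3 I2 I3 I1"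
        "distinct3 I3 I1 I2" "distinct3 I3 I2 I1" by (simp_all add: distinct3_def)
      consider "\<bar>y I3\<bar> \<le> \<bar>y I2\<bar> \<and> \<bar>y I2\<bar> \<le> \<bar>y I1\<bar>" | "\<bar>y I2\<bar> \<le> \<bar>y I3\<bar> \<and> \<bar>y I3\<bar> \<le> \<bar>y I1\<bar>"
        | "\<bar>y I3\<bar> \<le> \<bar>y I1\<bar> \<and> \<bar>y I1\<bar> \<le> \<bar>y I2\<bar>" | "\<bar>y I1\<bar> \<le> \<bar>y I3\<bar> \<and> \<bar>y I3\<bar> \<le> \<bar>y I2\<bar>"
        | "\<bar>y I2\<bar> \<le> \<bar>y I1\<bar> \<and> \<bar>y I1\<bar> \<le> \<bar>y I3\<bar>" | "\<bar>y I1\<bar> \<le> \<bar>y I2\<bar> \<and> \<bar>y I2\<bar> \<le> \<bar>y I3\<bar>"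
        by linarith
      then show ?thesis using D by cases blast+
    qed
    then obtain i j k where d: "distinct3 i j k" and le: "\<bar>y k\<bar> \<le> \<bar>y j\<bar>" "\<bar>y j\<bar> \<le> \<bar>y i\<bar>" by blast
    define X Y Z where "X = \<bar>real_of_int (y i)\<bar>" and "Y = \<bar>real_of_int (y j)\<bar>" and "Z = \<bar>real_of_int (y k)\<bar>"
    have ZY: "Z \<le> Y" and YX: "Y \<le> X" using le by (simp_all add: X_def Y_def Z_def)
    have "Z \<le> 3 * G * M"
    proof (cases "y j = 0")
      case True
      then have "Z = 0" using ZY by (simp add: Y_def Z_def)
      then show ?thesis using G M(1) by simp
    next
      case False
      then have Y1: "1 \<le> Y" by (simp add: Y_def)
      have eq: "b i * y i + b j * y j + b k * y k = c" using plane[OF y] by (simp only: sum_distinct3[OF d])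
      have "X \<le> \<bar>real_of_int (b i)\<bar> * X" by (rule le_abs_int_mult) (simp_all add: b X_def)
      also have "\<dots> = \<bar>real_of_int (b i * y i)\<bar>" by (simp add: X_def abs_mult)
      also have "b i * y i = c - b j * y j - b k * y k" using eq by simp
      also have "\<bar>real_of_int (c - b j * y j - b k * y k)\<bar> \<le> \<bar>real_of_int c\<bar> + \<bar>real_of_int (b j * y j)\<bar> + \<bar>real_of_int (b k * y k)\<bar>"
        unfolding of_int_diff by linarith
      also have "\<dots> = \<bar>real_of_int c\<bar> + \<bar>real_of_int (b j)\<bar> * Y + \<bar>real_of_int (b k)\<bar> * Z"
        by (simp add: Y_def Z_def abs_mult)
      also have "\<dots> \<le> M * Y + M * Y + M * Y"
      proof (intro add_mono)
        show "\<bar>real_of_int c\<bar> \<le> M * Y" using M(1,2) Y1 by (metis mult.right_neutral mult_mono abs_ge_zero order_trans zero_le_one)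
        show "\<bar>real_of_int (b j)\<bar> * Y \<le> M * Y" using M(3) Y1 by (intro mult_right_mono) auto
        show "\<bar>real_of_int (b k)\<bar> * Z \<le> M * Y" using M(1,3) ZY by (intro mult_mono) (auto simp: Z_def)
      qed
      finally have XY: "X \<le> 3 * M * Y" by simp
      have X1: "1 \<le> X" using Y1 YX by linarith
      have "cmod (emb y l) \<le> X" for l
        using distinct3_cases[OF d, of l] ZY YX by (auto simp: emb_def X_def Y_def Z_def)
      from cubic_terms_bound[of I1 I2 I3, OF _ y X1 this]
      have "cmod (emb y I1 * emb y I2 * emb y I3) \<le> G * (X * X)" by (simp add: G_def distinct3_def)
      moreover have "cmod (emb y I1 * emb y I2 * emb y I3) = X * (Y * Z)"
        using d unfolding distinct3_def X_def Y_def Z_def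
        by (cases i; cases j; cases k) (simp_all add: emb_def norm_mult)
      ultimately have "X * (Y * Z) \<le> X * (G * X)" by (simp add: mult_ac)
      then have "Y * Z \<le> G * X" using X1 by (simp add: mult_le_cancel_left)
      also have "\<dots> \<le> G * (3 * M * Y)" using XY G by (intro mult_left_mono) auto
      finally have "Y * Z \<le> Y * (3 * G * M)" by (simp add: mult_ac)
      then show ?thesis using Y1 by (simp add: mult_le_cancel_left)
    qed
    then show "\<exists>i j k. distinct3 i j k \<and> cmod (emb y k) \<le> 3 * G * M"
      using d by (intro exI[of _ i] exI[of _ j] exI[of _ k]) (simp add: Z_def emb_def)
  qed
qed

text \<open>Here the coordinate \<open>k\<close> is not restricted by the plane, but
\<open>x\<^sub>i\<close> and \<open>x\<^sub>j\<close> are of the same order. The numbers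
\<open>z = x\<^sub>k\<close> and \<open>z' = \<alpha>\<^sub>k - x\<^sub>i x\<^sub>j -
x\<^sub>k\<close> are the roots of a quadratic equation, and their product is \<open>O(1 +
x\<^sub>i\<^sup>2 + x\<^sub>j\<^sup>2)\<close>, which is \<open>O(1 + \<bar>x\<^sub>i
x\<^sub>j\<bar>)\<close>. As \<open>x\<^sub>i x\<^sub>j\<close> is, up to a constant, the
negative of their sum, one of them is bounded.\<close>

lemma plane_two_coefficients:
  assumes d: "distinct3 i j k"
    and plane: "\<And>y. cubic \<alpha> (emb y) = \<beta> \<Longrightarrow> b i * y i + b j * y j = (c :: int)" and b: "b i \<noteq> 0" "b j \<noteq> 0"
  obtains C where "0 \<le> C" "\<And>y. cubic \<alpha> (emb y) = \<beta> \<Longrightarrow>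
    cmod (emb y k) \<le> C \<or> cmod (\<alpha> k - emb y i * emb y j - emb y k) \<le> C"
proof -
  define M where "M = 1 + \<bar>real_of_int c\<bar> + \<bar>real_of_int (b i)\<bar> + \<bar>real_of_int (b j)\<bar>"
  have M: "1 \<le> M" "\<bar>real_of_int c\<bar> \<le> M" "\<bar>real_of_int (b i)\<bar> \<le> M" "\<bar>real_of_int (b j)\<bar> \<le> M" by (simp_all add: M_def)
  define G where "G = 2 + cmod (\<alpha> i) + cmod (\<alpha> j) + cmod \<beta>"
  have G: "1 \<le> G" using norm_ge_zero[of "\<alpha> i"] norm_ge_zero[of "\<alpha> j"] norm_ge_zero[of \<beta>] unfolding G_def by linarith
  define H where "H = 4 * G * (M * M)"
  have H: "0 \<le> H" using G M(1) by (simp add: H_def)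
  define C where "C = 1 + 3 * H + H * cmod (\<alpha> k)"
  have C: "1 \<le> C" using H by (simp add: C_def)
  have side: "X \<le> M * (1 + Y)" if "\<bar>real_of_int a\<bar> \<le> M" "a' \<noteq> 0" "a' * x + a * x' = c"
    "X = \<bar>real_of_int x\<bar>" "Y = \<bar>real_of_int x'\<bar>" for a a' x x' :: int and X Y
  proof -
    have "X \<le> \<bar>real_of_int a'\<bar> * X" by (rule le_abs_int_mult) (simp_all add: that)
    also have "\<dots> = \<bar>real_of_int (a' * x)\<bar>" by (simp add: that abs_mult)
    also have "a' * x = c - a * x'" using that(3) by simp
    also have "\<bar>real_of_int (c - a * x')\<bar> \<le> \<bar>real_of_int c\<bar> + \<bar>real_of_int (a * x')\<bar>" unfolding of_int_diff by linarith
    also have "\<dots> \<le> M + M * Y"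
      using M(2) mult_right_mono[OF that(1), of Y] by (simp add: that abs_mult)
    finally show ?thesis by (simp add: distrib_left)
  qed
  show thesis
  proof (rule that[of C])
    show "0 \<le> C" using C by simp
    fix y assume y: "cubic \<alpha> (emb y) = \<beta>"
    define X Y where "X = \<bar>real_of_int (y i)\<bar>" and "Y = \<bar>real_of_int (y j)\<bar>"
    have XY0: "0 \<le> X" "0 \<le> Y" by (simp_all add: X_def Y_def)
    have XM: "X \<le> M * (1 + Y)" by (rule side[OF M(4) b(1) plane[OF y] X_def Y_def])
    have YM: "Y \<le> M * (1 + X)"
      by (rule side[OF M(3) b(2) _ Y_def X_def]) (use plane[OF y] in simp)
    define z z' where "z = emb y k" and "z' = \<alpha> k - emb y i * emb y j - emb y k"
    have "z * z' = emb y i * emb y i + emb y j * emb y j - \<alpha> i * emb y i - \<alpha> j * emb y j - \<beta>"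
      using y by (simp add: cubic_distinct3[OF d] z_def z'_def power2_eq_square algebra_simps)
    moreover have "cmod (a1 + a2 - a3 - a4 - a5) \<le> cmod a1 + cmod a2 + cmod a3 + cmod a4 + cmod a5" for a1 a2 a3 a4 a5
      using norm_triangle_ineq[of a1 a2] norm_triangle_ineq4[of "a1 + a2" a3]
        norm_triangle_ineq4[of "a1 + a2 - a3" a4] norm_triangle_ineq4[of "a1 + a2 - a3 - a4" a5] by linarith
    ultimately have "cmod (z * z') \<le> cmod (emb y i * emb y i) + cmod (emb y j * emb y j) + cmod (\<alpha> i * emb y i) + cmod (\<alpha> j * emb y j) + cmod \<beta>"
      by (simp only:)
    then have zz: "cmod z * cmod z' \<le> X * X + Y * Y + cmod (\<alpha> i) * X + cmod (\<alpha> j) * Y + cmod \<beta>"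
      by (simp add: norm_mult emb_def X_def Y_def)
    define V where "V = max 1 (max X Y)"
    have V1: "1 \<le> V" "X \<le> V" "Y \<le> V" by (auto simp: V_def)
    moreover have "V \<le> V * V" using mult_left_mono[OF V1(1), of V] V1(1) by simp
    ultimately have V: "1 \<le> V" "X \<le> V" "Y \<le> V" "V \<le> V * V" by blast+
    have "X * X + Y * Y + cmod (\<alpha> i) * X + cmod (\<alpha> j) * Y + cmod \<beta> \<le>
        V * V + V * V + cmod (\<alpha> i) * (V * V) + cmod (\<alpha> j) * (V * V) + cmod \<beta> * (V * V)"
    proof (intro add_mono mult_mono order_refl)
      show "X \<le> V * V" "Y \<le> V * V" using V by linarith+
      have "1 \<le> V * V" using V by linarith
      then have "cmod \<beta> * 1 \<le> cmod \<beta> * (V * V)" by (intro mult_left_mono) auto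
      then show "cmod \<beta> \<le> cmod \<beta> * (V * V)" by simp
    qed (use V XY0 in auto)
    also have "\<dots> = G * (V * V)" by (simp add: G_def algebra_simps)
    finally have zV: "cmod z * cmod z' \<le> G * (V * V)" using zz by linarith
    have VV: "V * V \<le> 4 * (M * M) * (1 + X * Y)"
    proof (cases "y i = 0 \<or> y j = 0")
      case True
      then have "X = 0 \<or> Y = 0" by (auto simp: X_def Y_def)
      then have "V \<le> M" "X * Y = 0" using XM YM M(1) by (auto simp: V_def)
      moreover from this have "V * V \<le> M * M" using V by (intro mult_mono) auto
      moreover have "0 \<le> M * M" by simp
      ultimately have "V * V \<le> 4 * (M * M)" by linarith
      then show ?thesis unfolding \<open>X * Y = 0\<close> by simp
    next
      case False
      then have "1 \<le> \<bar>y i\<bar>" "1 \<le> \<bar>y j\<bar>" by linarith+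
      then have one: "1 \<le> X" "1 \<le> Y" unfolding X_def Y_def by linarith+
      then have "M * (1 + Y) \<le> M * (2 * Y)" "M * (1 + X) \<le> M * (2 * X)" using M(1) by (auto intro!: mult_left_mono)
      then have XM': "X \<le> 2 * M * Y" and YM': "Y \<le> 2 * M * X" using XM YM by (simp_all add: mult_ac)
      have MM: "M \<le> M * M" using M(1) by (simp add: mult_le_cancel_left1)
      have "2 * M \<le> 4 * (M * M)" using MM M(1) by linarith
      then have double: "2 * M * (X * Y) \<le> 4 * (M * M) * (X * Y)" using XY0 by (intro mult_right_mono) auto
      have "X * X \<le> (2 * M * Y) * X" using XM' XY0 by (intro mult_right_mono) auto
      then have XX: "X * X \<le> 4 * (M * M) * (X * Y)" using double by (simp add: mult_ac)
      have "Y * Y \<le> (2 * M * X) * Y" using YM' XY0 by (intro mult_right_mono) auto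
      then have YY: "Y * Y \<le> 4 * (M * M) * (X * Y)" using double by (simp add: mult_ac)
      have "1 \<le> 4 * (M * M)" using MM M(1) by linarith
      moreover have "0 \<le> 4 * (M * M) * (X * Y)" using XY0 M(1) by simp
      moreover have "V * V = 1 \<or> V * V = X * X \<or> V * V = Y * Y" by (auto simp: V_def max_def)
      ultimately have "V * V \<le> 4 * (M * M) + 4 * (M * M) * (X * Y)" using XX YY by linarith
      then show ?thesis by (simp add: distrib_left)
    qed
    have "G * (V * V) \<le> G * (4 * (M * M) * (1 + X * Y))" using VV G by (intro mult_left_mono) auto
    then have zH: "cmod z * cmod z' \<le> H * (1 + X * Y)" using zV by (simp add: H_def mult_ac)
    have "X * Y = cmod (emb y i * emb y j)" by (simp add: X_def Y_def emb_def norm_mult)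
    also have "emb y i * emb y j = \<alpha> k - z - z'" by (simp add: z_def z'_def)
    also have "cmod (\<alpha> k - z - z') \<le> cmod (\<alpha> k) + cmod z + cmod z'"
      using norm_triangle_ineq4[of "\<alpha> k - z" z'] norm_triangle_ineq4[of "\<alpha> k" z] by linarith
    finally have "H * (1 + X * Y) \<le> H * (1 + (cmod (\<alpha> k) + cmod z + cmod z'))" using H by (intro mult_left_mono) auto
    with zH have zH': "cmod z * cmod z' \<le> H * (1 + cmod (\<alpha> k) + cmod z + cmod z')" by (simp add: add.assoc)
    have small: "s \<le> C" if "s * t \<le> H * (1 + cmod (\<alpha> k) + s + t)" "s \<le> t" "1 \<le> t" for s t
    proof -
      have "H * (1 + cmod (\<alpha> k) + s + t) \<le> H * ((3 + cmod (\<alpha> k)) * t)"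
      proof (rule mult_left_mono[OF _ H])
        have "cmod (\<alpha> k) * 1 \<le> cmod (\<alpha> k) * t" using that(3) by (intro mult_left_mono) auto
        then show "1 + cmod (\<alpha> k) + s + t \<le> (3 + cmod (\<alpha> k)) * t" using that(2,3) by (simp add: algebra_simps)
      qed
      then have "s * t \<le> (H * (3 + cmod (\<alpha> k))) * t" using that(1) by (simp add: mult.assoc)
      then have "s \<le> H * (3 + cmod (\<alpha> k))" using that(3) by (simp add: mult_le_cancel_right)
      then show ?thesis by (simp add: C_def algebra_simps)
    qed
    have "cmod z \<le> C \<or> cmod z' \<le> C"
    proof (rule ccontr)
      assume n: "\<not> ?thesis"
      then have "1 \<le> cmod z" "1 \<le> cmod z'" using C by auto
      then show False using n small[of "cmod z" "cmod z'"] small[of "cmod z'" "cmod z"] zH'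
        by (cases "cmod z \<le> cmod z'") (auto simp: mult.commute add_ac)
    qed
    then show "cmod (emb y k) \<le> C \<or> cmod (\<alpha> k - emb y i * emb y j - emb y k) \<le> C"
      unfolding z_def z'_def .
  qed
qed

section \<open>Two irrational coefficients\<close>

lemma integer_points_near_plane_fibres:
  assumes ij: "i0 \<noteq> j0" and irr: "\<alpha> i0 \<notin> \<rat>" "\<alpha> j0 \<notin> \<rat>"
  obtains b c C where "0 \<le> (C :: real)"
    "\<And>y. cubic \<alpha> (emb y) = \<beta> \<Longrightarrow> b I1 * y I1 + b I2 * y I2 + b I3 * y I3 = (c :: int)"
    "\<And>y. cubic \<alpha> (emb y) = \<beta> \<Longrightarrow> \<exists>i j k. distinct3 i j k \<and> b i \<noteq> 0 \<and> b j \<noteq> 0 \<and>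
       (cmod (emb y k) \<le> C \<or> (b k = 0 \<and> cmod (\<alpha> k - emb y i * emb y j - emb y k) \<le> C))"
proof -
  obtain b c where b: "b i0 \<noteq> (0 :: int)" "b j0 \<noteq> 0"
    and plane: "\<And>y. cubic \<alpha> (emb y) = \<beta> \<Longrightarrow> b I1 * y I1 + b I2 * y I2 + b I3 * y I3 = c"
    using integer_points_in_plane[OF ij irr, where \<beta> = \<beta>] by metis
  obtain k0 where d: "distinct3 i0 j0 k0" using distinct3_third[OF ij] by blast
  show thesis
  proof (cases "b k0 = 0")
    case True
    have plane2: "b i0 * y i0 + b j0 * y j0 = c" if "cubic \<alpha> (emb y) = \<beta>" for y
      using plane[OF that] sum_distinct3[OF d, of b y] True by simp
    obtain C where C: "0 \<le> C" "\<And>y. cubic \<alpha> (emb y) = \<beta> \<Longrightarrow>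
      cmod (emb y k0) \<le> C \<or> cmod (\<alpha> k0 - emb y i0 * emb y j0 - emb y k0) \<le> C"
      using plane_two_coefficients[OF d plane2 b] by metis
    show thesis by (rule that[OF C(1) plane]) (use C(2) d b True in blast)+
  next
    case False
    then have all: "b l \<noteq> 0" for l using b distinct3_cases[OF d, of l] by auto
    obtain C where C: "0 \<le> C" "\<And>y. cubic \<alpha> (emb y) = \<beta> \<Longrightarrow> \<exists>i j k. distinct3 i j k \<and> cmod (emb y k) \<le> C"
      using plane_all_coefficients[of \<alpha> \<beta> b c, OF plane all] by metis
    show thesis by (rule that[OF C(1) plane]) (use C(2) all in blast)+
  qed
qed

lemma finite_integers_in_disc: "finite {z :: int. cmod (a - of_int z) \<le> R}"
proof (rule finite_subset)
  show "{z :: int. cmod (a - of_int z) \<le> R} \<subseteq> {- \<lceil>R + cmod a\<rceil>..\<lceil>R + cmod a\<rceil>}"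
  proof
    fix z assume "z \<in> {z :: int. cmod (a - of_int z) \<le> R}"
    then have "cmod (of_int z) \<le> R + cmod a"
      using norm_triangle_ineq2[of "of_int z" a] by (simp add: norm_minus_commute)
    then have "\<bar>real_of_int z\<bar> \<le> R + cmod a" by simp
    then show "z \<in> {- \<lceil>R + cmod a\<rceil>..\<lceil>R + cmod a\<rceil>}" by (simp; linarith)
  qed
qed simp

text \<open>The bounded coordinate \<open>x\<^sub>k\<close> takes finitely many integer values. In the
second alternative the coordinate \<open>k\<close> of the neighbour differs from \<open>\<alpha>
k\<close> by an integer and is bounded, so it takes finitely many values as well. The finite set
\<open>S\<close> lists the resulting fibres.\<close>

lemma rigid_outside_finite_set:
  assumes ij: "i0 \<noteq> j0" and irr: "\<alpha> i0 \<notin> \<rat>" "\<alpha> j0 \<notin> \<rat>"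
  obtains F where "finite F" "\<And>y. cubic \<alpha> (emb y) = \<beta> \<Longrightarrow> y \<notin> F \<Longrightarrow>
    \<exists>k. rigid \<alpha> \<beta> k (emb y) \<or> rigid \<alpha> \<beta> k (vieta \<alpha> k (emb y))"
proof -
  obtain b c C where C0: "0 \<le> (C :: real)"
    and plane: "\<And>y. cubic \<alpha> (emb y) = \<beta> \<Longrightarrow> b I1 * y I1 + b I2 * y I2 + b I3 * y I3 = (c :: int)"
    and cases: "\<And>y. cubic \<alpha> (emb y) = \<beta> \<Longrightarrow> \<exists>i j k. distinct3 i j k \<and> b i \<noteq> 0 \<and> b j \<noteq> 0 \<and>
       (cmod (emb y k) \<le> C \<or> (b k = 0 \<and> cmod (\<alpha> k - emb y i * emb y j - emb y k) \<le> C))"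
    by (rule integer_points_near_plane_fibres[OF ij irr, where \<beta> = \<beta>], rule that) blast+
  have near: "near_fibre \<alpha> \<beta> C" unfolding near_fibre_def using cases by blast
  define T1 where "T1 = {z :: int. cmod (0 - of_int z) \<le> C}"
  define T2 where "T2 k = {z :: int. cmod (\<alpha> k - of_int z) \<le> C}" for k
  define S where "S = (\<Union>i\<in>{I1, I2, I3}. \<Union>j\<in>{I1, I2, I3}. \<Union>k\<in>{I1, I2, I3}.
    (\<lambda>t. (i, j, k, of_int t, c - b k * t)) ` T1 \<union> (\<lambda>z. (i, j, k, \<alpha> k - of_int z, c)) ` T2 k)"
  define Q where "Q s e \<longleftrightarrow> (case s of (i, j, k, \<tau>, c') \<Rightarrow> distinct3 i j k \<longrightarrow> b i \<noteq> 0 \<longrightarrow> b j \<noteq> 0 \<longrightarrow>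
    b i * fst e + b j * snd e = c' \<longrightarrow> cubic \<alpha> (fibre_point i j \<tau> e) = \<beta> \<longrightarrow> rigid \<alpha> \<beta> k (fibre_point i j \<tau> e))" for s e
  have T: "finite T1" "finite (T2 k)" for k unfolding T1_def T2_def by (rule finite_integers_in_disc)+
  then have "finite S" unfolding S_def by (intro finite_UN_I finite_UnI finite_imageI) simp_all
  moreover have "\<exists>H. \<forall>e. H < \<bar>fst e\<bar> + \<bar>snd e\<bar> \<longrightarrow> Q s e" if s: "s \<in> S" for s
  proof -
    obtain i j k \<tau> c' where s_eq: "s = (i, j, k, \<tau>, c')" by (cases s)
    have tau: "\<tau> \<in> \<int> \<or> \<tau> - \<alpha> k \<in> \<int>" using s unfolding s_eq S_def by auto
    show ?thesis
    proof (cases "distinct3 i j k \<and> b i \<noteq> 0 \<and> b j \<noteq> 0")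
      case True
      then have d: "distinct3 i j k" by blast
      have "\<not> (\<alpha> i \<in> \<rat> \<and> \<alpha> j \<in> \<rat>)"
        using irr ij distinct3_cases[OF d, of i0] distinct3_cases[OF d, of j0] by auto
      from fibre_line_rigid[OF d near C0 this, of "b i" "b j" \<tau> c'] True tau
      show ?thesis unfolding Q_def s_eq by auto
    next
      case False
      then show ?thesis unfolding Q_def s_eq by auto
    qed
  qed
  ultimately obtain H where H: "\<And>s e. s \<in> S \<Longrightarrow> H < \<bar>fst e\<bar> + \<bar>snd e\<bar> \<Longrightarrow> Q s e"
    using uniform_threshold[of S "\<lambda>e. \<bar>fst e\<bar> + \<bar>snd e\<bar>" Q] by blast
  define A where "A = cmod (\<alpha> I1) + cmod (\<alpha> I2) + cmod (\<alpha> I3)"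
  have A: "cmod (\<alpha> l) \<le> A" for l by (cases l) (simp_all add: A_def)
  define R where "R = max \<bar>real_of_int H\<bar> (C + A + \<bar>real_of_int H\<bar> * \<bar>real_of_int H\<bar>)"
  define F where "F = {y. \<forall>l. cmod (scaled 1 y l) \<le> R}"
  show thesis
  proof (rule that[of F])
    show "finite F" unfolding F_def by (rule finite_scaled_bounded) simp
    fix y assume y: "cubic \<alpha> (emb y) = \<beta>" and out: "y \<notin> F"
    obtain i j k where d: "distinct3 i j k" and b: "b i \<noteq> 0" "b j \<noteq> 0"
      and alt: "cmod (emb y k) \<le> C \<or> (b k = 0 \<and> cmod (\<alpha> k - emb y i * emb y j - emb y k) \<le> C)"
      using cases[OF y] by blast
    have ne: "i \<noteq> j" "i \<noteq> k" "j \<noteq> k" using d by (auto simp: distinct3_def)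
    have idx: "l \<in> {I1, I2, I3}" for l by (cases l) auto
    let ?e = "(y i, y j)"
    have eq: "b i * y i + b j * y j + b k * y k = c" using plane[OF y] by (simp only: sum_distinct3[OF d])
    have big: "H < \<bar>y i\<bar> + \<bar>y j\<bar>"
    proof (rule ccontr)
      assume "\<not> ?thesis"
      then have yij: "\<bar>real_of_int (y i)\<bar> \<le> \<bar>real_of_int H\<bar>" "\<bar>real_of_int (y j)\<bar> \<le> \<bar>real_of_int H\<bar>" by linarith+
      have prod: "cmod (emb y i * emb y j) \<le> \<bar>real_of_int H\<bar> * \<bar>real_of_int H\<bar>"
        unfolding norm_mult using yij by (intro mult_mono) (auto simp: emb_def)
      have A0: "0 \<le> A" using A[of I1] norm_ge_zero order_trans by blast
      have "cmod (emb y k) \<le> C + A + \<bar>real_of_int H\<bar> * \<bar>real_of_int H\<bar>"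
        using alt
      proof
        assume "cmod (emb y k) \<le> C"
        moreover have "0 \<le> \<bar>real_of_int H\<bar> * \<bar>real_of_int H\<bar>" by simp
        ultimately show ?thesis using A0 by linarith
      next
        assume "b k = 0 \<and> cmod (\<alpha> k - emb y i * emb y j - emb y k) \<le> C"
        then show ?thesis
          using prod A[of k] norm_triangle_ineq2[of "emb y k" "\<alpha> k - emb y i * emb y j"]
            norm_triangle_ineq4[of "\<alpha> k" "emb y i * emb y j"]
          by (simp add: norm_minus_commute)
      qed
      then have "cmod (emb y l) \<le> R" for l
        using distinct3_cases[OF d, of l] yij unfolding R_def by (auto simp: emb_def le_max_iff_disj)
      moreover have "scaled 1 y = emb y" by (simp add: scaled_def emb_def fun_eq_iff)
      ultimately show False using out by (simp add: F_def)
    qed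
    show "\<exists>k. rigid \<alpha> \<beta> k (emb y) \<or> rigid \<alpha> \<beta> k (vieta \<alpha> k (emb y))"
      using alt
    proof
      assume "cmod (emb y k) \<le> C"
      then have "y k \<in> T1" by (simp add: T1_def emb_def)
      then have "(i, j, k, of_int (y k), c - b k * y k) \<in> S"
        unfolding S_def by (intro UN_I[of i, OF idx] UN_I[of j, OF idx] UN_I[of k, OF idx] UnI1 image_eqI[of _ _ "y k"]) simp_all
      from H[OF this, of ?e] have Q: "Q (i, j, k, of_int (y k), c - b k * y k) ?e" using big by simp
      have "fibre_point i j (of_int (y k)) ?e = emb y"
        using ne by (intro idx_ext[OF d]) (simp_all add: fibre_point_def emb_def)
      then have "rigid \<alpha> \<beta> k (emb y)" using Q d b eq y unfolding Q_def by simp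
      then show ?thesis by blast
    next
      assume *: "b k = 0 \<and> cmod (\<alpha> k - emb y i * emb y j - emb y k) \<le> C"
      have split: "\<alpha> k - emb y i * emb y j - emb y k = \<alpha> k - of_int (y i * y j + y k)" by (simp add: emb_def)
      then have "y i * y j + y k \<in> T2 k" using * unfolding T2_def split by simp
      then have "(i, j, k, \<alpha> k - of_int (y i * y j + y k), c) \<in> S"
        unfolding S_def by (intro UN_I[of i, OF idx] UN_I[of j, OF idx] UN_I[of k, OF idx] UnI2
          image_eqI[of _ _ "y i * y j + y k"]) simp_all
      from H[OF this, of ?e] have Q: "Q (i, j, k, \<alpha> k - of_int (y i * y j + y k), c) ?e" using big by simp
      have dk: "distinct3 k i j" using d by (auto simp: distinct3_def)
      have "fibre_point i j (\<alpha> k - of_int (y i * y j + y k)) ?e = vieta \<alpha> k (emb y)"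
        using ne by (intro idx_ext[OF d]) (simp_all add: fibre_point_def vieta_distinct3[OF dk] emb_def)
      then have "rigid \<alpha> \<beta> k (vieta \<alpha> k (emb y))" using Q d b eq * y unfolding Q_def by simp
      then show ?thesis by blast
    qed
  qed
qed

lemma distinct3_exists: "\<exists>i j. distinct3 k i j"
proof -
  have "(if k = I1 then I2 else I1) \<noteq> k" by simp
  then have "k \<noteq> (if k = I1 then I2 else I1)" by (rule not_sym)
  then show ?thesis using distinct3_third by blast
qed

text \<open>Outside a finite set, equivalent points are equal or neighbours, which a walk of one step
detects. In the finite set, equivalence is recorded in the table. The lattice is
\<open>\<int>\<^sup>3\<close>, with all integral coefficients.\<close>

lemma two_irrational_orbits:
  assumes ij: "i0 \<noteq> j0" and irr: "\<alpha> i0 \<notin> \<rat>" "\<alpha> j0 \<notin> \<rat>"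
  shows "orbits_by_lattice_paths \<alpha> \<beta>"
proof -
  obtain F where F: "finite F" and rigid: "\<And>y. cubic \<alpha> (emb y) = \<beta> \<Longrightarrow> y \<notin> F \<Longrightarrow>
    \<exists>k. rigid \<alpha> \<beta> k (emb y) \<or> rigid \<alpha> \<beta> k (vieta \<alpha> k (emb y))"
    by (rule rigid_outside_finite_set[OF ij irr, where \<beta> = \<beta>], rule that) blast+
  define J where "J = {l. \<alpha> l \<in> \<int>}"
  define a where "a l = (SOME n. \<alpha> l = of_int n)" for l
  have a: "\<alpha> l = of_int (a l) / of_nat 1" if "l \<in> J" for l
  proof -
    have "\<alpha> l \<in> \<int>" using that by (simp add: J_def)
    then obtain n where "\<alpha> l = of_int n" by (elim Ints_cases)
    then have "\<alpha> l = of_int (a l)" unfolding a_def by (rule someI)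
    then show ?thesis by simp
  qed
  have emb1: "scaled 1 x = emb x" "scaled (Suc 0) x = emb x" for x by (simp_all add: scaled_def emb_def fun_eq_iff)
  have step: "conn 1 J a 0 x y" if xy: "emb y = emb x \<or> (\<exists>k. emb y = vieta \<alpha> k (emb x))" for x y
  proof (cases "emb y = emb x")
    case True
    have "minimal_word \<alpha> J (emb x) []" by (simp add: minimal_word_def)
    with True show ?thesis
      by (intro conn_of_short_path[where \<alpha> = \<alpha> and w = "[]" and Z = "\<lambda>_. x"] a) (simp_all add: emb1)
  next
    case False
    then obtain k where k: "emb y = vieta \<alpha> k (emb x)" using xy by blast
    have kJ: "k \<in> J"
    proof -
      obtain i j where d: "distinct3 k i j" using distinct3_exists by blast
      have "of_int (y k) = \<alpha> k - of_int (x i) * of_int (x j) - of_int (x k)"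
        using fun_cong[OF k, of k] by (simp add: vieta_distinct3[OF d] emb_def)
      then have "\<alpha> k = of_int (y k + x i * x j + x k)" by (simp add: algebra_simps)
      then show ?thesis unfolding J_def by (metis Ints_of_int mem_Collect_eq)
    qed
    have "minimal_word \<alpha> J (emb x) [k]"
      unfolding minimal_word_def
    proof (intro conjI allI impI)
      fix v assume "act \<alpha> v (emb x) = act \<alpha> [k] (emb x)"
      then have "v \<noteq> []" using False k by auto
      then show "length [k] \<le> length v" by (cases v) auto
    qed (use kJ in simp)
    with k show ?thesis
      by (intro conn_of_short_path[where \<alpha> = \<alpha> and w = "[k]" and Z = "\<lambda>t. if t = 0 then x else y"] a)
         (auto simp: emb1 le_Suc_eq)
  qed
  have exit: "emb y = emb x \<or> (\<exists>k. emb y = vieta \<alpha> k (emb x))"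
    if x: "cubic \<alpha> (emb x) = \<beta>" "x \<notin> F" and y: "cubic \<alpha> (emb y) = \<beta>" and link: "linked \<alpha> UNIV (emb x) (emb y)" for x y
  proof -
    obtain k where k: "rigid \<alpha> \<beta> k (emb x) \<or> rigid \<alpha> \<beta> k (vieta \<alpha> k (emb x))" using rigid[OF x] by blast
    then obtain p where p: "rigid \<alpha> \<beta> k p" "p = emb x \<or> p = vieta \<alpha> k (emb x)" by blast
    have "linked \<alpha> UNIV p (emb x)"
      using p(2) unfolding linked_def by (metis act_Cons act_Nil subset_UNIV vieta_vieta)
    then have "linked \<alpha> UNIV p (emb y)" using link by (rule linked_trans)
    then obtain w where w: "distinct_adj w" "act \<alpha> w p = emb y" using linked_distinct_adj by metis
    then have "w = [] \<or> w = [k]" using p(1) y unfolding rigid_def by blast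
    then have "emb y = p \<or> emb y = vieta \<alpha> k p" using w(2) by auto
    with p(2) have "emb y = emb x \<or> emb y = vieta \<alpha> k (emb x)" by auto
    then show ?thesis by blast
  qed
  define T where "T = {(x, y). x \<in> F \<and> y \<in> F \<and> linked \<alpha> UNIV (emb x) (emb y)}"
  show ?thesis
  proof (rule orbits_by_lattice_pathsI[where N = 1 and J = J and T = T and C = 0, OF _ a])
    have "T \<subseteq> F \<times> F" by (auto simp: T_def)
    then show "finite T" using F by (auto intro: finite_subset)
    show "linked \<alpha> UNIV (scaled 1 g) (scaled 1 h)" if "(g, h) \<in> T" for g h using that by (simp add: T_def emb1)
    fix x y assume x: "cubic \<alpha> (emb x) = \<beta>" and y: "cubic \<alpha> (emb y) = \<beta>"
      and link: "linked \<alpha> UNIV (emb x) (emb y)"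
    have conn: "conn 1 J a 0 (\<lambda>i. int 1 * x i) (\<lambda>i. int 1 * y i)"
      if "emb y = emb x \<or> (\<exists>k. emb y = vieta \<alpha> k (emb x))" for x y using step[OF that] by simp
    consider "x \<notin> F" | "y \<notin> F" | "x \<in> F \<and> y \<in> F" by blast
    then show "conn 1 J a 0 (\<lambda>i. int 1 * x i) (\<lambda>i. int 1 * y i) \<or>
         (\<exists>(g, h)\<in>T. conn 1 J a 0 (\<lambda>i. int 1 * x i) g \<and> conn 1 J a 0 (\<lambda>i. int 1 * y i) h)"
    proof cases
      case 1
      then show ?thesis using conn[OF exit[OF x _ y link]] by blast
    next
      case 2
      have "emb x = emb y \<or> (\<exists>k. emb x = vieta \<alpha> k (emb y))" by (rule exit[OF y 2 x linked_sym[OF link]])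
      then have "emb y = emb x \<or> (\<exists>k. emb y = vieta \<alpha> k (emb x))" by (metis vieta_vieta)
      then show ?thesis using conn by blast
    next
      case 3
      then have "(x, y) \<in> T" using link by (simp add: T_def)
      moreover have "conn 1 J a 0 (\<lambda>i. int 1 * x i) x" "conn 1 J a 0 (\<lambda>i. int 1 * y i) y"
        using step[of x x] step[of y y] by simp_all
      ultimately show ?thesis by blast
    qed
  qed simp
qed

lemma orbits_by_lattice_paths: "orbits_by_lattice_paths \<alpha> \<beta>"
proof (cases "\<exists>i j. i \<noteq> j \<and> \<alpha> i \<notin> \<rat> \<and> \<alpha> j \<notin> \<rat>")
  case True
  then show ?thesis using two_irrational_orbits by blast
next
  case two: False
  show ?thesis
  proof (cases "\<exists>k. \<alpha> k \<notin> \<rat>")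
    case True
    then obtain k where k: "\<alpha> k \<notin> \<rat>" by blast
    obtain i j where d: "distinct3 k i j" using distinct3_exists by blast
    then have "distinct3 i j k" "\<alpha> i \<in> \<rat>" "\<alpha> j \<in> \<rat>" using two k by (auto simp: distinct3_def)
    then show ?thesis using one_irrational_orbits k by blast
  next
    case False
    then show ?thesis using rational_orbits by blast
  qed
qed

section \<open>The group generated by the involutions\<close>

definition params_alpha :: "params \<Rightarrow> idx \<Rightarrow> complex" where
  "params_alpha k i = (case i of I1 \<Rightarrow> alpha1 k | I2 \<Rightarrow> alpha2 k | I3 \<Rightarrow> alpha3 k)"

lemma pt_vieta:
  "pt (vieta1 k x) = vieta (params_alpha k) I1 (pt x)"
  "pt (vieta2 k x) = vieta (params_alpha k) I2 (pt x)"
  "pt (vieta3 k x) = vieta (params_alpha k) I3 (pt x)"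
  by (cases x; auto simp: vieta_def params_alpha_def fun_eq_iff split: idx.split)+

lemma pt_inj: "pt x = pt y \<Longrightarrow> x = y"
proof -
  assume "pt x = pt y"
  then have "pt x I1 = pt y I1" "pt x I2 = pt y I2" "pt x I3 = pt y I3" by auto
  then show "x = y" by (cases x; cases y) auto
qed

lemma pt_of_int_triple: "pt (of_int_triple x) = emb (pt x)"
  by (cases x) (auto simp: emb_def fun_eq_iff split: idx.split)

lemma Gamma_word: "g \<in> carrier (Gamma k) \<Longrightarrow> \<exists>w. \<forall>x. pt (g x) = act (params_alpha k) w (pt x)"
proof (induction rule: Gamma_induct)
  case one
  show ?case by (rule exI[of _ "[]"]) simp
next
  case vieta1
  show ?case by (rule exI[of _ "[I1]"]) (simp add: pt_vieta)
next
  case vieta2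
  show ?case by (rule exI[of _ "[I2]"]) (simp add: pt_vieta)
next
  case vieta3
  show ?case by (rule exI[of _ "[I3]"]) (simp add: pt_vieta)
next
  case (mult g h)
  then obtain v w where "\<forall>x. pt (g x) = act (params_alpha k) v (pt x)" "\<forall>x. pt (h x) = act (params_alpha k) w (pt x)"
    by blast
  then show ?case by (intro exI[of _ "w @ v"]) (simp del: split_paired_All)
qed

lemma word_Gamma: "\<exists>g\<in>carrier (Gamma k). pt (g x) = act (params_alpha k) w (pt x)"
proof (induction w rule: rev_induct)
  case Nil
  have "\<one>\<^bsub>Gamma k\<^esub> \<in> carrier (Gamma k)" using group.is_monoid[OF group_Gamma] by (rule monoid.one_closed)
  moreover have "\<one>\<^bsub>Gamma k\<^esub> = (\<lambda>x. x)" by (simp add: Gamma_def BijGroup_def restrict_def)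
  ultimately show ?case by (intro bexI[of _ "\<lambda>x. x"]) simp_all
next
  case (snoc i w)
  then obtain g where g: "g \<in> carrier (Gamma k)" "pt (g x) = act (params_alpha k) w (pt x)" by blast
  define h where "h = (case i of I1 \<Rightarrow> vieta1 k | I2 \<Rightarrow> vieta2 k | I3 \<Rightarrow> vieta3 k)"
  have hS: "h \<in> {vieta1 k, vieta2 k, vieta3 k}" by (simp add: h_def split: idx.split)
  then have h: "h \<in> carrier (Gamma k)" unfolding carrier_Gamma by (rule generate.incl)
  have "h \<otimes>\<^bsub>Gamma k\<^esub> g \<in> carrier (Gamma k)"
    using group.is_monoid[OF group_Gamma] h g(1) by (rule monoid.m_closed)
  moreover have "h \<in> carrier (BijGroup UNIV)" using hS vieta_in_BijGroup[of k] by blast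
  moreover have "g \<in> carrier (BijGroup UNIV)"
    using g(1) group.generate_in_carrier[OF group_BijGroup vieta_in_BijGroup[of k]] unfolding carrier_Gamma by blast
  ultimately have "h \<otimes>\<^bsub>Gamma k\<^esub> g \<in> carrier (Gamma k)" "h \<in> Bij UNIV" "g \<in> Bij UNIV"
    by (simp_all add: BijGroup_def)
  moreover from this(2,3) have "h \<otimes>\<^bsub>Gamma k\<^esub> g = h \<circ> g"
    by (simp add: Gamma_def BijGroup_def compose_def comp_def restrict_def)
  moreover have "pt (h y) = vieta (params_alpha k) i (pt y)" for y
    by (cases i) (simp_all add: h_def pt_vieta)
  ultimately show ?case using g(2) by (intro bexI[of _ "h \<circ> g"]) auto
qed

lemma same_orbit_iff_linked:
  "same_orbit k x y \<longleftrightarrow> linked (params_alpha k) UNIV (emb (pt x)) (emb (pt y))"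
proof
  assume "same_orbit k x y"
  then obtain g where g: "g \<in> carrier (Gamma k)" "of_int_triple y = g (of_int_triple x)"
    unfolding same_orbit_def orbit_def by auto
  then show "linked (params_alpha k) UNIV (emb (pt x)) (emb (pt y))"
    using Gamma_word[OF g(1)] unfolding linked_def by (metis pt_of_int_triple subset_UNIV)
next
  assume "linked (params_alpha k) UNIV (emb (pt x)) (emb (pt y))"
  then obtain w where "act (params_alpha k) w (pt (of_int_triple x)) = pt (of_int_triple y)"
    unfolding linked_def pt_of_int_triple by blast
  then obtain g where g: "g \<in> carrier (Gamma k)" "pt (g (of_int_triple x)) = pt (of_int_triple y)"
    using word_Gamma[of k "of_int_triple x" w] by auto
  have "of_int_triple y = g (of_int_triple x)" using pt_inj[OF g(2)] by simp
  then show "same_orbit k x y" unfolding same_orbit_def orbit_def using g(1) by blast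
qed

lemma integer_points_cubic: "x \<in> integer_points k \<longleftrightarrow> cubic (params_alpha k) (emb (pt x)) = beta k"
  by (cases x) (auto simp: integer_points_def surface_def cubic_def params_alpha_def emb_def algebra_simps)

theorem theorem1p2:
  fixes k :: "complex \<times> complex \<times> complex \<times> complex"
  shows "decidable_on (integer_points k) (same_orbit k)"
proof -
  obtain N J a C T where T: "finite T" and eq: "\<And>x y. cubic (params_alpha k) (emb x) = beta k \<Longrightarrow>
      cubic (params_alpha k) (emb y) = beta k \<Longrightarrow>
      linked (params_alpha k) UNIV (emb x) (emb y) \<longleftrightarrow>
        conn N J a C (\<lambda>i. int N * x i) (\<lambda>i. int N * y i) \<or>
        (\<exists>(g, h)\<in>T. conn N J a C (\<lambda>i. int N * x i) g \<and> conn N J a C (\<lambda>i. int N * y i) h)"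
    using orbits_by_lattice_paths[of "params_alpha k" "beta k"] unfolding orbits_by_lattice_paths_def by metis
  show ?thesis
    by (rule decidable_on_template[OF T]) (simp only: same_orbit_iff_linked integer_points_cubic eq)
qed

end
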